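(* Let $M$ be a smooth 3-manifold with an enriched path structure $(T^1,T^2,L)$ and let $p_2:Y_2\to M$ be its adapted coframe bundle, with tautological forms $\omega,\omega^1,\omega^2$. Let $\mathfrak b\subset\mathfrak{sl}(3,\mathbb R)$ be the Lie algebra of trace-free lower triangular matrices. Then there exists a unique Cartan connection $\pi_2$ on $Y_2$ with values in $\mathfrak b$ of the form $$\pi_2=\begin{pmatrix}\phi+w&0&0\\ \omega^1&-2w&0\\ \omega&\omega^2&-\phi+w\end{pmatrix}$$ whose curvature is of the form $$\Pi_2=d\pi_2+\pi_2\wedge\pi_2=\begin{pmatrix}\omega\wedge\psi+W&0&0\\ \tau^1_2\,\omega\wedge\omega^2&-2W&0\\ 0&-\tau^2_1\,\omega\wedge\omega^1&-\omega\wedge\psi+W\end{pmatrix},$$ where $W=C\,\omega\wedge\omega^1+D\,\omega\wedge\omega^2+S\,\omega^1\wedge\omega^2$ and $\psi=A\,\omega^1+B\,\omega^2$ for some functions $A,B,C,D,S,\tau^1_2,\tau^2_1$ on $Y_2$.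
   Context: A path structure on a smooth 3-manifold $M$ is a pair of line subbundles $T^1,T^2\subset TM$ with $T^1\cap T^2=\{0\}$ such that $D=T^1\oplus T^2$ is a contact distribution (locally $D=\ker\theta$ with $\theta\wedge d\theta$ nowhere zero). An enriched path structure is a path structure together with a line subbundle $L\subset TM$ with $TM=T^1\oplus T^2\oplus L$. The adapted coframe bundle $p_2:Y_2\to M$ has as fibre over $x$ the set of coframes $(\omega,\omega^1,\omega^2)$ of $T_x^*M$ such that $\ker\omega=D_x$, $\omega^1$ vanishes on $T^2\oplus L$, $\omega^2$ vanishes on $T^1\oplus L$, and $d\omega|_{D}=(\omega^1\wedge\omega^2)|_{D}$ (extend $\omega$ to any local 1-form with kernel $D$; the condition does not depend on the extension). It is a principal bundle with group $P_2=\{\mathrm{diag}(a,\tfrac1{ab},b): a,b\in\mathbb R^*\}\subset SL(3,\mathbb R)$, isomorphic to $(\mathbb R^* )^2$, acting on the right by $(\omega,\omega^1,\omega^2)\mapsto(\tfrac ab\,\omega,\ a^2b\,\omega^1,\ \tfrac1{ab^2}\,\omega^2)$. The tautological 1-forms on $Y_2$ are again denoted $\omega,\omega^1,\omega^2$: at the point $(\omega,\omega^1,\omega^2)$ they are the pull-backs of these covectors by $p_2$. A Cartan connection on $Y_2$ with values in $\mathfrak b$ is a $\mathfrak b$-valued 1-form which is a linear isomorphism $T_uY_2\to\mathfrak b$ at each $u$, satisfies $R_h^*\pi_2=h^{-1}\pi_2h$ for $h\in P_2$, and takes the value $X$ on the fundamental vector field of each $X$ in the Lie algebra of $P_2$.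 *)

theory Defs
  imports "HOL-Analysis.Analysis"
begin

section \<open>Smooth maps between open subsets of normed spaces\<close>

text \<open>Meant for open \<open>S\<close>: \<open>C_k_on k S f\<close> says that \<open>f\<close> is \<open>k\<close> times continuously
  differentiable on \<open>S\<close>.\<close>

fun C_k_on :: "nat \<Rightarrow> 'a::real_normed_vector set \<Rightarrow> ('a \<Rightarrow> 'b::real_normed_vector) \<Rightarrow> bool" where
  "C_k_on 0 S f \<longleftrightarrow> continuous_on S f"
| "C_k_on (Suc k) S f \<longleftrightarrow> (\<forall>x\<in>S. f differentiable (at x)) \<and>
     (\<forall>v. C_k_on k S (\<lambda>x. frechet_derivative f (at x) v))"

definition smooth_on :: "'a::real_normed_vector set \<Rightarrow> ('a \<Rightarrow> 'b::real_normed_vector) \<Rightarrow> bool" where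
  "smooth_on S f \<longleftrightarrow> (\<forall>k. C_k_on k S f)"


section \<open>Smooth manifolds\<close>

text \<open>A chart is a domain together with a coordinate map; the values of the coordinate map outside
  the domain are irrelevant. A manifold is given by an atlas; its point set is the union of the
  chart domains and its topology is the one induced by the atlas. The dimension is that of the
  model space \<open>'e\<close>.\<close>

type_synonym ('a, 'e) chart = "'a set \<times> ('a \<Rightarrow> 'e)"
type_synonym ('a, 'e) atlas = "('a, 'e) chart set"

abbreviation dom_of :: "('a, 'e) chart \<Rightarrow> 'a set" where "dom_of c \<equiv> fst c"
abbreviation coords :: "('a, 'e) chart \<Rightarrow> 'a \<Rightarrow> 'e" where "coords c \<equiv> snd c"

definition param :: "('a, 'e) chart \<Rightarrow> 'e \<Rightarrow> 'a" where
  "param c = inv_into (dom_of c) (coords c)"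

definition points :: "('a, 'e) atlas \<Rightarrow> 'a set" where
  "points \<A> = (\<Union>c\<in>\<A>. dom_of c)"

definition smooth_atlas :: "('a, 'e::euclidean_space) atlas \<Rightarrow> bool" where
  "smooth_atlas \<A> \<longleftrightarrow>
     (\<forall>c\<in>\<A>. inj_on (coords c) (dom_of c) \<and> open (coords c ` dom_of c)) \<and>
     (\<forall>c\<in>\<A>. \<forall>d\<in>\<A>. open (coords c ` (dom_of c \<inter> dom_of d)) \<and>
        smooth_on (coords c ` (dom_of c \<inter> dom_of d)) (coords d \<circ> param c))"

definition mtopology :: "('a, 'e::euclidean_space) atlas \<Rightarrow> 'a topology" where
  "mtopology \<A> =
     topology (\<lambda>U. U \<subseteq> points \<A> \<and> (\<forall>c\<in>\<A>. open (coords c ` (U \<inter> dom_of c))))"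

lemma openin_mtopology:
  assumes "smooth_atlas \<A>"
  shows "openin (mtopology \<A>) U \<longleftrightarrow>
    U \<subseteq> points \<A> \<and> (\<forall>c\<in>\<A>. open (coords c ` (U \<inter> dom_of c)))"
proof -
  have "istopology (\<lambda>U. U \<subseteq> points \<A> \<and> (\<forall>c\<in>\<A>. open (coords c ` (U \<inter> dom_of c))))"
    unfolding istopology_def
  proof (intro conjI allI impI ballI)
    fix S T c
    assume S: "S \<subseteq> points \<A> \<and> (\<forall>c\<in>\<A>. open (coords c ` (S \<inter> dom_of c)))"
      and T: "T \<subseteq> points \<A> \<and> (\<forall>c\<in>\<A>. open (coords c ` (T \<inter> dom_of c)))"
      and c: "c \<in> \<A>"
    have "inj_on (coords c) (dom_of c)"
      using assms c by (auto simp: smooth_atlas_def)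
    then have "coords c ` ((S \<inter> dom_of c) \<inter> (T \<inter> dom_of c)) =
        coords c ` (S \<inter> dom_of c) \<inter> coords c ` (T \<inter> dom_of c)"
      by (rule inj_on_image_Int) auto
    moreover have "(S \<inter> dom_of c) \<inter> (T \<inter> dom_of c) = S \<inter> T \<inter> dom_of c" by auto
    ultimately show "open (coords c ` (S \<inter> T \<inter> dom_of c))"
      using S T c by (metis open_Int)
  next
    fix \<K> c
    assume K: "\<forall>K\<in>\<K>. K \<subseteq> points \<A> \<and> (\<forall>c\<in>\<A>. open (coords c ` (K \<inter> dom_of c)))"
      and c: "c \<in> \<A>"
    have "coords c ` (\<Union>\<K> \<inter> dom_of c) = (\<Union>K\<in>\<K>. coords c ` (K \<inter> dom_of c))" by auto
    then show "open (coords c ` (\<Union>\<K> \<inter> dom_of c))"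
      using K c by auto
  qed auto
  then show ?thesis
    unfolding mtopology_def by (subst topology_inverse') auto
qed

definition smooth_manifold :: "('a, 'e::euclidean_space) atlas \<Rightarrow> bool" where
  "smooth_manifold \<A> \<longleftrightarrow> smooth_atlas \<A> \<and>
     Hausdorff_space (mtopology \<A>) \<and> second_countable (mtopology \<A>)"


section \<open>Tangent vectors, vector fields and differential forms\<close>

text \<open>The tangent space at every point is a copy of the model space \<open>'e\<close>: a tangent vector at \<open>p\<close>
  is recorded by its components in one preferred chart \<open>chart_at \<A> p\<close> around \<open>p\<close>. The choice
  need not depend continuously on \<open>p\<close>; smoothness is always expressed through the components
  with respect to one fixed chart of the atlas.\<close>

definition chart_at :: "('a, 'e) atlas \<Rightarrow> 'a \<Rightarrow> ('a, 'e) chart" where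
  "chart_at \<A> p = (SOME c. c \<in> \<A> \<and> p \<in> dom_of c)"

text \<open>Components in the chart \<open>c\<close> of the tangent vector \<open>v\<close> at \<open>p\<close>.\<close>

definition comps :: "('a, 'e::euclidean_space) atlas \<Rightarrow> ('a, 'e) chart \<Rightarrow> 'a \<Rightarrow> 'e \<Rightarrow> 'e" where
  "comps \<A> c p v =
     frechet_derivative (coords c \<circ> param (chart_at \<A> p)) (at (coords (chart_at \<A> p) p)) v"

text \<open>Conversely, the tangent vector at \<open>p\<close> with components \<open>w\<close> in the chart \<open>c\<close>.\<close>

definition tvec :: "('a, 'e::euclidean_space) atlas \<Rightarrow> ('a, 'e) chart \<Rightarrow> 'a \<Rightarrow> 'e \<Rightarrow> 'e" where
  "tvec \<A> c p w = frechet_derivative (coords (chart_at \<A> p) \<circ> param c) (at (coords c p)) w"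

text \<open>The tangent map at \<open>p\<close> of a map between manifolds, and the velocity of a curve.\<close>

definition tangent_map ::
    "('a, 'e::euclidean_space) atlas \<Rightarrow> ('b, 'f::euclidean_space) atlas \<Rightarrow> ('a \<Rightarrow> 'b) \<Rightarrow>
     'a \<Rightarrow> 'e \<Rightarrow> 'f" where
  "tangent_map \<A> \<B> f p v =
     frechet_derivative (coords (chart_at \<B> (f p)) \<circ> f \<circ> param (chart_at \<A> p))
       (at (coords (chart_at \<A> p) p)) v"

definition velocity ::
    "('a, 'e::euclidean_space) atlas \<Rightarrow> (real \<Rightarrow> 'a) \<Rightarrow> real \<Rightarrow> 'e" where
  "velocity \<A> \<gamma> t = vector_derivative (coords (chart_at \<A> (\<gamma> t)) \<circ> \<gamma>) (at t)"

definition smooth_fun ::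
    "('a, 'e::euclidean_space) atlas \<Rightarrow> 'a set \<Rightarrow> ('a \<Rightarrow> 'v::real_normed_vector) \<Rightarrow> bool" where
  "smooth_fun \<A> U f \<longleftrightarrow> (\<forall>c\<in>\<A>. smooth_on (coords c ` (U \<inter> dom_of c)) (f \<circ> param c))"

definition smooth_field ::
    "('a, 'e::euclidean_space) atlas \<Rightarrow> 'a set \<Rightarrow> ('a \<Rightarrow> 'e) \<Rightarrow> bool" where
  "smooth_field \<A> U X \<longleftrightarrow> (\<forall>c\<in>\<A>. smooth_on (coords c ` (U \<inter> dom_of c))
     (\<lambda>y. comps \<A> c (param c y) (X (param c y))))"

text \<open>The local expression of a 1-form in a chart \<open>c\<close>: its value at the point with coordinates
  \<open>y\<close> on the constant coordinate field \<open>w\<close>.\<close>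

definition local_form ::
    "('a, 'e::euclidean_space) atlas \<Rightarrow> ('a, 'e) chart \<Rightarrow> ('a \<Rightarrow> 'e \<Rightarrow> 'v) \<Rightarrow> 'e \<Rightarrow> 'e \<Rightarrow> 'v" where
  "local_form \<A> c \<alpha> y w = \<alpha> (param c y) (tvec \<A> c (param c y) w)"

definition smooth_form1 ::
    "('a, 'e::euclidean_space) atlas \<Rightarrow> 'a set \<Rightarrow> ('a \<Rightarrow> 'e \<Rightarrow> 'v::real_normed_vector) \<Rightarrow> bool" where
  "smooth_form1 \<A> U \<alpha> \<longleftrightarrow> (\<forall>p\<in>U. linear (\<alpha> p)) \<and>
     (\<forall>c\<in>\<A>. \<forall>w. smooth_on (coords c ` (U \<inter> dom_of c)) (\<lambda>y. local_form \<A> c \<alpha> y w))"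

text \<open>Conventions: \<open>d\<alpha>(X,Y) = X(\<alpha>(Y)) - Y(\<alpha>(X)) - \<alpha>([X,Y])\<close> and
  \<open>(\<alpha> \<and> \<beta>)(X,Y) = \<alpha>(X)\<beta>(Y) - \<alpha>(Y)\<beta>(X)\<close>. In \<open>ext_d\<close> the vectors are extended to constant
  coordinate fields, so the bracket term disappears.\<close>

definition ext_d ::
    "('a, 'e::euclidean_space) atlas \<Rightarrow> ('a \<Rightarrow> 'e \<Rightarrow> 'v::real_normed_vector) \<Rightarrow>
     'a \<Rightarrow> 'e \<Rightarrow> 'e \<Rightarrow> 'v" where
  "ext_d \<A> \<alpha> p v w =
     (let c = chart_at \<A> p in
        frechet_derivative (\<lambda>y. local_form \<A> c \<alpha> y w) (at (coords c p)) v -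
        frechet_derivative (\<lambda>y. local_form \<A> c \<alpha> y v) (at (coords c p)) w)"

definition wedge :: "('a \<Rightarrow> 'e \<Rightarrow> real) \<Rightarrow> ('a \<Rightarrow> 'e \<Rightarrow> real) \<Rightarrow> 'a \<Rightarrow> 'e \<Rightarrow> 'e \<Rightarrow> real" where
  "wedge \<alpha> \<beta> p v w = \<alpha> p v * \<beta> p w - \<alpha> p w * \<beta> p v"

definition wedge12 ::
    "('a \<Rightarrow> 'e \<Rightarrow> real) \<Rightarrow> ('a \<Rightarrow> 'e \<Rightarrow> 'e \<Rightarrow> real) \<Rightarrow> 'a \<Rightarrow> 'e \<Rightarrow> 'e \<Rightarrow> 'e \<Rightarrow> real" where
  "wedge12 \<alpha> \<beta> p u v w = \<alpha> p u * \<beta> p v w + \<alpha> p v * \<beta> p w u + \<alpha> p w * \<beta> p u v"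

definition matrix_wedge ::
    "('a \<Rightarrow> 'e \<Rightarrow> real^'n^'n) \<Rightarrow> ('a \<Rightarrow> 'e \<Rightarrow> real^'n^'n) \<Rightarrow> 'a \<Rightarrow> 'e \<Rightarrow> 'e \<Rightarrow> real^'n^'n" where
  "matrix_wedge \<alpha> \<beta> p v w = \<alpha> p v ** \<beta> p w - \<alpha> p w ** \<beta> p v"


section \<open>Enriched path structures on 3-manifolds\<close>

definition line_subbundle :: "('m, real^3) atlas \<Rightarrow> ('m \<Rightarrow> (real^3) set) \<Rightarrow> bool" where
  "line_subbundle \<A> T \<longleftrightarrow>
     (\<forall>x \<in> points \<A>. subspace (T x) \<and> dim (T x) = 1) \<and>
     (\<forall>x \<in> points \<A>. \<exists>U X. openin (mtopology \<A>) U \<and> x \<in> U \<and> smooth_field \<A> U X \<and>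
        (\<forall>y\<in>U. T y = span {X y}))"

definition bundle_sum ::
    "('m \<Rightarrow> 'e::real_vector set) \<Rightarrow> ('m \<Rightarrow> 'e set) \<Rightarrow> 'm \<Rightarrow> 'e set" where
  "bundle_sum S T x = {v + w | v w. v \<in> S x \<and> w \<in> T x}"

definition contact_distribution :: "('m, real^3) atlas \<Rightarrow> ('m \<Rightarrow> (real^3) set) \<Rightarrow> bool" where
  "contact_distribution \<A> D \<longleftrightarrow>
     (\<forall>x \<in> points \<A>. \<exists>U \<theta>. openin (mtopology \<A>) U \<and> x \<in> U \<and> smooth_form1 \<A> U \<theta> \<and>
        (\<forall>y\<in>U. D y = {v. \<theta> y v = 0}) \<and>
        (\<forall>y\<in>U. \<exists>u v w. wedge12 \<theta> (ext_d \<A> \<theta>) y u v w \<noteq> 0))"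

definition path_structure ::
    "('m, real^3) atlas \<Rightarrow> ('m \<Rightarrow> (real^3) set) \<Rightarrow> ('m \<Rightarrow> (real^3) set) \<Rightarrow> bool" where
  "path_structure \<A> T1 T2 \<longleftrightarrow> line_subbundle \<A> T1 \<and> line_subbundle \<A> T2 \<and>
     (\<forall>x \<in> points \<A>. T1 x \<inter> T2 x = {0}) \<and>
     contact_distribution \<A> (bundle_sum T1 T2)"

definition enriched_path_structure ::
    "('m, real^3) atlas \<Rightarrow> ('m \<Rightarrow> (real^3) set) \<Rightarrow> ('m \<Rightarrow> (real^3) set) \<Rightarrow>
     ('m \<Rightarrow> (real^3) set) \<Rightarrow> bool" where
  "enriched_path_structure \<A> T1 T2 L \<longleftrightarrow> path_structure \<A> T1 T2 \<and> line_subbundle \<A> L \<and>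
     (\<forall>x \<in> points \<A>. bundle_sum T1 T2 x \<inter> L x = {0} \<and>
        bundle_sum (bundle_sum T1 T2) L x = UNIV)"


section \<open>The group \<open>P\<^sub>2\<close> and the algebra \<open>\<bb>\<close>\<close>

definition mat3 :: "real \<Rightarrow> real \<Rightarrow> real \<Rightarrow> real \<Rightarrow> real \<Rightarrow> real \<Rightarrow> real \<Rightarrow> real \<Rightarrow> real \<Rightarrow> real^3^3" where
  "mat3 a11 a12 a13 a21 a22 a23 a31 a32 a33 =
     vector [vector [a11, a12, a13], vector [a21, a22, a23], vector [a31, a32, a33]]"

definition diag3 :: "real \<Rightarrow> real \<Rightarrow> real \<Rightarrow> real^3^3" where
  "diag3 a b c = mat3 a 0 0  0 b 0  0 0 c"

definition P2 :: "(real^3^3) set" where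
  "P2 = {diag3 a (1 / (a * b)) b | a b. a \<noteq> 0 \<and> b \<noteq> 0}"

definition lie_P2 :: "(real^3^3) set" where
  "lie_P2 = {diag3 s (- (s + t)) t | s t. True}"

text \<open>\<open>one_param X r\<close> is \<open>exp (r X)\<close> for a diagonal matrix \<open>X\<close>.\<close>

definition one_param :: "real^3^3 \<Rightarrow> real \<Rightarrow> real^3^3" where
  "one_param X r = diag3 (exp (r * X$1$1)) (exp (r * X$2$2)) (exp (r * X$3$3))"

text \<open>The entries above the diagonal are listed one by one because in the index type \<open>3\<close>
  the numeral \<open>3\<close> equals \<open>0\<close>.\<close>

definition lie_b :: "(real^3^3) set" where
  "lie_b = {X. X$1$2 = 0 \<and> X$1$3 = 0 \<and> X$2$3 = 0 \<and> trace X = 0}"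


section \<open>The adapted coframe bundle\<close>

type_synonym covector = "real^3 \<Rightarrow> real"
type_synonym coframe = "covector \<times> covector \<times> covector"
type_synonym 'm coframe_point = "'m \<times> coframe"

definition is_coframe :: "coframe \<Rightarrow> bool" where
  "is_coframe = (\<lambda>(\<omega>, \<omega>1, \<omega>2). linear \<omega> \<and> linear \<omega>1 \<and> linear \<omega>2 \<and>
     (\<forall>r s t. (\<forall>v. r * \<omega> v + s * \<omega>1 v + t * \<omega>2 v = 0) \<longrightarrow> r = 0 \<and> s = 0 \<and> t = 0))"

definition adapted_coframes ::
    "('m, real^3) atlas \<Rightarrow> ('m \<Rightarrow> (real^3) set) \<Rightarrow> ('m \<Rightarrow> (real^3) set) \<Rightarrow>
     ('m \<Rightarrow> (real^3) set) \<Rightarrow> 'm \<Rightarrow> coframe set" where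
  "adapted_coframes \<A> T1 T2 L x = {(\<omega>, \<omega>1, \<omega>2).
     is_coframe (\<omega>, \<omega>1, \<omega>2) \<and>
     {v. \<omega> v = 0} = bundle_sum T1 T2 x \<and>
     (\<forall>v \<in> bundle_sum T2 L x. \<omega>1 v = 0) \<and>
     (\<forall>v \<in> bundle_sum T1 L x. \<omega>2 v = 0) \<and>
     (\<exists>U \<theta>. openin (mtopology \<A>) U \<and> x \<in> U \<and> smooth_form1 \<A> U \<theta> \<and> \<theta> x = \<omega> \<and>
        (\<forall>y\<in>U. {v. \<theta> y v = 0} = bundle_sum T1 T2 y) \<and>
        (\<forall>v \<in> bundle_sum T1 T2 x. \<forall>w \<in> bundle_sum T1 T2 x.
           ext_d \<A> \<theta> x v w = \<omega>1 v * \<omega>2 w - \<omega>1 w * \<omega>2 v))}"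

definition coframe_bundle ::
    "('m, real^3) atlas \<Rightarrow> ('m \<Rightarrow> (real^3) set) \<Rightarrow> ('m \<Rightarrow> (real^3) set) \<Rightarrow>
     ('m \<Rightarrow> (real^3) set) \<Rightarrow> 'm coframe_point set" where
  "coframe_bundle \<A> T1 T2 L =
     {(x, \<sigma>). x \<in> points \<A> \<and> \<sigma> \<in> adapted_coframes \<A> T1 T2 L x}"

text \<open>The right action of \<open>h = diag(a, 1/(ab), b)\<close>, with \<open>a = h$1$1\<close> and \<open>b = h$3$3\<close>.\<close>

definition coframe_act :: "coframe \<Rightarrow> real^3^3 \<Rightarrow> coframe" where
  "coframe_act = (\<lambda>(\<omega>, \<omega>1, \<omega>2) h.
     ((\<lambda>v. h$1$1 / h$3$3 * \<omega> v),
      (\<lambda>v. (h$1$1)^2 * h$3$3 * \<omega>1 v),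
      (\<lambda>v. 1 / (h$1$1 * (h$3$3)^2) * \<omega>2 v)))"

definition right_act :: "real^3^3 \<Rightarrow> 'm coframe_point \<Rightarrow> 'm coframe_point" where
  "right_act h = (\<lambda>(x, \<sigma>). (x, coframe_act \<sigma> h))"

definition smooth_adapted_section ::
    "('m, real^3) atlas \<Rightarrow> ('m \<Rightarrow> (real^3) set) \<Rightarrow> ('m \<Rightarrow> (real^3) set) \<Rightarrow>
     ('m \<Rightarrow> (real^3) set) \<Rightarrow> 'm set \<Rightarrow> ('m \<Rightarrow> coframe) \<Rightarrow> bool" where
  "smooth_adapted_section \<A> T1 T2 L U \<sigma> \<longleftrightarrow>
     (\<forall>x\<in>U. \<sigma> x \<in> adapted_coframes \<A> T1 T2 L x) \<and>
     smooth_form1 \<A> U (\<lambda>x. fst (\<sigma> x)) \<and>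
     smooth_form1 \<A> U (\<lambda>x. fst (snd (\<sigma> x))) \<and>
     smooth_form1 \<A> U (\<lambda>x. snd (snd (\<sigma> x)))"

text \<open>The smooth structure of the principal bundle: for a chart \<open>c\<close> of \<open>M\<close> and a smooth local
  section \<open>\<sigma>\<close> over an open part \<open>U\<close> of its domain, the point
  \<open>\<sigma>(x) \<cdot> diag(a, 1/(ab), b)\<close> has coordinates \<open>(c(x), a, b)\<close>.\<close>

definition bundle_chart ::
    "('m, real^3) atlas \<Rightarrow> ('m \<Rightarrow> (real^3) set) \<Rightarrow> ('m \<Rightarrow> (real^3) set) \<Rightarrow>
     ('m \<Rightarrow> (real^3) set) \<Rightarrow> ('m, real^3) chart \<Rightarrow> 'm set \<Rightarrow> ('m \<Rightarrow> coframe) \<Rightarrow>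
     ('m coframe_point, (real^3) \<times> real \<times> real) chart" where
  "bundle_chart \<A> T1 T2 L c U \<sigma> =
     ({u \<in> coframe_bundle \<A> T1 T2 L. fst u \<in> U},
      (\<lambda>u. (coords c (fst u),
        (THE (a, b). a \<noteq> 0 \<and> b \<noteq> 0 \<and>
           snd u = coframe_act (\<sigma> (fst u)) (diag3 a (1 / (a * b)) b)))))"

definition coframe_atlas ::
    "('m, real^3) atlas \<Rightarrow> ('m \<Rightarrow> (real^3) set) \<Rightarrow> ('m \<Rightarrow> (real^3) set) \<Rightarrow>
     ('m \<Rightarrow> (real^3) set) \<Rightarrow> ('m coframe_point, (real^3) \<times> real \<times> real) atlas" where
  "coframe_atlas \<A> T1 T2 L =
     {bundle_chart \<A> T1 T2 L c U \<sigma> | c U \<sigma>. c \<in> \<A> \<and> openin (mtopology \<A>) U \<and>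
        U \<subseteq> dom_of c \<and> smooth_adapted_section \<A> T1 T2 L U \<sigma>}"

text \<open>The tautological forms on a manifold of coframes with atlas \<open>\<Y>\<close>; the projection to \<open>M\<close>
  is \<open>fst\<close>.\<close>

definition taut ::
    "('m, real^3) atlas \<Rightarrow> ('m coframe_point, 'e::euclidean_space) atlas \<Rightarrow>
     'm coframe_point \<Rightarrow> 'e \<Rightarrow> real" where
  "taut \<A> \<Y> u v = fst (snd u) (tangent_map \<Y> \<A> fst u v)"

definition taut1 ::
    "('m, real^3) atlas \<Rightarrow> ('m coframe_point, 'e::euclidean_space) atlas \<Rightarrow>
     'm coframe_point \<Rightarrow> 'e \<Rightarrow> real" where
  "taut1 \<A> \<Y> u v = fst (snd (snd u)) (tangent_map \<Y> \<A> fst u v)"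

definition taut2 ::
    "('m, real^3) atlas \<Rightarrow> ('m coframe_point, 'e::euclidean_space) atlas \<Rightarrow>
     'm coframe_point \<Rightarrow> 'e \<Rightarrow> real" where
  "taut2 \<A> \<Y> u v = snd (snd (snd u)) (tangent_map \<Y> \<A> fst u v)"


section \<open>Cartan connections\<close>

definition fundamental_field ::
    "('m coframe_point, 'e::euclidean_space) atlas \<Rightarrow> real^3^3 \<Rightarrow> 'm coframe_point \<Rightarrow> 'e" where
  "fundamental_field \<Y> X u = velocity \<Y> (\<lambda>r. right_act (one_param X r) u) 0"

definition cartan_connection ::
    "('m coframe_point, 'e::euclidean_space) atlas \<Rightarrow> 'm coframe_point set \<Rightarrow>
     ('m coframe_point \<Rightarrow> 'e \<Rightarrow> real^3^3) \<Rightarrow> bool" where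
  "cartan_connection \<Y> Y \<pi> \<longleftrightarrow>
     smooth_form1 \<Y> Y \<pi> \<and>
     (\<forall>u\<in>Y. bij_betw (\<pi> u) UNIV lie_b) \<and>
     (\<forall>h\<in>P2. \<forall>u\<in>Y. \<forall>v. \<pi> (right_act h u) (tangent_map \<Y> \<Y> (right_act h) u v) =
        matrix_inv h ** \<pi> u v ** h) \<and>
     (\<forall>X\<in>lie_P2. \<forall>u\<in>Y. \<pi> u (fundamental_field \<Y> X u) = X)"

definition curvature ::
    "('a, 'e::euclidean_space) atlas \<Rightarrow> ('a \<Rightarrow> 'e \<Rightarrow> real^'n^'n) \<Rightarrow>
     'a \<Rightarrow> 'e \<Rightarrow> 'e \<Rightarrow> real^'n^'n" where
  "curvature \<Y> \<pi> u v w = ext_d \<Y> \<pi> u v w + matrix_wedge \<pi> \<pi> u v w"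

end

theory Submission
  imports Defs
begin

text \<open>
  With \<open>\<pi>\<close> of the prescribed shape, the entries of the curvature below the diagonal are the structure
  equations \<open>d\<omega> = \<omega>\<^sup>1 \<and> \<omega>\<^sup>2 + 2 \<phi> \<and> \<omega>\<close>, \<open>d\<omega>\<^sup>1 = (\<phi> + 3 w) \<and> \<omega>\<^sup>1 + \<tau>\<^sup>1 \<omega> \<and> \<omega>\<^sup>2\<close> and
  \<open>d\<omega>\<^sup>2 = (\<phi> - 3 w) \<and> \<omega>\<^sup>2 - \<tau>\<^sup>2 \<omega> \<and> \<omega>\<^sup>1\<close>, and by linear algebra they determine \<open>\<phi>\<close>, \<open>w\<close> and the
  torsions at every point of the bundle. In the trivialisation of the bundle by an adapted
  coframe \<open>\<beta>\<close> on the base the solution is \<open>\<phi> = \<phi>\<^sub>0 + (da/a - db/b)/2\<close>, \<open>w = w\<^sub>0 + (da/a + db/b)/2\<close>,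
  where \<open>\<phi>\<^sub>0\<close>, \<open>w\<^sub>0\<close> are explicit combinations of \<open>\<beta>\<close> whose coefficients are read off
  from \<open>d\<beta>\<close>. This yields existence, smoothness, equivariance and the value on fundamental fields;
  \<open>dw\<close> is pulled back from the base, and \<open>d\<phi>\<close> has no \<open>\<omega>\<^sup>1 \<and> \<omega>\<^sup>2\<close> component because
  \<open>d(d\<omega>) = 0\<close> reduces to \<open>d\<phi> \<and> \<omega> = 0\<close>.
\<close>

section \<open>Calculus of smooth maps\<close>

text \<open>No section of the bundle is preferred, and the solution is not glued from local
  formulas. The structure equations at a point u involve the unknown forms only through their values
  on the tangent space at u, and there they have at most one solution. So both forms, the torsions
  and the curvature coefficients can be defined on the whole bundle by definite descriptions;
  trivialisations serve to prove that the descriptions are met and that the result depends smoothly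
  on u. Two obstacles shape the rest. Tangent vectors are recorded in a chart chosen arbitrarily at
  each point, so every statement about d or about a tangent map has to be moved into one fixed
  chart; that d survives the move rests on the symmetry of second derivatives. And the fibre
  coordinates a, b must be recovered smoothly from the scale factors a^2 b and 1/(a b^2) of a
  coframe, which costs a real cube root, smooth away from 0.\<close>

lemma frechet_derivative_eqI:
  "(f has_derivative f') (at x) \<Longrightarrow> frechet_derivative f (at x) = f'"
  by (metis frechet_derivative_at)

lemma frechet_derivative_transformI:
  assumes "(f has_derivative f') (at x)" "open S" "x \<in> S" "\<And>y. y \<in> S \<Longrightarrow> f y = g y"
  shows "frechet_derivative g (at x) = f'"
  by (rule frechet_derivative_eqI[OF has_derivative_transform_within_open[OF assms]])

text \<open>Derivatives are taken in the ambient space; openness of \<open>S\<close> makes them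
  depend on the values on \<open>S\<close> alone.\<close>

lemma C_k_on_cong:
  assumes "open S" "C_k_on k S f" "\<And>x. x \<in> S \<Longrightarrow> f x = g x"
  shows "C_k_on k S g"
  using assms
proof (induction k arbitrary: f g)
  case 0
  then show ?case by (metis C_k_on.simps(1) continuous_on_cong)
next
  case (Suc k)
  have D: "(g has_derivative frechet_derivative f (at x)) (at x)" if "x \<in> S" for x
  proof (rule has_derivative_transform_within_open[OF _ \<open>open S\<close> that])
    show "(f has_derivative frechet_derivative f (at x)) (at x)"
      using Suc.prems(2) that by (simp add: frechet_derivative_works)
  qed (use Suc.prems in simp)
  have f: "C_k_on k S (\<lambda>x. frechet_derivative f (at x) v)" for v
    using Suc.prems(2) by simp
  have "C_k_on k S (\<lambda>x. frechet_derivative g (at x) v)" for v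
    by (rule Suc.IH[OF \<open>open S\<close> f[of v]]) (simp only: frechet_derivative_eqI[OF D])
  then show ?case
    using D by (auto simp: differentiable_def)
qed

text \<open>Lets a derivative be supplied by a formula instead of through
  \<open>frechet_derivative\<close>.\<close>

lemma C_k_on_SucI:
  assumes "open S" and D: "\<And>x. x \<in> S \<Longrightarrow> (f has_derivative f' x) (at x)"
    and "\<And>v. C_k_on k S (\<lambda>x. f' x v)"
  shows "C_k_on (Suc k) S f"
proof -
  have "C_k_on k S (\<lambda>x. frechet_derivative f (at x) v)" for v
    by (rule C_k_on_cong[OF assms(1,3)]) (simp add: frechet_derivative_eqI[OF D])
  then show ?thesis using D by (auto simp: differentiable_def)
qed

lemma C_k_on_subset: "C_k_on k S f \<Longrightarrow> T \<subseteq> S \<Longrightarrow> C_k_on k T f"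
  by (induction k arbitrary: f) (auto intro: continuous_on_subset)

text \<open>The defining clause for \<open>Suc k\<close> does not mention continuity of
  \<open>f\<close>; at the bottom of the induction it comes from differentiability.\<close>

lemma C_k_on_Suc_D: "C_k_on (Suc k) S f \<Longrightarrow> C_k_on k S f"
proof (induction k arbitrary: f)
  case 0
  then have "isCont f x" if "x \<in> S" for x
    using that differentiable_imp_continuous_within by (metis C_k_on.simps(2))
  then show ?case
    by (simp add: continuous_at_imp_continuous_on)
next
  case (Suc k)
  then have "C_k_on k S (\<lambda>x. frechet_derivative f (at x) v)" for v
    by (metis C_k_on.simps(2))
  with Suc.prems show ?case by simp
qed

lemma C_k_on_bounded_linear:
  assumes "open S" "C_k_on k S f" "bounded_linear h"
  shows "C_k_on k S (\<lambda>x. h (f x))"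
  using assms(2)
proof (induction k arbitrary: f)
  case 0
  then show ?case
    using assms(3) by (auto intro: bounded_linear.continuous_on)
next
  case (Suc k)
  show ?case
  proof (rule C_k_on_SucI[OF assms(1)])
    show "((\<lambda>x. h (f x)) has_derivative (\<lambda>v. h (frechet_derivative f (at x) v))) (at x)"
      if "x \<in> S" for x
      using Suc.prems that
      by (auto intro!: bounded_linear.has_derivative[OF assms(3)] simp: frechet_derivative_works)
    show "C_k_on k S (\<lambda>x. h (frechet_derivative f (at x) v))" for v
      using Suc.IH[of "\<lambda>x. frechet_derivative f (at x) v"] Suc.prems by simp
  qed
qed

lemma C_k_on_const: "C_k_on k S (\<lambda>x. c)"
  by (induction k arbitrary: c) auto

lemma C_k_on_linear: "bounded_linear f \<Longrightarrow> C_k_on k S f"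
proof (induction k)
  case 0
  then show ?case by (simp add: linear_continuous_on)
next
  case (Suc k)
  have D: "(f has_derivative f) (at x)" for x
    by (rule bounded_linear_imp_has_derivative[OF Suc.prems])
  then show ?case
    by (auto simp: frechet_derivative_eqI[OF D] differentiable_def C_k_on_const)
qed

lemma C_k_on_add:
  assumes "open S" "C_k_on k S f" "C_k_on k S g"
  shows "C_k_on k S (\<lambda>x. f x + g x)"
  using assms(2-)
proof (induction k arbitrary: f g)
  case 0
  then show ?case by (auto intro: continuous_on_add)
next
  case (Suc k)
  show ?case
  proof (rule C_k_on_SucI[OF assms(1)])
    show "((\<lambda>x. f x + g x) has_derivative
        (\<lambda>v. frechet_derivative f (at x) v + frechet_derivative g (at x) v)) (at x)" if "x \<in> S" for x
      using Suc.prems that by (auto intro!: has_derivative_add simp: frechet_derivative_works)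
    show "C_k_on k S (\<lambda>x. frechet_derivative f (at x) v + frechet_derivative g (at x) v)" for v
      using Suc.IH[of "\<lambda>x. frechet_derivative f (at x) v" "\<lambda>x. frechet_derivative g (at x) v"] Suc.prems
      by simp
  qed
qed

lemma C_k_on_bilinear:
  assumes "open S" "bounded_bilinear h" "C_k_on k S f" "C_k_on k S g"
  shows "C_k_on k S (\<lambda>x. h (f x) (g x))"
  using assms(3-)
proof (induction k arbitrary: f g)
  case 0
  then show ?case using assms(2) by (auto intro: bounded_bilinear.continuous_on)
next
  case (Suc k)
  show ?case
  proof (rule C_k_on_SucI[OF assms(1)])
    show "((\<lambda>x. h (f x) (g x)) has_derivative (\<lambda>v. h (f x) (frechet_derivative g (at x) v) +
        h (frechet_derivative f (at x) v) (g x))) (at x)" if "x \<in> S" for x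
      using Suc.prems that
      by (auto intro!: bounded_bilinear.FDERIV[OF assms(2)] simp: frechet_derivative_works)
    \<comment> \<open>The product rule brings \<open>f\<close> and \<open>g\<close> themselves back
      beside their derivatives.\<close>
    have "C_k_on k S f" "C_k_on k S g"
      using Suc.prems C_k_on_Suc_D by auto
    then show "C_k_on k S (\<lambda>x. h (f x) (frechet_derivative g (at x) v) +
        h (frechet_derivative f (at x) v) (g x))" for v
      using Suc.IH[of f "\<lambda>x. frechet_derivative g (at x) v"]
        Suc.IH[of "\<lambda>x. frechet_derivative f (at x) v" g] Suc.prems
      by (intro C_k_on_add[OF assms(1)]) simp_all
  qed
qed

lemma C_k_on_sum:
  assumes "open S" "\<And>i. i \<in> I \<Longrightarrow> C_k_on k S (f i)"
  shows "C_k_on k S (\<lambda>x. \<Sum>i\<in>I. f i x)"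
proof (cases "finite I")
  case True
  then show ?thesis
    using assms(2) by (induction I) (auto simp: C_k_on_const intro!: C_k_on_add[OF assms(1)])
qed (simp add: C_k_on_const)

lemma linear_euclidean_sum:
  fixes v :: "'a::euclidean_space"
  assumes "linear f"
  shows "f v = (\<Sum>b\<in>Basis. (v \<bullet> b) *\<^sub>R f b)"
proof -
  have "f v = f (\<Sum>b\<in>Basis. (v \<bullet> b) *\<^sub>R b)"
    by (simp only: euclidean_representation)
  also have "\<dots> = (\<Sum>b\<in>Basis. (v \<bullet> b) *\<^sub>R f b)"
    by (simp only: linear_sum[OF assms] linear_scale[OF assms])
  finally show ?thesis .
qed

text \<open>\<open>C_k_on\<close> controls derivatives in fixed directions, while the chain rule
  applies the derivative of \<open>g\<close> in a direction that moves with x. Expanding this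
  direction in the basis of the middle space leaves sums of products to which the induction
  applies.\<close>

lemma C_k_on_compose:
  fixes f :: "'a::real_normed_vector \<Rightarrow> 'b::euclidean_space"
    and g :: "'b \<Rightarrow> 'c::real_normed_vector"
  assumes S: "open S" and f: "C_k_on k S f" and g: "C_k_on k T g" and im: "f ` S \<subseteq> T"
  shows "C_k_on k S (\<lambda>x. g (f x))"
  using f g
proof (induction k arbitrary: g)
  case 0
  then show ?case using im continuous_on_compose2 by auto
next
  case (Suc k)
  have fd: "(f has_derivative frechet_derivative f (at x)) (at x)"
    and gd: "(g has_derivative frechet_derivative g (at (f x))) (at (f x))" if "x \<in> S" for x
    using Suc.prems that im by (auto simp: frechet_derivative_works)
  then have D: "((\<lambda>x. g (f x)) has_derivative
      (\<lambda>v. frechet_derivative g (at (f x)) (frechet_derivative f (at x) v))) (at x)"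
    if "x \<in> S" for x
    using that has_derivative_compose by blast
  show ?case
  proof (rule C_k_on_SucI[OF S D], assumption, rule C_k_on_cong[OF S])
    fix v
    have "C_k_on k S f" using Suc.prems C_k_on_Suc_D by blast
    then have "C_k_on k S (\<lambda>x. frechet_derivative g (at (f x)) b)" for b
      using Suc.IH[of "\<lambda>y. frechet_derivative g (at y) b"] Suc.prems by simp
    moreover have "C_k_on k S (\<lambda>x. frechet_derivative f (at x) v \<bullet> b)" for b
      using Suc.prems by (intro C_k_on_bounded_linear[OF S _ bounded_linear_inner_left]) auto
    ultimately show "C_k_on k S (\<lambda>x. \<Sum>b\<in>Basis. (frechet_derivative f (at x) v \<bullet> b) *\<^sub>R
        frechet_derivative g (at (f x)) b)"
      by (intro C_k_on_sum S C_k_on_bilinear[OF S bounded_bilinear_scaleR])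
    show "(\<Sum>b\<in>Basis. (frechet_derivative f (at x) v \<bullet> b) *\<^sub>R frechet_derivative g (at (f x)) b) =
        frechet_derivative g (at (f x)) (frechet_derivative f (at x) v)" if "x \<in> S" for x
      by (rule linear_euclidean_sum[OF has_derivative_linear[OF gd[OF that]], symmetric])
  qed
qed

lemma smooth_onI: "(\<And>k. C_k_on k S f) \<Longrightarrow> smooth_on S f"
  by (simp add: smooth_on_def)

lemma smooth_onD: "smooth_on S f \<Longrightarrow> C_k_on k S f"
  by (simp add: smooth_on_def)

lemma smooth_on_has_derivative:
  "smooth_on S f \<Longrightarrow> x \<in> S \<Longrightarrow> (f has_derivative frechet_derivative f (at x)) (at x)"
  by (metis C_k_on.simps(2) frechet_derivative_works smooth_on_def)

lemma smooth_on_differentiable: "smooth_on S f \<Longrightarrow> x \<in> S \<Longrightarrow> f differentiable (at x)"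
  by (metis C_k_on.simps(2) smooth_on_def)

lemma smooth_on_frechet:
  "smooth_on S f \<Longrightarrow> smooth_on S (\<lambda>x. frechet_derivative f (at x) v)"
  by (metis C_k_on.simps(2) smooth_on_def)

lemma smooth_on_cong:
  "open S \<Longrightarrow> smooth_on S f \<Longrightarrow> (\<And>x. x \<in> S \<Longrightarrow> f x = g x) \<Longrightarrow> smooth_on S g"
  by (metis C_k_on_cong smooth_on_def)

lemma smooth_on_subset: "smooth_on S f \<Longrightarrow> T \<subseteq> S \<Longrightarrow> smooth_on T f"
  by (metis C_k_on_subset smooth_on_def)

section \<open>Closure of smooth maps under algebraic operations and composition\<close>

named_theorems smooth_intros

lemma smooth_on_const [smooth_intros]: "smooth_on S (\<lambda>x. c)"
  by (simp add: smooth_onI C_k_on_const)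

lemma smooth_on_linear: "bounded_linear f \<Longrightarrow> smooth_on S f"
  by (simp add: smooth_onI C_k_on_linear)

lemma smooth_on_id [smooth_intros]: "smooth_on S (\<lambda>x. x)"
  by (rule smooth_on_linear) (rule bounded_linear_ident)

lemma smooth_on_bounded_linear:
  "bounded_linear h \<Longrightarrow> open S \<Longrightarrow> smooth_on S f \<Longrightarrow> smooth_on S (\<lambda>x. h (f x))"
  by (simp add: smooth_onI smooth_onD C_k_on_bounded_linear)

lemma smooth_on_bilinear:
  "bounded_bilinear h \<Longrightarrow> open S \<Longrightarrow> smooth_on S f \<Longrightarrow> smooth_on S g \<Longrightarrow>
    smooth_on S (\<lambda>x. h (f x) (g x))"
  by (simp add: smooth_onI smooth_onD C_k_on_bilinear)

lemma smooth_on_add [smooth_intros]: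
  "open S \<Longrightarrow> smooth_on S f \<Longrightarrow> smooth_on S g \<Longrightarrow> smooth_on S (\<lambda>x. f x + g x)"
  by (simp add: smooth_onI smooth_onD C_k_on_add)

lemmas smooth_on_mult [smooth_intros] =
  smooth_on_bilinear[OF bounded_bilinear_mult[where 'a = real]]
lemmas smooth_on_scaleR [smooth_intros] = smooth_on_bilinear[OF bounded_bilinear_scaleR]
lemmas smooth_on_inner [smooth_intros] = smooth_on_bilinear[OF bounded_bilinear_inner]
lemmas smooth_on_uminus [smooth_intros] =
  smooth_on_bounded_linear[OF bounded_linear_minus[OF bounded_linear_ident]]
lemmas smooth_on_fst [smooth_intros] = smooth_on_bounded_linear[OF bounded_linear_fst]
lemmas smooth_on_snd [smooth_intros] = smooth_on_bounded_linear[OF bounded_linear_snd]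

lemma smooth_on_diff [smooth_intros]:
  "open S \<Longrightarrow> smooth_on S f \<Longrightarrow> smooth_on S g \<Longrightarrow> smooth_on S (\<lambda>x. f x - g x)"
  using smooth_on_add[of S f "\<lambda>x. - g x"] smooth_on_uminus[of S g] by simp

lemma smooth_on_sum [smooth_intros]:
  "open S \<Longrightarrow> (\<And>i. i \<in> I \<Longrightarrow> smooth_on S (f i)) \<Longrightarrow> smooth_on S (\<lambda>x. \<Sum>i\<in>I. f i x)"
  by (simp add: smooth_onI smooth_onD C_k_on_sum)

lemma smooth_on_Pair [smooth_intros]:
  assumes "open S" "smooth_on S f" "smooth_on S g"
  shows "smooth_on S (\<lambda>x. (f x, g x))"
proof -
  have "bounded_linear (\<lambda>y. (y, 0))"
    by (intro bounded_linear_Pair bounded_linear_ident bounded_linear_zero)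
  from smooth_on_bounded_linear[OF this assms(1,2)]
  have 1: "smooth_on S (\<lambda>x. (f x, 0))" .
  have "bounded_linear (\<lambda>y. (0, y))"
    by (intro bounded_linear_Pair bounded_linear_ident bounded_linear_zero)
  from smooth_on_bounded_linear[OF this assms(1,3)]
  have 2: "smooth_on S (\<lambda>x. (0, g x))" .
  show ?thesis
    using smooth_on_add[OF assms(1) 1 2] by simp
qed

lemma smooth_on_compose:
  fixes f :: "'a::real_normed_vector \<Rightarrow> 'b::euclidean_space"
  assumes "smooth_on T g" "open S" "smooth_on S f" "f ` S \<subseteq> T"
  shows "smooth_on S (\<lambda>x. g (f x))"
  by (rule smooth_onI)
    (rule C_k_on_compose[OF assms(2) smooth_onD[OF assms(3)] smooth_onD[OF assms(1)] assms(4)])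

text \<open>The derivative of 1/f is built from 1/f and the derivative of f, so class k of 1/f
  yields class k + 1.\<close>

lemma smooth_on_inverse [smooth_intros]:
  fixes f :: "'a::real_normed_vector \<Rightarrow> real"
  assumes S: "open S" and f: "smooth_on S f" and nz: "\<And>x. x \<in> S \<Longrightarrow> f x \<noteq> 0"
  shows "smooth_on S (\<lambda>x. inverse (f x))"
proof (rule smooth_onI)
  fix k show "C_k_on k S (\<lambda>x. inverse (f x))"
  proof (induction k)
    case 0
    then show ?case
      using smooth_onD[OF f, of 0] nz by (auto intro: continuous_on_inverse)
  next
    case (Suc k)
    show ?case
    proof (rule C_k_on_SucI[OF S])
      show "((\<lambda>x. inverse (f x)) has_derivative
          (\<lambda>v. - (inverse (f x) * frechet_derivative f (at x) v * inverse (f x)))) (at x)"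
        if "x \<in> S" for x
        using smooth_on_has_derivative[OF f] nz that by (auto intro!: has_derivative_inverse)
      show "C_k_on k S (\<lambda>x. - (inverse (f x) * frechet_derivative f (at x) v * inverse (f x)))" for v
        using Suc smooth_onD[OF smooth_on_frechet[OF f]]
        by (intro C_k_on_bounded_linear[OF S _ bounded_linear_minus[OF bounded_linear_ident]]
            C_k_on_bilinear[OF S bounded_bilinear_mult])
    qed
  qed
qed

lemma smooth_on_divide [smooth_intros]:
  fixes f g :: "'a::real_normed_vector \<Rightarrow> real"
  assumes "open S" "smooth_on S f" "smooth_on S g" "\<And>x. x \<in> S \<Longrightarrow> g x \<noteq> 0"
  shows "smooth_on S (\<lambda>x. f x / g x)"
  unfolding divide_inverse using assms by (intro smooth_intros)

lemma smooth_on_power [smooth_intros]: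
  fixes f :: "'a::real_normed_vector \<Rightarrow> real"
  shows "open S \<Longrightarrow> smooth_on S f \<Longrightarrow> smooth_on S (\<lambda>x. f x ^ n)"
  by (induction n) (auto intro: smooth_intros)

text \<open>The same bootstrap: the derivative of the cube root r at x is r(x)/(3 x).
  \<open>root 3\<close> is the real cube root on negative numbers as well; it enters through
  \<open>diag_parameters\<close>.\<close>

lemma smooth_on_root3: "smooth_on (- {0}) (root 3)"
proof (rule smooth_onI)
  have D: "(root 3 has_derivative (\<lambda>v. (root 3 x * inverse (3 * x)) * v)) (at x)" if "x \<noteq> 0" for x
  proof -
    have "root 3 x ^ 3 = x" "root 3 x \<noteq> 0"
      using that by (simp_all add: odd_real_root_pow)
    then have "inverse (real 3 * root 3 x ^ (3 - Suc 0)) = root 3 x * inverse (3 * x)"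
      by (simp add: field_simps power3_eq_cube power2_eq_square)
    then have "(root 3 has_real_derivative (root 3 x * inverse (3 * x))) (at x)"
      using DERIV_odd_real_root[of 3 x] that by (metis odd_numeral)
    then show ?thesis by (simp only: has_field_derivative_def)
  qed
  fix k show "C_k_on k (- {0}) (root 3)"
  proof (induction k)
    case 0
    then show ?case by (auto intro: continuous_on_real_root continuous_on_id)
  next
    case (Suc k)
    have o: "open (- {0::real})" by auto
    have "smooth_on (- {0}) (\<lambda>x::real. inverse (3 * x))"
      by (intro smooth_intros o) auto
    from C_k_on_bilinear[OF o bounded_bilinear_mult C_k_on_bilinear[OF o bounded_bilinear_mult
        Suc smooth_onD[OF this]] C_k_on_const]
    have "C_k_on k (- {0}) (\<lambda>x. (root 3 x * inverse (3 * x)) * v)" for v .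
    with D show ?case by (intro C_k_on_SucI[OF o]) auto
  qed
qed

section \<open>Symmetry of second derivatives\<close>

lemma mixed_difference_mvt:
  fixes f :: "'a::euclidean_space \<Rightarrow> real"
  assumes "smooth_on S f" "ball x d \<subseteq> S" "h > 0" "h * norm v + h * norm w < d"
  shows "\<exists>y\<in>ball x d. f (x + h *\<^sub>R v + h *\<^sub>R w) - f (x + h *\<^sub>R v) - f (x + h *\<^sub>R w) + f x =
     h * h * frechet_derivative (\<lambda>z. frechet_derivative f (at z) v) (at y) w"
proof -
  let ?Df = "\<lambda>z. frechet_derivative f (at z) v"
  have inb: "x + t *\<^sub>R v + s *\<^sub>R w \<in> ball x d" if "0 \<le> t" "t \<le> h" "0 \<le> s" "s \<le> h" for t s
  proof -
    have "norm (t *\<^sub>R v + s *\<^sub>R w) \<le> t * norm v + s * norm w"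
      using norm_triangle_ineq[of "t *\<^sub>R v" "s *\<^sub>R w"] that by simp
    also have "\<dots> \<le> h * norm v + h * norm w"
      using that by (intro add_mono mult_right_mono) auto
    finally have "norm (t *\<^sub>R v + s *\<^sub>R w) < d" using assms(4) by simp
    moreover have "x - (x + t *\<^sub>R v + s *\<^sub>R w) = - (t *\<^sub>R v + s *\<^sub>R w)" by simp
    ultimately show ?thesis by (simp only: mem_ball dist_norm norm_minus_cancel)
  qed
  have line: "((\<lambda>r. g (p + r *\<^sub>R u)) has_real_derivative frechet_derivative g (at (p + r *\<^sub>R u)) u) (at r)"
    if "smooth_on S g" "p + r *\<^sub>R u \<in> S" for g :: "'a \<Rightarrow> real" and p u r
  proof -
    have "((\<lambda>r. p + r *\<^sub>R u) has_derivative (\<lambda>r. r *\<^sub>R u)) (at r)"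
      by (auto intro!: derivative_eq_intros)
    from has_derivative_compose[OF this smooth_on_has_derivative[OF that]]
    have "((\<lambda>r. g (p + r *\<^sub>R u)) has_derivative
        (\<lambda>s. frechet_derivative g (at (p + r *\<^sub>R u)) (s *\<^sub>R u))) (at r)" .
    moreover have "linear (frechet_derivative g (at (p + r *\<^sub>R u)))"
      using smooth_on_has_derivative[OF that] has_derivative_linear by blast
    ultimately show ?thesis
      by (simp add: has_field_derivative_def linear_scale mult_commute_abs)
  qed
  \<comment> \<open>The mean value theorem is applied first in the direction v, to the difference of
    \<open>f\<close> along two parallel segments, and then in the direction w, to the directional
    derivative so obtained.\<close>
  have "((\<lambda>t. f ((x + h *\<^sub>R w) + t *\<^sub>R v) - f (x + t *\<^sub>R v)) has_real_derivative
      ?Df ((x + h *\<^sub>R w) + t *\<^sub>R v) - ?Df (x + t *\<^sub>R v)) (at t)" if "0 \<le> t" "t \<le> h" for t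
    using inb[of t h] inb[of t 0] that assms
    by (intro derivative_intros line[OF assms(1)]) (auto simp: algebra_simps)
  from MVT2[OF assms(3) this] obtain t where t: "0 < t" "t < h" and
    1: "(f ((x + h *\<^sub>R w) + h *\<^sub>R v) - f (x + h *\<^sub>R v)) - (f ((x + h *\<^sub>R w) + 0 *\<^sub>R v) - f (x + 0 *\<^sub>R v)) =
      (h - 0) * (?Df ((x + h *\<^sub>R w) + t *\<^sub>R v) - ?Df (x + t *\<^sub>R v))"
    by blast
  have "((\<lambda>s. ?Df ((x + t *\<^sub>R v) + s *\<^sub>R w)) has_real_derivative
      frechet_derivative ?Df (at ((x + t *\<^sub>R v) + s *\<^sub>R w)) w) (at s)" if "0 \<le> s" "s \<le> h" for s
    using inb[of t s] that assms t
    by (intro line smooth_on_frechet[OF assms(1)]) auto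
  from MVT2[OF assms(3) this] obtain s where s: "0 < s" "s < h" and
    2: "?Df ((x + t *\<^sub>R v) + h *\<^sub>R w) - ?Df ((x + t *\<^sub>R v) + 0 *\<^sub>R w) =
      (h - 0) * frechet_derivative ?Df (at ((x + t *\<^sub>R v) + s *\<^sub>R w)) w"
    by blast
  show ?thesis
    using 1 2 inb[of t s] t s
    by (intro bexI[of _ "(x + t *\<^sub>R v) + s *\<^sub>R w"]) (simp_all add: algebra_simps)
qed

text \<open>The second difference over the parallelogram spanned by h v and h w is symmetric in v
  and w, and it is h^2 times either mixed derivative at some point nearby. Continuity of both mixed
  derivatives moves these points to x.\<close>

lemma symmetric_second_derivative_real:
  fixes f :: "'a::euclidean_space \<Rightarrow> real"
  assumes f: "smooth_on S f" and S: "open S" and x: "x \<in> S"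
  shows "frechet_derivative (\<lambda>z. frechet_derivative f (at z) v) (at x) w =
     frechet_derivative (\<lambda>z. frechet_derivative f (at z) w) (at x) v"
proof -
  define P where "P v w y = frechet_derivative (\<lambda>z. frechet_derivative f (at z) v) (at y) w" for v w y
  have cont: "isCont (P v w) x" for v w
    using smooth_onD[OF smooth_on_frechet[OF smooth_on_frechet[OF f]], of 0] S x
    unfolding P_def by (simp add: continuous_on_eq_continuous_at)
  have "\<bar>P v w x - P w v x\<bar> < e" if e: "e > 0" for e
  proof -
    obtain d1 where d1: "d1 > 0" "\<And>y. dist y x < d1 \<Longrightarrow> dist (P v w y) (P v w x) < e / 2"
      using cont[of v w] e unfolding continuous_at_eps_delta by (meson half_gt_zero)
    obtain d2 where d2: "d2 > 0" "\<And>y. dist y x < d2 \<Longrightarrow> dist (P w v y) (P w v x) < e / 2"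
      using cont[of w v] e unfolding continuous_at_eps_delta by (meson half_gt_zero)
    obtain d3 where d3: "d3 > 0" "ball x d3 \<subseteq> S"
      using S x open_contains_ball by blast
    define d where "d = min d1 (min d2 d3)"
    have d: "d > 0" "ball x d \<subseteq> S" using d1 d2 d3 by (auto simp: d_def)
    \<comment> \<open>The summand 1 keeps the denominator positive when v = w = 0 and makes the
      bound on the step strict.\<close>
    define h where "h = d / (norm v + norm w + 1)"
    have n: "norm v + norm w + 1 > 0" using norm_ge_zero[of v] norm_ge_zero[of w] by linarith
    have h: "h > 0" using d n by (simp add: h_def)
    have "h * norm v + h * norm w < h * (norm v + norm w + 1)"
      using h by (simp add: algebra_simps)
    also have "\<dots> = d" using n by (simp add: h_def)
    finally have hd: "h * norm v + h * norm w < d" .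
    obtain y where y: "y \<in> ball x d"
      "f (x + h *\<^sub>R v + h *\<^sub>R w) - f (x + h *\<^sub>R v) - f (x + h *\<^sub>R w) + f x = h * h * P v w y"
      using mixed_difference_mvt[OF f d(2) h hd] unfolding P_def by blast
    obtain z where z: "z \<in> ball x d"
      "f (x + h *\<^sub>R w + h *\<^sub>R v) - f (x + h *\<^sub>R w) - f (x + h *\<^sub>R v) + f x = h * h * P w v z"
      using mixed_difference_mvt[OF f d(2) h, of w v] hd unfolding P_def by (auto simp: add.commute)
    have "h * h * P v w y = h * h * P w v z"
      unfolding y(2)[symmetric] z(2)[symmetric] by (simp add: algebra_simps)
    then have "P v w y = P w v z" using h by simp
    moreover have "dist (P v w y) (P v w x) < e / 2" "dist (P w v z) (P w v x) < e / 2"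
      using d1(2)[of y] d2(2)[of z] y(1) z(1) by (simp_all add: d_def dist_commute)
    ultimately show ?thesis unfolding dist_real_def by linarith
  qed
  then have "P v w x = P w v x"
    by (metis less_irrefl zero_less_abs_iff right_minus_eq)
  then show ?thesis by (simp add: P_def)
qed

lemma symmetric_second_derivative:
  fixes f :: "'a::euclidean_space \<Rightarrow> 'b::euclidean_space"
  assumes f: "smooth_on S f" and S: "open S" and x: "x \<in> S"
  shows "frechet_derivative (\<lambda>z. frechet_derivative f (at z) v) (at x) w =
     frechet_derivative (\<lambda>z. frechet_derivative f (at z) w) (at x) v"
proof (rule euclidean_eqI)
  fix b :: 'b assume "b \<in> Basis"
  have inner: "frechet_derivative (\<lambda>z. g z \<bullet> b) (at y) u = frechet_derivative g (at y) u \<bullet> b"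
    if "smooth_on S g" "y \<in> S" for g :: "'a \<Rightarrow> 'b" and y u
    using bounded_linear.has_derivative[OF bounded_linear_inner_left smooth_on_has_derivative[OF that]]
    by (rule fun_cong[OF frechet_derivative_eqI])
  have fb: "smooth_on S (\<lambda>z. f z \<bullet> b)"
    using f S by (intro smooth_intros)
  have "frechet_derivative (\<lambda>z. frechet_derivative (\<lambda>z. f z \<bullet> b) (at z) v) (at x) w =
      frechet_derivative (\<lambda>z. frechet_derivative f (at z) v) (at x) w \<bullet> b" for v w
  proof -
    have "((\<lambda>z. frechet_derivative f (at z) v \<bullet> b) has_derivative
        (\<lambda>w. frechet_derivative (\<lambda>z. frechet_derivative f (at z) v) (at x) w \<bullet> b)) (at x)"
      by (rule bounded_linear.has_derivative[OF bounded_linear_inner_left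
            smooth_on_has_derivative[OF smooth_on_frechet[OF f] x]])
    from frechet_derivative_transformI[OF this S x] show ?thesis by (simp add: inner[OF f])
  qed
  then show "frechet_derivative (\<lambda>z. frechet_derivative f (at z) v) (at x) w \<bullet> b =
     frechet_derivative (\<lambda>z. frechet_derivative f (at z) w) (at x) v \<bullet> b"
    using symmetric_second_derivative_real[OF fb S x] by metis
qed

section \<open>Tangent vectors and forms in charts\<close>

text \<open>Both \<open>comps\<close> and \<open>tvec\<close> are instances of this derivative of a
  transition map, so the single chain rule \<open>jac_cocycle\<close> serves both.\<close>

definition jac :: "('a, 'e::euclidean_space) chart \<Rightarrow> ('a, 'e) chart \<Rightarrow> 'a \<Rightarrow> 'e \<Rightarrow> 'e" where
  "jac c d p = frechet_derivative (coords d \<circ> param c) (at (coords c p))"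

lemma comps_jac: "comps \<A> c p = jac (chart_at \<A> p) c p"
  by (simp add: fun_eq_iff comps_def jac_def)

lemma tvec_jac: "tvec \<A> c p = jac c (chart_at \<A> p) p"
  by (simp add: fun_eq_iff tvec_def jac_def)

section \<open>The exterior derivative of a one-form given in coordinates\<close>

definition d_local :: "('e::real_normed_vector \<Rightarrow> 'e \<Rightarrow> 'v::real_normed_vector) \<Rightarrow> 'e \<Rightarrow> 'e \<Rightarrow> 'e \<Rightarrow> 'v" where
  "d_local \<beta> y v w = frechet_derivative (\<lambda>y. \<beta> y w) (at y) v - frechet_derivative (\<lambda>y. \<beta> y v) (at y) w"

lemma ext_d_local:
  "ext_d \<A> \<alpha> p = d_local (local_form \<A> (chart_at \<A> p) \<alpha>) (coords (chart_at \<A> p) p)"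
  by (simp add: ext_d_def d_local_def Let_def fun_eq_iff)

text \<open>A linear form evaluated on a constant vector is a combination of its values on the basis
  with constant coefficients, and these coefficients pass through the derivative.\<close>

lemma frechet_linear_arg:
  fixes \<beta> :: "'e::euclidean_space \<Rightarrow> 'e \<Rightarrow> 'v::real_normed_vector"
  assumes S: "open S" and y: "y \<in> S" and lin: "\<And>y. y \<in> S \<Longrightarrow> linear (\<beta> y)"
    and sm: "\<And>w. smooth_on S (\<lambda>y. \<beta> y w)"
  shows "frechet_derivative (\<lambda>y. \<beta> y w) (at y) v =
    (\<Sum>b\<in>Basis. (w \<bullet> b) *\<^sub>R frechet_derivative (\<lambda>y. \<beta> y b) (at y) v)"
proof -
  have "((\<lambda>y. \<Sum>b\<in>Basis. (w \<bullet> b) *\<^sub>R \<beta> y b) has_derivative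
      (\<lambda>v. \<Sum>b\<in>Basis. (w \<bullet> b) *\<^sub>R frechet_derivative (\<lambda>y. \<beta> y b) (at y) v)) (at y)"
    using smooth_on_has_derivative[OF sm y] by (intro has_derivative_sum has_derivative_scaleR_right)
  then show ?thesis
    by (rule fun_cong[OF frechet_derivative_transformI[OF _ S y linear_euclidean_sum[OF lin, symmetric]]])
qed

text \<open>Smoothness of a form is stated on constant vectors; this extends it to vectors that vary
  smoothly.\<close>

lemma smooth_on_linear_arg:
  fixes \<beta> :: "'e::euclidean_space \<Rightarrow> 'f::euclidean_space \<Rightarrow> 'v::real_normed_vector"
  assumes "open S" "\<And>y. y \<in> S \<Longrightarrow> linear (\<beta> y)" "\<And>w. smooth_on S (\<lambda>y. \<beta> y w)" "smooth_on S f"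
  shows "smooth_on S (\<lambda>y. \<beta> y (f y))"
proof (rule smooth_on_cong[OF assms(1)])
  show "smooth_on S (\<lambda>y. \<Sum>b\<in>Basis. (f y \<bullet> b) *\<^sub>R \<beta> y b)"
    by (intro smooth_intros assms)
  show "(\<Sum>b\<in>Basis. (f y \<bullet> b) *\<^sub>R \<beta> y b) = \<beta> y (f y)" if "y \<in> S" for y
    by (rule linear_euclidean_sum[OF assms(2)[OF that], symmetric])
qed

lemma linear_frechet_smooth: "smooth_on S f \<Longrightarrow> y \<in> S \<Longrightarrow> linear (frechet_derivative f (at y))"
  by (rule has_derivative_linear[OF smooth_on_has_derivative])

context
  fixes \<beta> :: "'e::euclidean_space \<Rightarrow> 'e \<Rightarrow> 'v::real_normed_vector" and S
  assumes S: "open S" and lin: "\<And>y. y \<in> S \<Longrightarrow> linear (\<beta> y)"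
    and sm: "\<And>w. smooth_on S (\<lambda>y. \<beta> y w)"
begin

lemma linear_frechet_arg:
  assumes "y \<in> S"
  shows "linear (\<lambda>w. frechet_derivative (\<lambda>y. \<beta> y w) (at y) v)"
proof -
  have "linear (\<lambda>w. \<Sum>b\<in>Basis. (w \<bullet> b) *\<^sub>R frechet_derivative (\<lambda>y. \<beta> y b) (at y) v)"
    by (rule linearI) (simp_all add: inner_add_left sum.distrib scaleR_add_left scaleR_sum_right)
  then show ?thesis
    by (simp only: frechet_linear_arg[OF S assms lin sm, symmetric])
qed

lemma linear_d_local1: "y \<in> S \<Longrightarrow> linear (\<lambda>v. d_local \<beta> y v w)"
  unfolding d_local_def
  by (intro linear_compose_sub linear_frechet_smooth[OF sm] linear_frechet_arg)

lemma linear_d_local2: "y \<in> S \<Longrightarrow> linear (\<lambda>w. d_local \<beta> y v w)"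
  unfolding d_local_def
  by (intro linear_compose_sub linear_frechet_smooth[OF sm] linear_frechet_arg)

lemma smooth_d_local:
  assumes f: "smooth_on S f" and g: "smooth_on S g"
  shows "smooth_on S (\<lambda>y. d_local \<beta> y (f y) (g y))"
proof (rule smooth_on_linear_arg[OF S linear_d_local2 _ g])
  show "smooth_on S (\<lambda>y. d_local \<beta> y (f y) w)" for w
    by (rule smooth_on_linear_arg[OF S linear_d_local1 _ f])
      (auto simp: d_local_def intro!: smooth_on_diff[OF S] smooth_on_frechet[OF sm])
qed

end

lemma d_local_skew: "d_local \<beta> y v w = - d_local \<beta> y w v"
  by (simp add: d_local_def)

section \<open>Charts, transition maps and forms on a manifold\<close>

locale manifold_atlas =
  fixes \<A> :: "('a, 'e::euclidean_space) atlas"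
  assumes atlas: "smooth_atlas \<A>"
begin

lemma inj_coords: "c \<in> \<A> \<Longrightarrow> inj_on (coords c) (dom_of c)"
  using atlas by (auto simp: smooth_atlas_def)

lemma param_coords [simp]: "c \<in> \<A> \<Longrightarrow> p \<in> dom_of c \<Longrightarrow> param c (coords c p) = p"
  by (simp add: param_def inv_into_f_f[OF inj_coords])

lemma chart_at: "p \<in> points \<A> \<Longrightarrow> chart_at \<A> p \<in> \<A> \<and> p \<in> dom_of (chart_at \<A> p)"
  unfolding chart_at_def points_def by (rule someI_ex) auto

lemma dom_points: "c \<in> \<A> \<Longrightarrow> p \<in> dom_of c \<Longrightarrow> p \<in> points \<A>"
  by (auto simp: points_def)

lemma chart_at_chart:
  assumes "c \<in> \<A>" "p \<in> dom_of c"
  shows "chart_at \<A> p \<in> \<A>" "p \<in> dom_of (chart_at \<A> p)"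
  using chart_at dom_points assms by blast+

lemma open_overlap: "c \<in> \<A> \<Longrightarrow> d \<in> \<A> \<Longrightarrow> open (coords c ` (dom_of c \<inter> dom_of d))"
  using atlas by (auto simp: smooth_atlas_def)

lemma smooth_transition:
  "c \<in> \<A> \<Longrightarrow> d \<in> \<A> \<Longrightarrow> smooth_on (coords c ` (dom_of c \<inter> dom_of d)) (coords d \<circ> param c)"
  using atlas by (auto simp: smooth_atlas_def)

lemma jac_has_derivative:
  "c \<in> \<A> \<Longrightarrow> d \<in> \<A> \<Longrightarrow> p \<in> dom_of c \<Longrightarrow> p \<in> dom_of d \<Longrightarrow>
    ((coords d \<circ> param c) has_derivative jac c d p) (at (coords c p))"
  unfolding jac_def by (rule smooth_on_has_derivative[OF smooth_transition]) auto

lemma linear_jac: "c \<in> \<A> \<Longrightarrow> d \<in> \<A> \<Longrightarrow> p \<in> dom_of c \<Longrightarrow> p \<in> dom_of d \<Longrightarrow> linear (jac c d p)"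
  by (rule has_derivative_linear[OF jac_has_derivative])

lemma jac_cocycle:
  assumes "c \<in> \<A>" "d \<in> \<A>" "e \<in> \<A>" "p \<in> dom_of c" "p \<in> dom_of d" "p \<in> dom_of e"
  shows "jac d e p (jac c d p w) = jac c e p w"
proof -
  have "((\<lambda>y. (coords e \<circ> param d) ((coords d \<circ> param c) y)) has_derivative
      (\<lambda>w. jac d e p (jac c d p w))) (at (coords c p))"
    by (rule has_derivative_compose[OF jac_has_derivative]) (use assms jac_has_derivative[OF assms(2,3,5,6)] in \<open>simp_all add: comp_def\<close>)
  then show ?thesis
    unfolding jac_def[of c e]
    by (rule fun_cong[OF frechet_derivative_transformI[OF _ open_overlap[of c d]], symmetric]) (use assms in auto)
qed

lemma jac_self:
  assumes "c \<in> \<A>" "p \<in> dom_of c"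
  shows "jac c c p w = w"
proof -
  have "((\<lambda>y. y) has_derivative (\<lambda>w. w)) (at (coords c p))" by simp
  then show ?thesis
    unfolding jac_def
    by (rule fun_cong[OF frechet_derivative_transformI[OF _ open_overlap[of c c]]]) (use assms in auto)
qed

lemma comps_tvec: "c \<in> \<A> \<Longrightarrow> p \<in> dom_of c \<Longrightarrow> comps \<A> c p (tvec \<A> c p w) = w"
  unfolding comps_jac tvec_jac
  by (simp add: jac_cocycle chart_at_chart jac_self)

lemma tvec_comps: "c \<in> \<A> \<Longrightarrow> p \<in> dom_of c \<Longrightarrow> tvec \<A> c p (comps \<A> c p v) = v"
  unfolding comps_jac tvec_jac
  by (simp add: jac_cocycle chart_at_chart jac_self)

lemma linear_comps: "c \<in> \<A> \<Longrightarrow> p \<in> dom_of c \<Longrightarrow> linear (comps \<A> c p)"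
  unfolding comps_jac by (simp add: linear_jac chart_at_chart)

lemma linear_tvec: "c \<in> \<A> \<Longrightarrow> p \<in> dom_of c \<Longrightarrow> linear (tvec \<A> c p)"
  unfolding tvec_jac by (simp add: linear_jac chart_at_chart)

lemma comps_chart_at: "p \<in> points \<A> \<Longrightarrow> comps \<A> (chart_at \<A> p) p v = v"
  unfolding comps_jac by (simp add: jac_self chart_at)

lemma tvec_transition:
  "c \<in> \<A> \<Longrightarrow> d \<in> \<A> \<Longrightarrow> p \<in> dom_of c \<Longrightarrow> p \<in> dom_of d \<Longrightarrow>
    tvec \<A> c p w = tvec \<A> d p (jac c d p w)"
  unfolding tvec_jac by (simp add: jac_cocycle chart_at_chart)

lemma local_form_coords:
  "c \<in> \<A> \<Longrightarrow> p \<in> dom_of c \<Longrightarrow> local_form \<A> c \<alpha> (coords c p) w = \<alpha> p (tvec \<A> c p w)"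
  by (simp add: local_form_def)

lemma form_eq_local_form:
  "c \<in> \<A> \<Longrightarrow> p \<in> dom_of c \<Longrightarrow> \<alpha> p v = local_form \<A> c \<alpha> (coords c p) (comps \<A> c p v)"
  by (simp add: local_form_coords tvec_comps)

lemma local_form_transition:
  assumes "c \<in> \<A>" "d \<in> \<A>" "y \<in> coords c ` (dom_of c \<inter> dom_of d)"
  shows "local_form \<A> c \<alpha> y w = local_form \<A> d \<alpha> ((coords d \<circ> param c) y)
    (frechet_derivative (coords d \<circ> param c) (at y) w)"
proof -
  from assms(3) obtain p where p: "p \<in> dom_of c" "p \<in> dom_of d" "y = coords c p" by auto
  show ?thesis
    using tvec_transition[OF assms(1,2) p(1,2)] p assms by (simp add: local_form_def jac_def)
qed

definition manifold_open :: "'a set \<Rightarrow> bool" where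
  "manifold_open U \<longleftrightarrow> (\<forall>c\<in>\<A>. open (coords c ` (U \<inter> dom_of c)))"

lemma manifold_openD: "manifold_open U \<Longrightarrow> c \<in> \<A> \<Longrightarrow> open (coords c ` (U \<inter> dom_of c))"
  by (simp add: manifold_open_def)

lemma openin_manifold_open: "openin (mtopology \<A>) U \<Longrightarrow> manifold_open U"
  by (simp add: manifold_open_def openin_mtopology[OF atlas])

lemma openin_points: "openin (mtopology \<A>) U \<Longrightarrow> U \<subseteq> points \<A>"
  by (simp add: openin_mtopology[OF atlas])

lemma openin_dom: "c \<in> \<A> \<Longrightarrow> openin (mtopology \<A>) (dom_of c)"
  by (auto simp: openin_mtopology[OF atlas] dom_points Int_commute intro: open_overlap)

lemma smooth_form1_local:
  assumes "smooth_form1 \<A> U \<alpha>" "c \<in> \<A>"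
  shows "\<And>w. smooth_on (coords c ` (U \<inter> dom_of c)) (\<lambda>y. local_form \<A> c \<alpha> y w)"
    and "\<And>y. y \<in> coords c ` (U \<inter> dom_of c) \<Longrightarrow> linear (local_form \<A> c \<alpha> y)"
proof -
  show "smooth_on (coords c ` (U \<inter> dom_of c)) (\<lambda>y. local_form \<A> c \<alpha> y w)" for w
    using assms by (simp add: smooth_form1_def)
  fix y assume "y \<in> coords c ` (U \<inter> dom_of c)"
  then obtain p where p: "p \<in> U" "p \<in> dom_of c" "y = coords c p" by auto
  have "local_form \<A> c \<alpha> y = \<alpha> p \<circ> tvec \<A> c p"
    using p assms(2) by (simp add: fun_eq_iff local_form_coords)
  moreover have "linear (\<alpha> p)" using assms p by (simp add: smooth_form1_def)
  ultimately show "linear (local_form \<A> c \<alpha> y)"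
    using linear_compose[OF linear_tvec] assms(2) p(2) by metis
qed

text \<open>One chart covering \<open>U\<close> is enough, because the expression in any other chart
  is the pull-back by a transition map, which is smooth together with its derivative.\<close>

lemma smooth_form1I:
  assumes c: "c \<in> \<A>" and U: "manifold_open U" "U \<subseteq> dom_of c"
    and lin: "\<And>p. p \<in> U \<Longrightarrow> linear (\<alpha> p)"
    and sm: "\<And>w. smooth_on (coords c ` U) (\<lambda>y. local_form \<A> c \<alpha> y w)"
  shows "smooth_form1 \<A> U \<alpha>"
  unfolding smooth_form1_def
proof (intro conjI ballI allI lin)
  fix d w assume d: "d \<in> \<A>"
  let ?S = "coords d ` (U \<inter> dom_of d)" and ?\<tau> = "coords c \<circ> param d"
  have S: "open ?S" by (rule manifold_openD[OF U(1) d])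
  have S': "?S \<subseteq> coords d ` (dom_of d \<inter> dom_of c)" using U by auto
  have \<tau>: "smooth_on ?S ?\<tau>"
    by (rule smooth_on_subset[OF smooth_transition[OF d c] S'])
  have im: "?\<tau> ` ?S \<subseteq> coords c ` U"
    using d by auto
  have linc: "linear (local_form \<A> c \<alpha> (?\<tau> y))" if "y \<in> ?S" for y
  proof -
    from that obtain p where p: "p \<in> U" "p \<in> dom_of d" "y = coords d p" by auto
    have "local_form \<A> c \<alpha> (?\<tau> y) = \<alpha> p \<circ> tvec \<A> c p"
      using p c d U by (auto simp: fun_eq_iff local_form_coords)
    then show ?thesis
      using linear_compose[OF linear_tvec lin] c p U by (metis subsetD)
  qed
  have "smooth_on ?S (\<lambda>y. local_form \<A> c \<alpha> (?\<tau> y) (frechet_derivative ?\<tau> (at y) w))"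
  proof (rule smooth_on_linear_arg[OF S linc])
    show "smooth_on ?S (\<lambda>y. local_form \<A> c \<alpha> (?\<tau> y) w)" for w
      by (rule smooth_on_compose[OF sm S \<tau> im])
  qed (simp_all add: smooth_on_frechet[OF \<tau>])
  then show "smooth_on ?S (\<lambda>y. local_form \<A> d \<alpha> y w)"
  proof (rule smooth_on_cong[OF S])
    fix y assume "y \<in> ?S"
    then show "local_form \<A> c \<alpha> (?\<tau> y) (frechet_derivative ?\<tau> (at y) w) = local_form \<A> d \<alpha> y w"
      by (rule local_form_transition[OF d c subsetD[OF S'], symmetric])
  qed
qed

text \<open>This is the compatibility of \<open>d\<close> with pull-backs; the terms containing second derivatives
  of the transition map cancel by symmetry.\<close>

lemma ext_d_chart:
  assumes \<alpha>: "smooth_form1 \<A> U \<alpha>" and U: "manifold_open U"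
    and c: "c \<in> \<A>" and p: "p \<in> U" "p \<in> dom_of c"
  shows "ext_d \<A> \<alpha> p v w =
    d_local (local_form \<A> c \<alpha>) (coords c p) (comps \<A> c p v) (comps \<A> c p w)"
proof -
  define c0 where "c0 = chart_at \<A> p"
  have c0: "c0 \<in> \<A>" "p \<in> dom_of c0" using chart_at_chart c p by (auto simp: c0_def)
  define \<tau> where "\<tau> = coords c \<circ> param c0"
  define \<beta> where "\<beta> = local_form \<A> c \<alpha>"
  define J where "J = jac c0 c p"
  let ?y = "coords c0 p" and ?z = "coords c p"
  let ?S = "coords c0 ` (U \<inter> dom_of c0) \<inter> coords c0 ` (dom_of c0 \<inter> dom_of c)"
    and ?T = "coords c ` (U \<inter> dom_of c)"
  have S: "open ?S" using manifold_openD[OF U c0(1)] open_overlap[OF c0(1) c] by (rule open_Int)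
  have y: "?y \<in> ?S" using p c0 by auto
  have T: "open ?T" by (rule manifold_openD[OF U c])
  have z: "?z \<in> ?T" using p by auto
  have \<tau>y: "\<tau> ?y = ?z" using c0 by (simp add: \<tau>_def)
  have \<tau>: "smooth_on ?S \<tau>"
    unfolding \<tau>_def by (rule smooth_on_subset[OF smooth_transition[OF c0(1) c]]) auto
  have \<tau>D: "(\<tau> has_derivative J) (at ?y)"
    unfolding \<tau>_def J_def by (rule jac_has_derivative) (use c c0 p in auto)
  have J: "frechet_derivative \<tau> (at ?y) = J" by (rule frechet_derivative_eqI[OF \<tau>D])
  have im: "\<tau> y \<in> ?T" if yS: "y \<in> ?S" for y
  proof -
    obtain q where q: "q \<in> U" "q \<in> dom_of c0" "y = coords c0 q" using IntD1[OF yS] by blast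
    obtain r where r: "r \<in> dom_of c0" "r \<in> dom_of c" "y = coords c0 r" using IntD2[OF yS] by blast
    have "q = r" using inj_coords[OF c0(1)] q r by (auto dest: inj_onD)
    then show ?thesis using q r c0 by (simp add: \<tau>_def)
  qed
  note \<beta>s = smooth_form1_local(1)[OF \<alpha> c, folded \<beta>_def]
  note \<beta>l = smooth_form1_local(2)[OF \<alpha> c, folded \<beta>_def]
  have D: "frechet_derivative (\<lambda>y. local_form \<A> c0 \<alpha> y w) (at ?y) v =
      frechet_derivative (\<lambda>z. \<beta> z (J w)) (at ?z) (J v) +
      \<beta> ?z (frechet_derivative (\<lambda>y. frechet_derivative \<tau> (at y) w) (at ?y) v)" for v w
  proof -
    have 1: "((\<lambda>y. \<beta> (\<tau> y) b) has_derivative (\<lambda>v. frechet_derivative (\<lambda>z. \<beta> z b) (at ?z) (J v))) (at ?y)" for b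
      using has_derivative_compose[OF \<tau>D, of "\<lambda>z. \<beta> z b"] smooth_on_has_derivative[OF \<beta>s z] \<tau>y by metis
    have 2: "((\<lambda>y. frechet_derivative \<tau> (at y) w \<bullet> b) has_derivative
        (\<lambda>v. frechet_derivative (\<lambda>y. frechet_derivative \<tau> (at y) w) (at ?y) v \<bullet> b)) (at ?y)" for b
      by (rule bounded_linear.has_derivative[OF bounded_linear_inner_left
            smooth_on_has_derivative[OF smooth_on_frechet[OF \<tau>] y]])
    \<comment> \<open>Both the form and its argument move with y; the basis expansion turns the
      pull-back into a sum of products, each covered by the product rule.\<close>
    have "((\<lambda>y. \<Sum>b\<in>Basis. (frechet_derivative \<tau> (at y) w \<bullet> b) *\<^sub>R \<beta> (\<tau> y) b) has_derivative
        (\<lambda>v. \<Sum>b\<in>Basis. (frechet_derivative \<tau> (at ?y) w \<bullet> b) *\<^sub>R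
            frechet_derivative (\<lambda>z. \<beta> z b) (at ?z) (J v) +
          (frechet_derivative (\<lambda>y. frechet_derivative \<tau> (at y) w) (at ?y) v \<bullet> b) *\<^sub>R \<beta> (\<tau> ?y) b)) (at ?y)"
      by (rule has_derivative_sum) (rule has_derivative_scaleR[OF 2 1])
    moreover have "(\<Sum>b\<in>Basis. (frechet_derivative \<tau> (at y) w \<bullet> b) *\<^sub>R \<beta> (\<tau> y) b) = local_form \<A> c0 \<alpha> y w"
      if y: "y \<in> ?S" for y
    proof -
      have "local_form \<A> c0 \<alpha> y w = \<beta> (\<tau> y) (frechet_derivative \<tau> (at y) w)"
        unfolding \<beta>_def \<tau>_def by (rule local_form_transition[OF c0(1) c]) (use y in blast)
      then show ?thesis using linear_euclidean_sum[OF \<beta>l[OF im[OF y]]] by metis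
    qed
    ultimately have "frechet_derivative (\<lambda>y. local_form \<A> c0 \<alpha> y w) (at ?y) =
        (\<lambda>v. \<Sum>b\<in>Basis. (frechet_derivative \<tau> (at ?y) w \<bullet> b) *\<^sub>R
            frechet_derivative (\<lambda>z. \<beta> z b) (at ?z) (J v) +
          (frechet_derivative (\<lambda>y. frechet_derivative \<tau> (at y) w) (at ?y) v \<bullet> b) *\<^sub>R \<beta> (\<tau> ?y) b)"
      by (rule frechet_derivative_transformI[OF _ S y])
    then have "frechet_derivative (\<lambda>y. local_form \<A> c0 \<alpha> y w) (at ?y) v =
      (\<Sum>b\<in>Basis. (J w \<bullet> b) *\<^sub>R frechet_derivative (\<lambda>z. \<beta> z b) (at ?z) (J v)) +
      (\<Sum>b\<in>Basis. (frechet_derivative (\<lambda>y. frechet_derivative \<tau> (at y) w) (at ?y) v \<bullet> b) *\<^sub>R \<beta> ?z b)"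
      by (simp only: sum.distrib J \<tau>y)
    then show ?thesis
      unfolding linear_euclidean_sum[OF \<beta>l[OF z], symmetric]
      by (simp only: frechet_linear_arg[OF T z \<beta>l \<beta>s, of "J w" "J v"])
  qed
  have "ext_d \<A> \<alpha> p v w = d_local \<beta> ?z (J v) (J w)"
    unfolding ext_d_local c0_def[symmetric] unfolding d_local_def D
    using symmetric_second_derivative[OF \<tau> S y] by (metis add_diff_cancel_right)
  then show ?thesis by (simp add: J_def comps_jac c0_def \<beta>_def)
qed

text \<open>Used to rescale a contact form and to read off the entries of a matrix-valued
  form.\<close>

lemma ext_d_bounded_linear:
  assumes \<alpha>: "smooth_form1 \<A> U \<alpha>" and p: "p \<in> U" "p \<in> points \<A>" and h: "bounded_linear h"
  shows "ext_d \<A> (\<lambda>p v. h (\<alpha> p v)) p v w = h (ext_d \<A> \<alpha> p v w)"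
proof -
  let ?c = "chart_at \<A> p"
  have c: "?c \<in> \<A>" "p \<in> dom_of ?c" using chart_at p by auto
  have "frechet_derivative (\<lambda>y. h (local_form \<A> ?c \<alpha> y w)) (at (coords ?c p)) v =
      h (frechet_derivative (\<lambda>y. local_form \<A> ?c \<alpha> y w) (at (coords ?c p)) v)" for v w
    by (rule fun_cong[OF frechet_derivative_eqI[OF bounded_linear.has_derivative[OF h
      smooth_on_has_derivative[OF smooth_form1_local(1)[OF \<alpha> c(1)]]]]]) (use p c in auto)
  then show ?thesis
    unfolding ext_d_local d_local_def
    using bounded_linear.linear[OF h] by (simp add: local_form_def linear_diff)
qed

end

text \<open>\<open>tangent_map\<close> is defined through the preferred charts; by the chain rule it
  may be computed in any charts \<open>c\<close> and \<open>d\<close>. On the open set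
  \<open>V\<close> the map stays inside the domain of \<open>d\<close>, so the coordinate
  expressions agree near the point.\<close>

lemma tangent_map_tvec:
  assumes "manifold_atlas \<A>" "manifold_atlas \<B>"
    and c: "c \<in> \<A>" "p \<in> dom_of c" and d: "d \<in> \<B>" "f p \<in> dom_of d"
    and V: "open V" "coords c p \<in> V" "V \<subseteq> coords c ` dom_of c"
    and im: "\<And>y. y \<in> V \<Longrightarrow> f (param c y) \<in> dom_of d"
    and F: "((coords d \<circ> f \<circ> param c) has_derivative F) (at (coords c p))"
  shows "tangent_map \<A> \<B> f p (tvec \<A> c p w) = tvec \<B> d (f p) (F w)"
proof -
  interpret A: manifold_atlas \<A> by fact
  interpret B: manifold_atlas \<B> by fact
  define c0 where "c0 = chart_at \<A> p"
  define d0 where "d0 = chart_at \<B> (f p)"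
  have c0: "c0 \<in> \<A>" "p \<in> dom_of c0" using A.chart_at_chart c by (auto simp: c0_def)
  have d0: "d0 \<in> \<B>" "f p \<in> dom_of d0" using B.chart_at_chart d by (auto simp: d0_def)
  let ?S = "coords c0 ` (dom_of c0 \<inter> dom_of c)"
  let ?\<tau> = "coords c \<circ> param c0"
  have "continuous_on ?S ?\<tau>"
    using smooth_onD[OF A.smooth_transition[OF c0(1) c(1)], of 0] by simp
  then have W: "open (?S \<inter> ?\<tau> -` V)"
    using A.open_overlap[OF c0(1) c(1)] V(1) by (rule continuous_open_preimage)
  have 1: "((coords d \<circ> f \<circ> param c) has_derivative F) (at (?\<tau> (coords c0 p)))"
    using F c0 by simp
  have 2: "((coords d0 \<circ> param d) has_derivative jac d d0 (f p))
      (at ((coords d \<circ> f \<circ> param c) (?\<tau> (coords c0 p))))"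
    using B.jac_has_derivative[OF d(1) d0(1) d(2) d0(2)] c0 c by simp
  have "((\<lambda>y. (coords d0 \<circ> param d) ((coords d \<circ> f \<circ> param c) (?\<tau> y))) has_derivative
      (\<lambda>v. jac d d0 (f p) (F (jac c0 c p v)))) (at (coords c0 p))"
    using has_derivative_compose[OF has_derivative_compose[OF
      A.jac_has_derivative[OF c0(1) c(1) c0(2) c(2)] 1] 2] .
  then have "frechet_derivative (coords d0 \<circ> f \<circ> param c0) (at (coords c0 p)) =
      (\<lambda>v. jac d d0 (f p) (F (jac c0 c p v)))"
  proof (rule frechet_derivative_transformI[OF _ W])
    show "coords c0 p \<in> ?S \<inter> ?\<tau> -` V" using c0 c V by auto
    fix y assume y: "y \<in> ?S \<inter> ?\<tau> -` V"
    then obtain q where q: "q \<in> dom_of c0" "q \<in> dom_of c" "y = coords c0 q" by auto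
    have "f q \<in> dom_of d" using im[of "coords c q"] y q c0 c by simp
    then show "(coords d0 \<circ> param d) ((coords d \<circ> f \<circ> param c) (?\<tau> y)) = (coords d0 \<circ> f \<circ> param c0) y"
      using q c0 c d by simp
  qed
  then have "tangent_map \<A> \<B> f p v = jac d d0 (f p) (F (jac c0 c p v))" for v
    unfolding tangent_map_def c0_def[symmetric] d0_def[symmetric] by simp
  then show ?thesis
    unfolding tvec_jac c0_def[symmetric] d0_def[symmetric]
    using A.jac_cocycle[of c c0 c p] A.jac_self c c0 by simp
qed

section \<open>Coframe fields on open subsets of three-space\<close>

lemma linear_sum3: "linear f \<Longrightarrow>
    f (a *\<^sub>R u + b *\<^sub>R v + c *\<^sub>R w) = a * f u + b * f v + (c::real) * (f w :: real)"
  by (simp add: linear_add linear_scale)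

lemma two_form_expand:
  fixes \<delta> :: "'e::real_vector \<Rightarrow> 'e \<Rightarrow> real"
  assumes "\<And>w. linear (\<lambda>v. \<delta> v w)" "\<And>v. linear (\<lambda>w. \<delta> v w)" "\<And>v w. \<delta> v w = - \<delta> w v"
    and v: "v = a0 *\<^sub>R e0 + a1 *\<^sub>R e1 + a2 *\<^sub>R e2" and w: "w = b0 *\<^sub>R e0 + b1 *\<^sub>R e1 + b2 *\<^sub>R e2"
  shows "\<delta> v w = \<delta> e0 e1 * (a0 * b1 - b0 * a1) + \<delta> e0 e2 * (a0 * b2 - b0 * a2) +
    \<delta> e1 e2 * (a1 * b2 - b1 * a2)"
proof -
  have "\<delta> v w = a0 * \<delta> e0 w + a1 * \<delta> e1 w + a2 * \<delta> e2 w"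
    unfolding v by (rule linear_sum3[OF assms(1)])
  moreover have "\<delta> e w = b0 * \<delta> e e0 + b1 * \<delta> e e1 + b2 * \<delta> e e2" for e
    unfolding w by (rule linear_sum3[OF assms(2)])
  moreover have "\<delta> e0 e0 = 0" "\<delta> e1 e1 = 0" "\<delta> e2 e2 = 0" "\<delta> e1 e0 = - \<delta> e0 e1"
    "\<delta> e2 e0 = - \<delta> e0 e2" "\<delta> e2 e1 = - \<delta> e1 e2"
    using assms(3)[of e0 e0] assms(3)[of e1 e1] assms(3)[of e2 e2]
      assms(3)[of e1 e0] assms(3)[of e2 e0] assms(3)[of e2 e1] by linarith+
  ultimately show ?thesis by (simp add: algebra_simps)
qed

text \<open>Cramer's rule: up to the triple product, the cross products of pairs form the basis dual
  to n0, n1, n2.\<close>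

lemma cross3_cramer:
  fixes n0 n1 n2 v :: "real^3"
  shows "(n0 \<bullet> cross3 n1 n2) *\<^sub>R v =
    (n0 \<bullet> v) *\<^sub>R cross3 n1 n2 + (n1 \<bullet> v) *\<^sub>R cross3 n2 n0 + (n2 \<bullet> v) *\<^sub>R cross3 n0 n1"
  by (simp add: cross3_simps forall_3)

lemma triple_product_nonzero:
  fixes n0 n1 n2 :: "real^3"
  assumes "\<And>r s t. r *\<^sub>R n0 + s *\<^sub>R n1 + t *\<^sub>R n2 = 0 \<Longrightarrow> r = 0 \<and> s = 0 \<and> t = 0"
  shows "n0 \<bullet> cross3 n1 n2 \<noteq> 0"
proof -
  let ?A = "vector [n0, n1, n2] :: real^3^3"
  have "\<forall>c. (\<Sum>i\<in>UNIV. c i *s row i ?A) = 0 \<longrightarrow> (\<forall>i. c i = 0)"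
  proof (intro allI impI)
    fix c i assume "(\<Sum>i\<in>UNIV. c i *s row i ?A) = 0"
    then have "c 1 *\<^sub>R n0 + c 2 *\<^sub>R n1 + c 3 *\<^sub>R n2 = 0"
      by (simp add: sum_3 row_def vec_eq_iff vector_3 forall_3)
    from assms[OF this] show "c i = 0" using exhaust_3[of i] by metis
  qed
  then have "\<exists>B. ?A ** B = mat 1"
    by (simp add: matrix_right_invertible_independent_rows)
  then have "invertible ?A" by (simp add: invertible_right_inverse)
  then have "det ?A \<noteq> 0" by (simp add: invertible_det_nz)
  then show ?thesis by (simp add: dot_cross_det)
qed

lemmas smooth_on_cross3 [smooth_intros] =
  smooth_on_bilinear[OF bilinear_cross[unfolded bilinear_conv_bounded_bilinear]]

text \<open>The vector that represents a covector through the inner product, so that covectors can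
  enter cross products.\<close>

definition grad_of :: "('e::euclidean_space \<Rightarrow> real) \<Rightarrow> 'e" where
  "grad_of \<alpha> = (\<Sum>b\<in>Basis. \<alpha> b *\<^sub>R b)"

lemma grad_of_inner: "linear \<alpha> \<Longrightarrow> grad_of \<alpha> \<bullet> v = \<alpha> v"
  using linear_euclidean_sum[of \<alpha> v]
  by (simp add: grad_of_def inner_sum_left inner_commute[of v] mult.commute)

text \<open>For independent covectors, Cramer's rule for the vector on which \<alpha> is 1 while
  \<beta> and \<gamma> are 0. The explicit formula makes its smooth dependence on the coframe a
  matter of closure rules.\<close>

definition dual_vector :: "(real^3 \<Rightarrow> real) \<Rightarrow> (real^3 \<Rightarrow> real) \<Rightarrow> (real^3 \<Rightarrow> real) \<Rightarrow> real^3" where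
  "dual_vector \<alpha> \<beta> \<gamma> = (1 / (grad_of \<alpha> \<bullet> cross3 (grad_of \<beta>) (grad_of \<gamma>))) *\<^sub>R
     cross3 (grad_of \<beta>) (grad_of \<gamma>)"

lemma triple_cyclic:
  fixes a b c :: "real^3"
  shows "b \<bullet> cross3 c a = a \<bullet> cross3 b c" "c \<bullet> cross3 a b = a \<bullet> cross3 b c"
  by (simp_all add: cross3_simps)

lemma dual_vector_eqs:
  assumes "linear \<alpha>" "linear \<beta>" "linear \<gamma>"
    and "grad_of \<alpha> \<bullet> cross3 (grad_of \<beta>) (grad_of \<gamma>) \<noteq> 0"
  shows "\<alpha> (dual_vector \<alpha> \<beta> \<gamma>) = 1" "\<beta> (dual_vector \<alpha> \<beta> \<gamma>) = 0" "\<gamma> (dual_vector \<alpha> \<beta> \<gamma>) = 0"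
proof -
  let ?u = "dual_vector \<alpha> \<beta> \<gamma>"
  have "grad_of \<alpha> \<bullet> ?u = 1" "grad_of \<beta> \<bullet> ?u = 0" "grad_of \<gamma> \<bullet> ?u = 0"
    using assms(4) by (simp_all add: dual_vector_def dot_cross_self)
  then show "\<alpha> ?u = 1" "\<beta> ?u = 0" "\<gamma> ?u = 0"
    using assms(1-3) by (simp_all add: grad_of_inner)
qed

section \<open>The dual frame of a smooth coframe field\<close>

locale coframe_field =
  fixes S :: "(real^3) set" and \<beta>0 \<beta>1 \<beta>2 :: "real^3 \<Rightarrow> real^3 \<Rightarrow> real"
  assumes open_S: "open S"
    and smooth0: "\<And>w. smooth_on S (\<lambda>y. \<beta>0 y w)"
    and smooth1: "\<And>w. smooth_on S (\<lambda>y. \<beta>1 y w)"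
    and smooth2: "\<And>w. smooth_on S (\<lambda>y. \<beta>2 y w)"
    and coframe: "\<And>y. y \<in> S \<Longrightarrow> is_coframe (\<beta>0 y, \<beta>1 y, \<beta>2 y)"
begin

lemma linear_coframe:
  assumes "y \<in> S"
  shows "linear (\<beta>0 y)" "linear (\<beta>1 y)" "linear (\<beta>2 y)"
  using coframe[OF assms] by (auto simp: is_coframe_def)

definition e0 :: "real^3 \<Rightarrow> real^3" where "e0 y = dual_vector (\<beta>0 y) (\<beta>1 y) (\<beta>2 y)"
definition e1 :: "real^3 \<Rightarrow> real^3" where "e1 y = dual_vector (\<beta>1 y) (\<beta>2 y) (\<beta>0 y)"
definition e2 :: "real^3 \<Rightarrow> real^3" where "e2 y = dual_vector (\<beta>2 y) (\<beta>0 y) (\<beta>1 y)"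

lemma triple_nonzero:
  assumes "y \<in> S"
  shows "grad_of (\<beta>0 y) \<bullet> cross3 (grad_of (\<beta>1 y)) (grad_of (\<beta>2 y)) \<noteq> 0"
proof (rule triple_product_nonzero)
  fix r s t assume *: "r *\<^sub>R grad_of (\<beta>0 y) + s *\<^sub>R grad_of (\<beta>1 y) + t *\<^sub>R grad_of (\<beta>2 y) = 0"
  have "r * \<beta>0 y v + s * \<beta>1 y v + t * \<beta>2 y v = 0" for v
    using arg_cong[OF *, of "\<lambda>n. n \<bullet> v"] linear_coframe[OF assms]
    by (simp add: inner_add_left grad_of_inner)
  then show "r = 0 \<and> s = 0 \<and> t = 0"
    using coframe[OF assms] unfolding is_coframe_def prod.case by blast
qed

lemma dual_eqs:
  assumes y: "y \<in> S"
  shows "\<beta>0 y (e0 y) = 1" "\<beta>0 y (e1 y) = 0" "\<beta>0 y (e2 y) = 0"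
    "\<beta>1 y (e0 y) = 0" "\<beta>1 y (e1 y) = 1" "\<beta>1 y (e2 y) = 0"
    "\<beta>2 y (e0 y) = 0" "\<beta>2 y (e1 y) = 0" "\<beta>2 y (e2 y) = 1"
proof -
  note lin = linear_coframe[OF y]
  have nz: "grad_of (\<beta>0 y) \<bullet> cross3 (grad_of (\<beta>1 y)) (grad_of (\<beta>2 y)) \<noteq> 0"
    "grad_of (\<beta>1 y) \<bullet> cross3 (grad_of (\<beta>2 y)) (grad_of (\<beta>0 y)) \<noteq> 0"
    "grad_of (\<beta>2 y) \<bullet> cross3 (grad_of (\<beta>0 y)) (grad_of (\<beta>1 y)) \<noteq> 0"
    using triple_nonzero[OF y] by (simp_all only: triple_cyclic(1)[of "grad_of (\<beta>1 y)"]
      triple_cyclic(2)[of "grad_of (\<beta>2 y)"] not_False_eq_True)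
  show "\<beta>0 y (e0 y) = 1" "\<beta>1 y (e0 y) = 0" "\<beta>2 y (e0 y) = 0"
    using dual_vector_eqs[OF lin(1,2,3) nz(1)] by (simp_all add: e0_def)
  show "\<beta>0 y (e1 y) = 0" "\<beta>1 y (e1 y) = 1" "\<beta>2 y (e1 y) = 0"
    using dual_vector_eqs[OF lin(2,3,1) nz(2)] by (simp_all add: e1_def)
  show "\<beta>0 y (e2 y) = 0" "\<beta>1 y (e2 y) = 0" "\<beta>2 y (e2 y) = 1"
    using dual_vector_eqs[OF lin(3,1,2) nz(3)] by (simp_all add: e2_def)
qed

lemma frame_expand:
  assumes "y \<in> S"
  shows "v = \<beta>0 y v *\<^sub>R e0 y + \<beta>1 y v *\<^sub>R e1 y + \<beta>2 y v *\<^sub>R e2 y"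
proof -
  let ?n0 = "grad_of (\<beta>0 y)" and ?n1 = "grad_of (\<beta>1 y)" and ?n2 = "grad_of (\<beta>2 y)"
  let ?d = "?n0 \<bullet> cross3 ?n1 ?n2"
  have d: "?d \<noteq> 0" by (rule triple_nonzero[OF assms])
  have "v = (1 / ?d) *\<^sub>R (?d *\<^sub>R v)" using d by simp
  also have "\<dots> = \<beta>0 y v *\<^sub>R e0 y + \<beta>1 y v *\<^sub>R e1 y + \<beta>2 y v *\<^sub>R e2 y"
    unfolding cross3_cramer[of ?n0 ?n1 ?n2 v] grad_of_inner[OF linear_coframe(1)[OF assms], of v]
      grad_of_inner[OF linear_coframe(2)[OF assms], of v] grad_of_inner[OF linear_coframe(3)[OF assms], of v]
    by (simp add: e0_def e1_def e2_def dual_vector_def triple_cyclic(1)[of ?n1 ?n2 ?n0]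
        triple_cyclic(2)[of ?n2 ?n0 ?n1] scaleR_add_right)
  finally show ?thesis .
qed

lemma smooth_grad:
  "smooth_on S (\<lambda>y. grad_of (\<beta>0 y))" "smooth_on S (\<lambda>y. grad_of (\<beta>1 y))"
  "smooth_on S (\<lambda>y. grad_of (\<beta>2 y))"
  unfolding grad_of_def by (intro smooth_intros open_S smooth0 smooth1 smooth2)+

lemma smooth_frame: "smooth_on S e0" "smooth_on S e1" "smooth_on S e2"
proof -
  have nz: "grad_of (\<beta>1 y) \<bullet> cross3 (grad_of (\<beta>2 y)) (grad_of (\<beta>0 y)) \<noteq> 0"
    "grad_of (\<beta>2 y) \<bullet> cross3 (grad_of (\<beta>0 y)) (grad_of (\<beta>1 y)) \<noteq> 0" if "y \<in> S" for y
    using triple_nonzero[OF that] triple_cyclic by metis+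
  have "smooth_on S (\<lambda>y. e0 y)" "smooth_on S (\<lambda>y. e1 y)" "smooth_on S (\<lambda>y. e2 y)"
    unfolding e0_def e1_def e2_def dual_vector_def
    by (intro smooth_intros open_S smooth_grad triple_nonzero nz; assumption)+
  then show "smooth_on S e0" "smooth_on S e1" "smooth_on S e2" .
qed

lemma d_expand:
  assumes y: "y \<in> S" and lin: "\<And>y. y \<in> S \<Longrightarrow> linear (\<alpha> y)" and sm: "\<And>w. smooth_on S (\<lambda>y. \<alpha> y w)"
  shows "d_local \<alpha> y v w = d_local \<alpha> y (e0 y) (e1 y) * wedge \<beta>0 \<beta>1 y v w +
    d_local \<alpha> y (e0 y) (e2 y) * wedge \<beta>0 \<beta>2 y v w +
    d_local \<alpha> y (e1 y) (e2 y) * (wedge \<beta>1 \<beta>2 y v w :: real)"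
  unfolding wedge_def
  using two_form_expand[OF linear_d_local1[OF open_S lin sm y] linear_d_local2[OF open_S lin sm y]
    d_local_skew frame_expand[OF y] frame_expand[OF y], of v w]
  by (simp add: mult.commute)

end

text \<open>The identity d(d\<beta>) = 0 on constant coordinate fields u, v, w: the six second
  derivatives cancel in pairs by symmetry.\<close>

lemma d_d_local:
  fixes \<beta> :: "'e::euclidean_space \<Rightarrow> 'e \<Rightarrow> 'v::euclidean_space"
  assumes S: "open S" and y: "y \<in> S" and sm: "\<And>w. smooth_on S (\<lambda>y. \<beta> y w)"
  shows "frechet_derivative (\<lambda>y. d_local \<beta> y v w) (at y) u +
    frechet_derivative (\<lambda>y. d_local \<beta> y w u) (at y) v +
    frechet_derivative (\<lambda>y. d_local \<beta> y u v) (at y) w = 0"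
proof -
  have "((\<lambda>y. d_local \<beta> y v w) has_derivative
     (\<lambda>u. frechet_derivative (\<lambda>y. frechet_derivative (\<lambda>y. \<beta> y w) (at y) v) (at y) u -
          frechet_derivative (\<lambda>y. frechet_derivative (\<lambda>y. \<beta> y v) (at y) w) (at y) u)) (at y)" for v w
    unfolding d_local_def
    by (intro has_derivative_diff smooth_on_has_derivative[OF smooth_on_frechet[OF sm] y])
  then have D: "frechet_derivative (\<lambda>y. d_local \<beta> y v w) (at y) u =
      frechet_derivative (\<lambda>y. frechet_derivative (\<lambda>y. \<beta> y w) (at y) v) (at y) u -
      frechet_derivative (\<lambda>y. frechet_derivative (\<lambda>y. \<beta> y v) (at y) w) (at y) u" for u v w
    by (rule fun_cong[OF frechet_derivative_eqI])
  have sym: "frechet_derivative (\<lambda>y. frechet_derivative (\<lambda>y. \<beta> y w) (at y) v) (at y) u =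
      frechet_derivative (\<lambda>y. frechet_derivative (\<lambda>y. \<beta> y w) (at y) u) (at y) v" for u v w
    by (rule symmetric_second_derivative[OF sm S y])
  show ?thesis
    unfolding D using sym[of u v w] sym[of w v u] sym[of v w u] by (simp add: algebra_simps)
qed

lemma wedge_has_derivative:
  assumes "smooth_on S (\<lambda>y. \<alpha> y v)" "smooth_on S (\<lambda>y. \<alpha> y w)"
    "smooth_on S (\<lambda>y. \<beta> y v)" "smooth_on S (\<lambda>y. \<beta> y w)" and y: "y \<in> S"
  shows "((\<lambda>y. wedge \<alpha> \<beta> y v w) has_derivative (\<lambda>u.
    (\<alpha> y v * frechet_derivative (\<lambda>y. \<beta> y w) (at y) u + frechet_derivative (\<lambda>y. \<alpha> y v) (at y) u * \<beta> y w) -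
    (\<alpha> y w * frechet_derivative (\<lambda>y. \<beta> y v) (at y) u + frechet_derivative (\<lambda>y. \<alpha> y w) (at y) u * \<beta> y v))) (at y)"
  unfolding wedge_def
  by (intro has_derivative_diff has_derivative_mult smooth_on_has_derivative[OF _ y] assms)

section \<open>The structure equations of an adapted coframe on the base\<close>

locale adapted_coframe_field = coframe_field +
  assumes adapted: "\<And>y v w. y \<in> S \<Longrightarrow> \<beta>0 y v = 0 \<Longrightarrow> \<beta>0 y w = 0 \<Longrightarrow>
    d_local \<beta>0 y v w = wedge \<beta>1 \<beta>2 y v w"
begin

text \<open>With members of the dual frame as \<open>e\<close> and \<open>f\<close>, these are the
  components of the exterior derivative of \<alpha> in the coframe.\<close>

definition T :: "(real^3 \<Rightarrow> real^3 \<Rightarrow> real) \<Rightarrow> (real^3 \<Rightarrow> real^3) \<Rightarrow> (real^3 \<Rightarrow> real^3) \<Rightarrow> real^3 \<Rightarrow> real"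
  where "T \<alpha> e f y = d_local \<alpha> y (e y) (f y)"

text \<open>The coefficients of \<open>\<phi>\<close> and \<open>\<kappa>\<close> (the form \<open>w\<close> of the theorem) are the solution of the linear system
  obtained by comparing components in the structure equations.\<close>

definition \<phi> :: "real^3 \<Rightarrow> real^3 \<Rightarrow> real" where
  "\<phi> y v = (T \<beta>1 e0 e1 y + T \<beta>2 e0 e2 y) / 2 * \<beta>0 y v - T \<beta>0 e0 e1 y / 2 * \<beta>1 y v -
     T \<beta>0 e0 e2 y / 2 * \<beta>2 y v"

definition \<kappa> :: "real^3 \<Rightarrow> real^3 \<Rightarrow> real" where
  "\<kappa> y v = (T \<beta>1 e0 e1 y - T \<beta>2 e0 e2 y) / 6 * \<beta>0 y v -
     (T \<beta>0 e0 e1 y / 2 + T \<beta>2 e1 e2 y) / 3 * \<beta>1 y v +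
     (T \<beta>0 e0 e2 y / 2 - T \<beta>1 e1 e2 y) / 3 * \<beta>2 y v"

lemma d_expand_T:
  assumes "y \<in> S" "\<And>y. y \<in> S \<Longrightarrow> linear (\<alpha> y)" "\<And>w. smooth_on S (\<lambda>y. \<alpha> y w)"
  shows "d_local \<alpha> y v w = T \<alpha> e0 e1 y * wedge \<beta>0 \<beta>1 y v w + T \<alpha> e0 e2 y * wedge \<beta>0 \<beta>2 y v w +
    T \<alpha> e1 e2 y * wedge \<beta>1 \<beta>2 y v w"
  unfolding T_def by (rule d_expand[OF assms])

lemma smooth_T:
  assumes "\<And>y. y \<in> S \<Longrightarrow> linear (\<alpha> y)" "\<And>w. smooth_on S (\<lambda>y. \<alpha> y w)"
    "smooth_on S e" "smooth_on S f"
  shows "smooth_on S (T \<alpha> e f)"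
  unfolding T_def by (rule smooth_d_local[OF open_S assms])

lemmas smooth_T_coframe =
  smooth_T[OF linear_coframe(1) smooth0 smooth_frame(1) smooth_frame(2)]
  smooth_T[OF linear_coframe(1) smooth0 smooth_frame(1) smooth_frame(3)]
  smooth_T[OF linear_coframe(2) smooth1 smooth_frame(1) smooth_frame(2)]
  smooth_T[OF linear_coframe(2) smooth1 smooth_frame(1) smooth_frame(3)]
  smooth_T[OF linear_coframe(2) smooth1 smooth_frame(2) smooth_frame(3)]
  smooth_T[OF linear_coframe(3) smooth2 smooth_frame(1) smooth_frame(2)]
  smooth_T[OF linear_coframe(3) smooth2 smooth_frame(1) smooth_frame(3)]
  smooth_T[OF linear_coframe(3) smooth2 smooth_frame(2) smooth_frame(3)]

lemma smooth_\<phi>: "smooth_on S (\<lambda>y. \<phi> y v)"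
  unfolding \<phi>_def
  by (intro smooth_intros open_S smooth0 smooth1 smooth2 smooth_T_coframe) simp_all

lemma smooth_\<kappa>: "smooth_on S (\<lambda>y. \<kappa> y v)"
  unfolding \<kappa>_def
  by (intro smooth_intros open_S smooth0 smooth1 smooth2 smooth_T_coframe) simp_all

lemma linear_combination3:
  assumes "linear f" "linear g" "linear h"
  shows "linear (\<lambda>v. (a::real) * f v + b * g v + c * (h v :: real))"
  using assms by (intro linearI) (simp_all add: linear_add linear_scale algebra_simps)

lemma linear_\<phi>:
  assumes "y \<in> S"
  shows "linear (\<phi> y)"
proof -
  have "\<phi> y = (\<lambda>v. (T \<beta>1 e0 e1 y + T \<beta>2 e0 e2 y) / 2 * \<beta>0 y v + (- T \<beta>0 e0 e1 y / 2) * \<beta>1 y v +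
      (- T \<beta>0 e0 e2 y / 2) * \<beta>2 y v)"
    by (simp add: \<phi>_def fun_eq_iff)
  then show ?thesis
    by (simp only: linear_combination3[OF linear_coframe[OF assms]])
qed

lemma linear_\<kappa>:
  assumes "y \<in> S"
  shows "linear (\<kappa> y)"
proof -
  have "\<kappa> y = (\<lambda>v. (T \<beta>1 e0 e1 y - T \<beta>2 e0 e2 y) / 6 * \<beta>0 y v +
      (- (T \<beta>0 e0 e1 y / 2 + T \<beta>2 e1 e2 y) / 3) * \<beta>1 y v +
      (T \<beta>0 e0 e2 y / 2 - T \<beta>1 e1 e2 y) / 3 * \<beta>2 y v)"
    by (simp add: \<kappa>_def fun_eq_iff field_simps)
  then show ?thesis
    by (simp only: linear_combination3[OF linear_coframe[OF assms]])
qed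

lemma T_adapted: "y \<in> S \<Longrightarrow> T \<beta>0 e1 e2 y = 1"
  by (simp add: T_def adapted dual_eqs wedge_def)

text \<open>The components along \<beta>0 \<and> \<beta>1 and \<beta>0 \<and> \<beta>2 fix the
  \<beta>1 and \<beta>2 coefficients of \<open>\<phi>\<close>; the component along \<beta>1 \<and>
  \<beta>2 is 1 by adaptedness. The \<beta>0 coefficient drops out of \<phi> \<and> \<beta>0 and is
  left to the other two equations.\<close>

lemma structure0:
  assumes "y \<in> S"
  shows "d_local \<beta>0 y v w = wedge \<beta>1 \<beta>2 y v w + 2 * wedge \<phi> \<beta>0 y v w"
  using d_expand_T[where \<alpha> = \<beta>0 and v = v and w = w, OF assms linear_coframe(1) smooth0] T_adapted[OF assms]
  by (simp add: wedge_def \<phi>_def algebra_simps add_divide_distrib diff_divide_distrib)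

text \<open>Read together with \<open>structure2\<close>: the \<beta>0 \<and> \<beta>1 component
  here and the \<beta>0 \<and> \<beta>2 component there give the \<beta>0 coefficients of \<phi> + 3
  \<kappa> and \<phi> - 3 \<kappa>; the \<beta>1 \<and> \<beta>2 components give the remaining two
  coefficients of \<open>\<kappa>\<close>; the component left over in each equation is the
  torsion.\<close>

lemma structure1:
  assumes "y \<in> S"
  shows "d_local \<beta>1 y v w = wedge \<phi> \<beta>1 y v w + 3 * wedge \<kappa> \<beta>1 y v w + T \<beta>1 e0 e2 y * wedge \<beta>0 \<beta>2 y v w"
  using d_expand_T[where \<alpha> = \<beta>1 and v = v and w = w, OF assms linear_coframe(2) smooth1]
  by (simp add: wedge_def \<phi>_def \<kappa>_def field_simps)

lemma structure2:
  assumes "y \<in> S"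
  shows "d_local \<beta>2 y v w = wedge \<phi> \<beta>2 y v w - 3 * wedge \<kappa> \<beta>2 y v w + T \<beta>2 e0 e1 y * wedge \<beta>0 \<beta>1 y v w"
  using d_expand_T[where \<alpha> = \<beta>2 and v = v and w = w, OF assms linear_coframe(3) smooth2]
  by (simp add: wedge_def \<phi>_def \<kappa>_def field_simps)

text \<open>Taking \<open>d\<close> of the first structure equation gives \<open>d\<phi> \<and> \<beta>0 = 0\<close>.\<close>

lemma T_\<phi>: assumes y: "y \<in> S" shows "T \<phi> e1 e2 y = 0"
proof -
  let ?D = "\<lambda>\<alpha> v u. frechet_derivative (\<lambda>y. \<alpha> y v) (at y) u"
  have D: "frechet_derivative (\<lambda>y. d_local \<beta>0 y v w) (at y) u =
     (\<beta>1 y v * ?D \<beta>2 w u + ?D \<beta>1 v u * \<beta>2 y w) - (\<beta>1 y w * ?D \<beta>2 v u + ?D \<beta>1 w u * \<beta>2 y v) +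
     2 * ((\<phi> y v * ?D \<beta>0 w u + ?D \<phi> v u * \<beta>0 y w) - (\<phi> y w * ?D \<beta>0 v u + ?D \<phi> w u * \<beta>0 y v))"
    for u v w
  proof -
    have "((\<lambda>y. wedge \<beta>1 \<beta>2 y v w + 2 * wedge \<phi> \<beta>0 y v w) has_derivative (\<lambda>u.
     (\<beta>1 y v * ?D \<beta>2 w u + ?D \<beta>1 v u * \<beta>2 y w) - (\<beta>1 y w * ?D \<beta>2 v u + ?D \<beta>1 w u * \<beta>2 y v) +
     2 * ((\<phi> y v * ?D \<beta>0 w u + ?D \<phi> v u * \<beta>0 y w) - (\<phi> y w * ?D \<beta>0 v u + ?D \<phi> w u * \<beta>0 y v)))) (at y)"
      by (intro has_derivative_add has_derivative_mult_right wedge_has_derivative[OF _ _ _ _ y]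
          smooth0 smooth1 smooth2 smooth_\<phi>)
    then show ?thesis
      by (rule fun_cong[OF frechet_derivative_transformI[OF _ open_S y]]) (simp add: structure0)
  qed
  define f where "f \<alpha> e g = ?D \<alpha> (g y) (e y)" for \<alpha> :: "real^3 \<Rightarrow> real^3 \<Rightarrow> real" and e g
  have T: "T \<alpha> e g y = f \<alpha> e g - f \<alpha> g e" for \<alpha> e g
    by (simp add: T_def d_local_def f_def)
  have "\<phi> y (e0 y) = (T \<beta>1 e0 e1 y + T \<beta>2 e0 e2 y) / 2" "\<phi> y (e1 y) = - T \<beta>0 e0 e1 y / 2"
    "\<phi> y (e2 y) = - T \<beta>0 e0 e2 y / 2"
    using y by (simp_all add: \<phi>_def dual_eqs)
  moreover have "T \<beta>0 e1 e2 y = 1" by (rule T_adapted[OF y])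
  \<comment> \<open>This is d(d\<beta>0) on the dual frame frozen at y. The first two terms add up
    to 2 \<phi>(e0), which the right-hand side matches since \<open>T \<beta>0 e1 e2 y\<close> is 1;
    the products on the right cancel because \<phi>(e1) and \<phi>(e2) are - 1/2 times
    \<open>T \<beta>0 e0 e1 y\<close> and \<open>T \<beta>0 e0 e2 y\<close>.\<close>
  moreover have "T \<beta>2 e0 e2 y + T \<beta>1 e0 e1 y + 2 * T \<phi> e1 e2 y =
     2 * (\<phi> y (e0 y) * T \<beta>0 e1 e2 y - \<phi> y (e1 y) * T \<beta>0 e0 e2 y + \<phi> y (e2 y) * T \<beta>0 e0 e1 y)"
    using d_d_local[where \<beta> = \<beta>0, OF open_S y smooth0, where v = "e1 y" and w = "e2 y" and u = "e0 y"]
    unfolding D f_def[symmetric] dual_eqs[OF y] T by (simp add: algebra_simps)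
  ultimately show ?thesis by (simp add: algebra_simps)
qed

lemma d_\<phi>:
  assumes "y \<in> S"
  shows "d_local \<phi> y v w = T \<phi> e0 e1 y * wedge \<beta>0 \<beta>1 y v w + T \<phi> e0 e2 y * wedge \<beta>0 \<beta>2 y v w"
  using d_expand_T[where \<alpha> = \<phi> and v = v and w = w, OF assms linear_\<phi> smooth_\<phi>] T_\<phi>[OF assms] by simp

lemma d_\<kappa>:
  assumes "y \<in> S"
  shows "d_local \<kappa> y v w = T \<kappa> e0 e1 y * wedge \<beta>0 \<beta>1 y v w + T \<kappa> e0 e2 y * wedge \<beta>0 \<beta>2 y v w +
    T \<kappa> e1 e2 y * wedge \<beta>1 \<beta>2 y v w"
  using d_expand_T[where \<alpha> = \<kappa> and v = v and w = w, OF assms linear_\<kappa> smooth_\<kappa>] .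

end

section \<open>The structure equations on a trivialised bundle\<close>

type_synonym fibre_coords = "(real^3) \<times> real \<times> real"

lemma smooth_on_fst_compose:
  fixes f :: "'a::euclidean_space \<Rightarrow> 'c::real_normed_vector"
  assumes "smooth_on S f" "open (S \<times> (T :: 'b::euclidean_space set))"
  shows "smooth_on (S \<times> T) (\<lambda>z. f (fst z))"
  by (rule smooth_on_compose[OF assms(1) assms(2) smooth_on_linear[OF bounded_linear_fst]]) auto

context adapted_coframe_field
begin

definition fibred :: "fibre_coords set" where
  "fibred = S \<times> (- {0}) \<times> (- {0})"

lemma open_fibred: "open fibred"
  unfolding fibred_def by (intro open_Times open_S) auto

lemma fibredD:
  assumes "z \<in> fibred"
  shows "fst z \<in> S" "fst (snd z) \<noteq> 0" "snd (snd z) \<noteq> 0"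
  using assms by (auto simp: fibred_def)

text \<open>These three forms are the local expressions of the tautological forms, as
  \<open>local_taut\<close> confirms: the coframe with fibre coordinates a, b is the section acted
  on by diag(a, 1/(a b), b).\<close>

definition \<Omega>0 :: "fibre_coords \<Rightarrow> fibre_coords \<Rightarrow> real" where
  "\<Omega>0 z v = fst (snd z) / snd (snd z) * \<beta>0 (fst z) (fst v)"
definition \<Omega>1 :: "fibre_coords \<Rightarrow> fibre_coords \<Rightarrow> real" where
  "\<Omega>1 z v = (fst (snd z))\<^sup>2 * snd (snd z) * \<beta>1 (fst z) (fst v)"
definition \<Omega>2 :: "fibre_coords \<Rightarrow> fibre_coords \<Rightarrow> real" where
  "\<Omega>2 z v = 1 / (fst (snd z) * (snd (snd z))\<^sup>2) * \<beta>2 (fst z) (fst v)"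
definition \<Phi> :: "fibre_coords \<Rightarrow> fibre_coords \<Rightarrow> real" where
  "\<Phi> z v = \<phi> (fst z) (fst v) + (fst (snd v) / fst (snd z) - snd (snd v) / snd (snd z)) / 2"
definition K :: "fibre_coords \<Rightarrow> fibre_coords \<Rightarrow> real" where
  "K z v = \<kappa> (fst z) (fst v) + (fst (snd v) / fst (snd z) + snd (snd v) / snd (snd z)) / 2"

text \<open>The powers of a and b here and below undo the scaling of the two-forms: \<Omega>0 \<and>
  \<Omega>1, \<Omega>0 \<and> \<Omega>2 and \<Omega>1 \<and> \<Omega>2 are a^3, b^(-3) and a/b times
  the corresponding products on the base. The torsions carry in addition the scale factor of
  \<Omega>1 or \<Omega>2.\<close>

definition coef_A :: "fibre_coords \<Rightarrow> real" where
  "coef_A z = T \<phi> e0 e1 (fst z) / fst (snd z) ^ 3"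
definition coef_B :: "fibre_coords \<Rightarrow> real" where
  "coef_B z = T \<phi> e0 e2 (fst z) * snd (snd z) ^ 3"
definition coef_C :: "fibre_coords \<Rightarrow> real" where
  "coef_C z = T \<kappa> e0 e1 (fst z) / fst (snd z) ^ 3"
definition coef_D :: "fibre_coords \<Rightarrow> real" where
  "coef_D z = T \<kappa> e0 e2 (fst z) * snd (snd z) ^ 3"
definition coef_S :: "fibre_coords \<Rightarrow> real" where
  "coef_S z = T \<kappa> e1 e2 (fst z) * snd (snd z) / fst (snd z)"
definition torsion1 :: "fibre_coords \<Rightarrow> real" where
  "torsion1 z = T \<beta>1 e0 e2 (fst z) * fst (snd z) ^ 2 * snd (snd z) ^ 4"
definition torsion2 :: "fibre_coords \<Rightarrow> real" where
  "torsion2 z = - T \<beta>2 e0 e1 (fst z) / (fst (snd z) ^ 4 * snd (snd z) ^ 2)"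

lemma smooth_fibred_fst: "smooth_on S f \<Longrightarrow> smooth_on fibred (\<lambda>z. f (fst z))"
  using smooth_on_fst_compose[of S f "(- {0}) \<times> (- {0})"] open_fibred by (simp add: fibred_def)

lemma smooth_coords:
  "smooth_on fibred (\<lambda>z. fst (snd z))" "smooth_on fibred (\<lambda>z. snd (snd z))"
  by (intro smooth_intros open_fibred)+

lemma smooth_fibred_forms:
  "smooth_on fibred (\<lambda>z. \<Omega>0 z v)" "smooth_on fibred (\<lambda>z. \<Omega>1 z v)" "smooth_on fibred (\<lambda>z. \<Omega>2 z v)"
  "smooth_on fibred (\<lambda>z. \<Phi> z v)" "smooth_on fibred (\<lambda>z. K z v)"
  unfolding \<Omega>0_def \<Omega>1_def \<Omega>2_def \<Phi>_def K_def
  using smooth_fibred_fst[OF smooth0] smooth_fibred_fst[OF smooth1] smooth_fibred_fst[OF smooth2]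
    smooth_fibred_fst[OF smooth_\<phi>] smooth_fibred_fst[OF smooth_\<kappa>]
  by (intro smooth_intros open_fibred smooth_coords; simp add: fibredD)+

lemma smooth_coefs:
  "smooth_on fibred coef_A" "smooth_on fibred coef_B" "smooth_on fibred coef_C"
  "smooth_on fibred coef_D" "smooth_on fibred coef_S"
  "smooth_on fibred torsion1" "smooth_on fibred torsion2"
proof -
  note Ts = smooth_T[OF linear_\<phi> smooth_\<phi> smooth_frame(1,2)] smooth_T[OF linear_\<phi> smooth_\<phi> smooth_frame(1,3)]
    smooth_T[OF linear_\<kappa> smooth_\<kappa> smooth_frame(1,2)] smooth_T[OF linear_\<kappa> smooth_\<kappa> smooth_frame(1,3)]
    smooth_T[OF linear_\<kappa> smooth_\<kappa> smooth_frame(2,3)]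
    smooth_T[OF linear_coframe(2) smooth1 smooth_frame(1,3)] smooth_T[OF linear_coframe(3) smooth2 smooth_frame(1,2)]
  note sm = smooth_fibred_fst[OF Ts(1)] smooth_fibred_fst[OF Ts(2)] smooth_fibred_fst[OF Ts(3)]
    smooth_fibred_fst[OF Ts(4)] smooth_fibred_fst[OF Ts(5)] smooth_fibred_fst[OF Ts(6)] smooth_fibred_fst[OF Ts(7)]
  have "smooth_on fibred (\<lambda>z. coef_A z)" "smooth_on fibred (\<lambda>z. coef_B z)" "smooth_on fibred (\<lambda>z. coef_C z)"
    "smooth_on fibred (\<lambda>z. coef_D z)" "smooth_on fibred (\<lambda>z. coef_S z)"
    "smooth_on fibred (\<lambda>z. torsion1 z)" "smooth_on fibred (\<lambda>z. torsion2 z)"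
    unfolding coef_A_def coef_B_def coef_C_def coef_D_def coef_S_def torsion1_def torsion2_def
    by (intro smooth_intros open_fibred smooth_coords sm; simp add: fibredD)+
  then show "smooth_on fibred coef_A" "smooth_on fibred coef_B" "smooth_on fibred coef_C"
    "smooth_on fibred coef_D" "smooth_on fibred coef_S"
    "smooth_on fibred torsion1" "smooth_on fibred torsion2" .
qed

lemma linear_fibred_forms:
  assumes "z \<in> fibred"
  shows "linear (\<Omega>0 z)" "linear (\<Omega>1 z)" "linear (\<Omega>2 z)" "linear (\<Phi> z)" "linear (K z)"
  using linear_coframe[OF fibredD(1)[OF assms]] linear_\<phi>[OF fibredD(1)[OF assms]]
    linear_\<kappa>[OF fibredD(1)[OF assms]]
  by (auto intro!: linearI simp: \<Omega>0_def \<Omega>1_def \<Omega>2_def \<Phi>_def K_def linear_add linear_scale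
      algebra_simps add_divide_distrib diff_divide_distrib)

text \<open>With \<open>l\<close> the logarithmic derivative of \<open>g\<close>, this is d(g
  \<beta>) = g (d\<beta> + l \<and> \<beta>); the next three lemmas differ in the scale factor and
  its \<open>l\<close>.\<close>

lemma d_local_scaled:
  fixes \<beta> :: "real^3 \<Rightarrow> real^3 \<Rightarrow> real"
  assumes z: "z \<in> fibred" and g: "(g has_derivative (\<lambda>u. g z * l u)) (at z)"
    and sm: "\<And>w. smooth_on S (\<lambda>y. \<beta> y w)"
  shows "d_local (\<lambda>z v. g z * \<beta> (fst z) (fst v)) z u v =
    g z * (d_local \<beta> (fst z) (fst u) (fst v) + l u * \<beta> (fst z) (fst v) - l v * \<beta> (fst z) (fst u))"
proof -
  have "((\<lambda>z. \<beta> (fst z) w) has_derivative (\<lambda>u. frechet_derivative (\<lambda>y. \<beta> y w) (at (fst z)) (fst u))) (at z)" for w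
    by (rule has_derivative_compose[OF has_derivative_fst[OF has_derivative_ident]
          smooth_on_has_derivative[OF sm fibredD(1)[OF z]]])
  from has_derivative_mult[OF g this]
  have "frechet_derivative (\<lambda>z. g z * \<beta> (fst z) w) (at z) u =
     g z * frechet_derivative (\<lambda>y. \<beta> y w) (at (fst z)) (fst u) + g z * l u * \<beta> (fst z) w" for u w
    by (rule fun_cong[OF frechet_derivative_eqI])
  then show ?thesis by (simp add: d_local_def algebra_simps)
qed

lemma d_\<Omega>0:
  assumes "z \<in> fibred"
  shows "d_local \<Omega>0 z u v = fst (snd z) / snd (snd z) * (d_local \<beta>0 (fst z) (fst u) (fst v) +
    (fst (snd u) / fst (snd z) - snd (snd u) / snd (snd z)) * \<beta>0 (fst z) (fst v) -
    (fst (snd v) / fst (snd z) - snd (snd v) / snd (snd z)) * \<beta>0 (fst z) (fst u))"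
  unfolding \<Omega>0_def[abs_def]
proof (rule d_local_scaled[OF assms _ smooth0])
  show "((\<lambda>z. fst (snd z) / snd (snd z)) has_derivative (\<lambda>u. fst (snd z) / snd (snd z) *
      (fst (snd u) / fst (snd z) - snd (snd u) / snd (snd z)))) (at z)"
    using fibredD[OF assms]
    by (auto intro!: derivative_eq_intros simp: field_simps fun_eq_iff power2_eq_square)
qed

lemma d_\<Omega>1:
  assumes "z \<in> fibred"
  shows "d_local \<Omega>1 z u v = (fst (snd z))\<^sup>2 * snd (snd z) * (d_local \<beta>1 (fst z) (fst u) (fst v) +
    (2 * (fst (snd u) / fst (snd z)) + snd (snd u) / snd (snd z)) * \<beta>1 (fst z) (fst v) -
    (2 * (fst (snd v) / fst (snd z)) + snd (snd v) / snd (snd z)) * \<beta>1 (fst z) (fst u))"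
  unfolding \<Omega>1_def[abs_def]
proof (rule d_local_scaled[OF assms _ smooth1])
  show "((\<lambda>z. (fst (snd z))\<^sup>2 * snd (snd z)) has_derivative (\<lambda>u. (fst (snd z))\<^sup>2 * snd (snd z) *
      (2 * (fst (snd u) / fst (snd z)) + snd (snd u) / snd (snd z)))) (at z)"
    using fibredD[OF assms]
    by (auto intro!: derivative_eq_intros simp: field_simps fun_eq_iff power2_eq_square)
qed

lemma d_\<Omega>2:
  assumes "z \<in> fibred"
  shows "d_local \<Omega>2 z u v = 1 / (fst (snd z) * (snd (snd z))\<^sup>2) * (d_local \<beta>2 (fst z) (fst u) (fst v) +
    (- (fst (snd u) / fst (snd z)) - 2 * (snd (snd u) / snd (snd z))) * \<beta>2 (fst z) (fst v) -
    (- (fst (snd v) / fst (snd z)) - 2 * (snd (snd v) / snd (snd z))) * \<beta>2 (fst z) (fst u))"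
  unfolding \<Omega>2_def[abs_def]
proof (rule d_local_scaled[OF assms _ smooth2])
  show "((\<lambda>z. 1 / (fst (snd z) * (snd (snd z))\<^sup>2)) has_derivative (\<lambda>u. 1 / (fst (snd z) * (snd (snd z))\<^sup>2) *
      (- (fst (snd u) / fst (snd z)) - 2 * (snd (snd u) / snd (snd z))))) (at z)"
    using fibredD[OF assms]
    by (auto intro!: derivative_eq_intros simp: field_simps fun_eq_iff power2_eq_square)
qed

text \<open>The forms da/a and db/b are closed and contribute nothing to d. The sign
  \<open>m\<close> is -1 for \<open>\<Phi>\<close> and 1 for \<open>K\<close>.\<close>

lemma d_local_translated:
  fixes \<beta> :: "real^3 \<Rightarrow> real^3 \<Rightarrow> real"
  assumes z: "z \<in> fibred" and sm: "\<And>w. smooth_on S (\<lambda>y. \<beta> y w)"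
  shows "d_local (\<lambda>z v. \<beta> (fst z) (fst v) + (fst (snd v) / fst (snd z) + m * (snd (snd v) / snd (snd z))) / 2) z u v =
    d_local \<beta> (fst z) (fst u) (fst v)"
proof -
  have 1: "((\<lambda>z. \<beta> (fst z) w) has_derivative (\<lambda>u. frechet_derivative (\<lambda>y. \<beta> y w) (at (fst z)) (fst u))) (at z)" for w
    by (rule has_derivative_compose[OF has_derivative_fst[OF has_derivative_ident]
          smooth_on_has_derivative[OF sm fibredD(1)[OF z]]])
  have 2: "((\<lambda>z. (s / fst (snd z) + m * (t / snd (snd z))) / 2) has_derivative
      (\<lambda>u. - (s * fst (snd u) / (fst (snd z))\<^sup>2 + m * (t * snd (snd u) / (snd (snd z))\<^sup>2)) / 2)) (at z)" for s t
    using fibredD[OF z]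
    by (auto intro!: derivative_eq_intros simp: field_simps fun_eq_iff power2_eq_square)
  from has_derivative_add[OF 1 2]
  have D: "frechet_derivative (\<lambda>z. \<beta> (fst z) w + (s / fst (snd z) + m * (t / snd (snd z))) / 2) (at z) u =
     frechet_derivative (\<lambda>y. \<beta> y w) (at (fst z)) (fst u) +
     - (s * fst (snd u) / (fst (snd z))\<^sup>2 + m * (t * snd (snd u) / (snd (snd z))\<^sup>2)) / 2" for u w s t
    by (rule fun_cong[OF frechet_derivative_eqI])
  show ?thesis unfolding d_local_def D by (simp add: mult.commute)
qed

lemma d_\<Phi>: "z \<in> fibred \<Longrightarrow> d_local \<Phi> z u v = d_local \<phi> (fst z) (fst u) (fst v)"
  using d_local_translated[where \<beta> = \<phi> and m = "-1", OF _ smooth_\<phi>] by (simp add: \<Phi>_def[abs_def])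

lemma d_K: "z \<in> fibred \<Longrightarrow> d_local K z u v = d_local \<kappa> (fst z) (fst u) (fst v)"
  using d_local_translated[where \<beta> = \<kappa> and m = 1, OF _ smooth_\<kappa>] by (simp add: K_def[abs_def])

text \<open>Write s = da/a and t = db/b. The scale factors a/b, a^2 b and 1/(a b^2) have logarithmic
  derivatives s - t, 2 s + t and - s - 2 t. These are 2 f, f + 3 k and f - 3 k for the fibre parts f
  = (s - t)/2 of \<open>\<Phi>\<close> and k = (s + t)/2 of \<open>K\<close>, so the fibre terms
  match and the equations on the base remain.\<close>

lemma fibred_structure:
  assumes z: "z \<in> fibred"
  shows "d_local \<Omega>0 z u v = wedge \<Omega>1 \<Omega>2 z u v + 2 * wedge \<Phi> \<Omega>0 z u v" (is ?s0)
    "d_local \<Omega>1 z u v = wedge \<Phi> \<Omega>1 z u v + 3 * wedge K \<Omega>1 z u v + torsion1 z * wedge \<Omega>0 \<Omega>2 z u v" (is ?s1)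
    "d_local \<Omega>2 z u v = wedge \<Phi> \<Omega>2 z u v - 3 * wedge K \<Omega>2 z u v - torsion2 z * wedge \<Omega>0 \<Omega>1 z u v" (is ?s2)
    "d_local \<Phi> z u v = coef_A z * wedge \<Omega>0 \<Omega>1 z u v + coef_B z * wedge \<Omega>0 \<Omega>2 z u v" (is ?sf)
    "d_local K z u v = coef_C z * wedge \<Omega>0 \<Omega>1 z u v + coef_D z * wedge \<Omega>0 \<Omega>2 z u v +
      coef_S z * wedge \<Omega>1 \<Omega>2 z u v" (is ?sk)
proof -
  define a b where "a = fst (snd z)" and "b = snd (snd z)"
  have nz: "a \<noteq> 0" "b \<noteq> 0" using fibredD[OF z] by (simp_all add: a_def b_def)
  have y: "fst z \<in> S" by (rule fibredD[OF z])
  have w01: "wedge \<Omega>0 \<Omega>1 z u v = a ^ 3 * wedge \<beta>0 \<beta>1 (fst z) (fst u) (fst v)"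
    and w02: "wedge \<Omega>0 \<Omega>2 z u v = 1 / b ^ 3 * wedge \<beta>0 \<beta>2 (fst z) (fst u) (fst v)"
    and w12: "wedge \<Omega>1 \<Omega>2 z u v = a / b * wedge \<beta>1 \<beta>2 (fst z) (fst u) (fst v)"
    using nz by (simp_all add: wedge_def \<Omega>0_def \<Omega>1_def \<Omega>2_def a_def[symmetric] b_def[symmetric]
        field_simps power2_eq_square power3_eq_cube)
  define s t where "s u = fst (snd u) / a" and "t u = snd (snd u) / b" for u :: "fibre_coords"
  have f: "\<Phi> z u = \<phi> (fst z) (fst u) + (s u - t u) / 2"
    "K z u = \<kappa> (fst z) (fst u) + (s u + t u) / 2" for u
    by (simp_all add: \<Phi>_def K_def a_def b_def s_def t_def)
  note folds = a_def[symmetric] b_def[symmetric] s_def[symmetric] t_def[symmetric]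
  have o: "\<Omega>0 z u = a / b * \<beta>0 (fst z) (fst u)" "\<Omega>1 z u = a\<^sup>2 * b * \<beta>1 (fst z) (fst u)"
    "\<Omega>2 z u = 1 / (a * b\<^sup>2) * \<beta>2 (fst z) (fst u)" for u
    by (simp_all add: \<Omega>0_def \<Omega>1_def \<Omega>2_def a_def b_def)
  show ?s0
    unfolding d_\<Omega>0[OF z, unfolded folds] structure0[OF y] w12 wedge_def[of \<Phi>]
      wedge_def[of \<phi>] f o
    by (simp add: algebra_simps add_divide_distrib diff_divide_distrib)
  have t1: "torsion1 z * wedge \<Omega>0 \<Omega>2 z u v = a\<^sup>2 * b * (T \<beta>1 e0 e2 (fst z) * wedge \<beta>0 \<beta>2 (fst z) (fst u) (fst v))"
    using nz by (simp add: torsion1_def w02 a_def[symmetric] b_def[symmetric] field_simps eval_nat_numeral)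
  have t2: "torsion2 z * wedge \<Omega>0 \<Omega>1 z u v = - 1 / (a * b\<^sup>2) * (T \<beta>2 e0 e1 (fst z) * wedge \<beta>0 \<beta>1 (fst z) (fst u) (fst v))"
    using nz by (simp add: torsion2_def w01 a_def[symmetric] b_def[symmetric] field_simps eval_nat_numeral)
  show ?s1
    unfolding d_\<Omega>1[OF z, unfolded folds] structure1[OF y] t1 wedge_def[of \<Phi>]
      wedge_def[of \<phi>] wedge_def[of K] wedge_def[of \<kappa>] f o
    by (simp add: algebra_simps add_divide_distrib diff_divide_distrib)
  show ?s2
    unfolding d_\<Omega>2[OF z, unfolded folds] structure2[OF y] t2 wedge_def[of \<Phi>]
      wedge_def[of \<phi>] wedge_def[of K] wedge_def[of \<kappa>] f o
    by (simp add: algebra_simps add_divide_distrib diff_divide_distrib)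
  show ?sf
    using nz by (simp add: d_\<Phi>[OF z] d_\<phi>[OF y] coef_A_def coef_B_def w01 w02 a_def[symmetric] b_def[symmetric])
  show ?sk
    using nz by (simp add: d_K[OF z] d_\<kappa>[OF y] coef_C_def coef_D_def coef_S_def w01 w02 w12
        a_def[symmetric] b_def[symmetric])
qed

text \<open>The five forms are a coframe of the trivialised bundle: the dual frame fixes the base
  part of u, and then K + \<Phi> and K - \<Phi> contain da/a and db/b separately.\<close>

lemma fibred_solve:
  assumes z: "z \<in> fibred"
  shows "\<exists>!u. \<Omega>0 z u = x0 \<and> \<Omega>1 z u = x1 \<and> \<Omega>2 z u = x2 \<and> \<Phi> z u = f \<and> K z u = k"
proof -
  define a b y where "a = fst (snd z)" and "b = snd (snd z)" and "y = fst z"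
  have nz: "a \<noteq> 0" "b \<noteq> 0" and y: "y \<in> S" using fibredD[OF z] by (simp_all add: a_def b_def y_def)
  note defs = \<Omega>0_def \<Omega>1_def \<Omega>2_def \<Phi>_def K_def a_def[symmetric] b_def[symmetric] y_def[symmetric]
  define w where "w = (b / a * x0) *\<^sub>R e0 y + (x1 / (a\<^sup>2 * b)) *\<^sub>R e1 y + (a * b\<^sup>2 * x2) *\<^sub>R e2 y"
  have \<beta>w: "\<beta>0 y w = b / a * x0" "\<beta>1 y w = x1 / (a\<^sup>2 * b)" "\<beta>2 y w = a * b\<^sup>2 * x2"
    unfolding w_def by (simp_all add: linear_sum3[OF linear_coframe(1)[OF y]]
      linear_sum3[OF linear_coframe(2)[OF y]] linear_sum3[OF linear_coframe(3)[OF y]] dual_eqs[OF y])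
  show ?thesis
  proof (rule ex1I)
    show "\<Omega>0 z (w, a * (f + k - \<phi> y w - \<kappa> y w), b * (k - f - \<kappa> y w + \<phi> y w)) = x0 \<and>
      \<Omega>1 z (w, a * (f + k - \<phi> y w - \<kappa> y w), b * (k - f - \<kappa> y w + \<phi> y w)) = x1 \<and>
      \<Omega>2 z (w, a * (f + k - \<phi> y w - \<kappa> y w), b * (k - f - \<kappa> y w + \<phi> y w)) = x2 \<and>
      \<Phi> z (w, a * (f + k - \<phi> y w - \<kappa> y w), b * (k - f - \<kappa> y w + \<phi> y w)) = f \<and>
      K z (w, a * (f + k - \<phi> y w - \<kappa> y w), b * (k - f - \<kappa> y w + \<phi> y w)) = k"
      using nz by (simp add: defs \<beta>w diff_divide_distrib)
  next
    fix u :: "fibre_coords"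
    assume u: "\<Omega>0 z u = x0 \<and> \<Omega>1 z u = x1 \<and> \<Omega>2 z u = x2 \<and> \<Phi> z u = f \<and> K z u = k"
    obtain v s t where uv: "u = (v, s, t)" by (metis surj_pair)
    have e: "a / b * \<beta>0 y v = x0" "a\<^sup>2 * b * \<beta>1 y v = x1" "1 / (a * b\<^sup>2) * \<beta>2 y v = x2"
      "\<phi> y v + (s / a - t / b) / 2 = f" "\<kappa> y v + (s / a + t / b) / 2 = k"
      using u by (simp_all add: defs uv)
    have "\<beta>0 y v = b / a * x0" "\<beta>1 y v = x1 / (a\<^sup>2 * b)" "\<beta>2 y v = a * b\<^sup>2 * x2"
      using nz by (simp_all add: e(1-3)[symmetric])
    then have v: "v = w" using frame_expand[OF y, of v] by (simp add: w_def)
    have "s / a = f + k - \<phi> y w - \<kappa> y w" "t / b = k - f - \<kappa> y w + \<phi> y w"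
      unfolding e(4,5)[symmetric] v by (simp_all add: field_simps)
    then show "u = (w, a * (f + k - \<phi> y w - \<kappa> y w), b * (k - f - \<kappa> y w + \<phi> y w))"
      using nz by (simp add: uv v field_simps)
  qed
qed

text \<open>The action of diag(p, 1/(p q), q) in fibre coordinates. \<open>\<Phi>\<close> and
  \<open>K\<close> are invariant because the fibre enters them through da/a and db/b only.\<close>

lemma fibred_scale:
  assumes "p \<noteq> 0" "q \<noteq> 0"
  shows "\<Omega>0 (y, p * a, q * b) (w, p * s, q * t) = p / q * \<Omega>0 (y, a, b) (w, s, t)"
    "\<Omega>1 (y, p * a, q * b) (w, p * s, q * t) = p\<^sup>2 * q * \<Omega>1 (y, a, b) (w, s, t)"
    "\<Omega>2 (y, p * a, q * b) (w, p * s, q * t) = 1 / (p * q\<^sup>2) * \<Omega>2 (y, a, b) (w, s, t)"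
    "\<Phi> (y, p * a, q * b) (w, p * s, q * t) = \<Phi> (y, a, b) (w, s, t)"
    "K (y, p * a, q * b) (w, p * s, q * t) = K (y, a, b) (w, s, t)"
  using assms by (simp_all add: \<Omega>0_def \<Omega>1_def \<Omega>2_def \<Phi>_def K_def power_mult_distrib)

end

section \<open>Adapted coframes\<close>

lemma smooth_form1_subset: "smooth_form1 \<A> U \<alpha> \<Longrightarrow> V \<subseteq> U \<Longrightarrow> smooth_form1 \<A> V \<alpha>"
  unfolding smooth_form1_def by (meson Int_mono image_mono order_refl smooth_on_subset subsetD)

lemma smooth_field_subset: "smooth_field \<A> U X \<Longrightarrow> V \<subseteq> U \<Longrightarrow> smooth_field \<A> V X"
  unfolding smooth_field_def by (meson Int_mono image_mono order_refl smooth_on_subset)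

lemma smooth_form1_linear: "smooth_form1 \<A> U \<alpha> \<Longrightarrow> p \<in> U \<Longrightarrow> linear (\<alpha> p)"
  by (simp add: smooth_form1_def)

lemma linear_combination2:
  assumes "linear f"
  shows "f (r *\<^sub>R u + s *\<^sub>R v) = r * f u + s * (f v :: real)"
  using assms by (simp add: linear_add linear_scale)

context manifold_atlas begin

lemma linear_ext_d:
  assumes "smooth_form1 \<A> U \<alpha>" "manifold_open U" "p \<in> U" "p \<in> points \<A>"
  shows "linear (\<lambda>v. ext_d \<A> \<alpha> p v w)" "linear (\<lambda>w. ext_d \<A> \<alpha> p v w)"
proof -
  let ?c = "chart_at \<A> p" let ?S = "coords ?c ` (U \<inter> dom_of ?c)"
  have c: "?c \<in> \<A>" "p \<in> dom_of ?c" using chart_at assms by auto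
  have S: "open ?S" "coords ?c p \<in> ?S" using manifold_openD[OF assms(2) c(1)] assms c by auto
  note l = smooth_form1_local[OF assms(1) c(1)]
  show "linear (\<lambda>v. ext_d \<A> \<alpha> p v w)"
    unfolding ext_d_local by (rule linear_d_local1[OF S(1) l(2) l(1) S(2)])
  show "linear (\<lambda>w. ext_d \<A> \<alpha> p v w)"
    unfolding ext_d_local by (rule linear_d_local2[OF S(1) l(2) l(1) S(2)])
qed

lemma ext_d_skew: "ext_d \<A> \<alpha> p v w = - ext_d \<A> \<alpha> p w v"
  unfolding ext_d_local by (rule d_local_skew)

text \<open>Where the forms do not vanish, \<theta>' = f \<theta> and d\<theta>' = f d\<theta> + df
  \<and> \<theta>, whose last term is zero on the kernel. Cross-multiplying by the values on e
  avoids introducing f. This is why the condition on the first covector in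
  \<open>adapted_coframes\<close> does not depend on the extension chosen there.\<close>

lemma ext_d_proportional:
  fixes \<theta> \<theta>' :: "'a \<Rightarrow> 'e \<Rightarrow> real"
  assumes \<theta>: "smooth_form1 \<A> U \<theta>" and \<theta>': "smooth_form1 \<A> U' \<theta>'"
    and U: "openin (mtopology \<A>) U" "openin (mtopology \<A>) U'" and x: "x \<in> U" "x \<in> U'"
    and ker: "\<And>y v. y \<in> U \<Longrightarrow> y \<in> U' \<Longrightarrow> \<theta> y v = 0 \<longleftrightarrow> \<theta>' y v = 0"
    and v: "\<theta> x v = 0" and w: "\<theta> x w = 0"
  shows "ext_d \<A> \<theta>' x v w * \<theta> x e = \<theta>' x e * ext_d \<A> \<theta> x v w"
proof -
  let ?c = "chart_at \<A> x" let ?S = "coords ?c ` (U \<inter> U' \<inter> dom_of ?c)"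
  have p: "x \<in> points \<A>" using openin_points[OF U(1)] x by auto
  have c: "?c \<in> \<A>" "x \<in> dom_of ?c" using chart_at[OF p] by auto
  have S: "open ?S" using manifold_openD[OF openin_manifold_open[OF openin_Int[OF U]] c(1)] .
  have y: "coords ?c x \<in> ?S" using x c by auto
  define \<beta> \<beta>' where "\<beta> = local_form \<A> ?c \<theta>" and "\<beta>' = local_form \<A> ?c \<theta>'"
  note sub1 = smooth_form1_subset[OF \<theta> Int_lower1[of U U']]
  note sub2 = smooth_form1_subset[OF \<theta>' Int_lower2[of U U']]
  note sm = smooth_form1_local(1)[OF sub1 c(1), folded \<beta>_def]
    smooth_form1_local(1)[OF sub2 c(1), folded \<beta>'_def]
  have at_x: "\<beta> (coords ?c x) u = \<theta> x u" "\<beta>' (coords ?c x) u = \<theta>' x u" for u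
    using local_form_coords[OF c, of \<theta> u] local_form_coords[OF c, of \<theta>' u] tvec_comps[OF c, of u]
      comps_chart_at[OF p, of u] by (simp_all add: \<beta>_def \<beta>'_def)
  have pr: "\<beta>' y w * \<beta> y e = \<beta>' y e * \<beta> y w" if yS: "y \<in> ?S" for y e w
  proof -
    obtain q where q: "q \<in> U" "q \<in> U'" "q \<in> dom_of ?c" "y = coords ?c q" using yS by auto
    have lin: "linear (\<beta> y)" "linear (\<beta>' y)"
      using smooth_form1_local(2)[OF sub1 c(1) yS] smooth_form1_local(2)[OF sub2 c(1) yS]
      by (simp_all add: \<beta>_def \<beta>'_def)
    have iff: "\<beta> y u = 0 \<longleftrightarrow> \<beta>' y u = 0" for u
      using ker[OF q(1,2)] q c by (simp add: \<beta>_def \<beta>'_def local_form_coords)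
    \<comment> \<open>The combination of w and e that lies in the kernel of the one form lies in the
      kernel of the other.\<close>
    have "\<beta> y (\<beta> y e *\<^sub>R w + (- \<beta> y w) *\<^sub>R e) = 0"
      by (simp only: linear_combination2[OF lin(1)]) simp
    then have "\<beta>' y (\<beta> y e *\<^sub>R w + (- \<beta> y w) *\<^sub>R e) = 0" using iff by blast
    then show ?thesis
      by (simp only: linear_combination2[OF lin(2)]) (simp add: algebra_simps)
  qed
  have D: "frechet_derivative (\<lambda>y. \<beta>' y w) (at (coords ?c x)) v * \<theta> x e =
      \<theta>' x e * frechet_derivative (\<lambda>y. \<beta> y w) (at (coords ?c x)) v" if "\<theta> x w = 0" for v w
  proof -
    \<comment> \<open>By \<open>pr\<close> this function vanishes identically. Its derivative at x,
      where both forms kill w, gives the claim.\<close>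
    have d1: "((\<lambda>y. \<beta>' y w * \<beta> y e - \<beta>' y e * \<beta> y w) has_derivative (\<lambda>v.
        (\<beta>' (coords ?c x) w * frechet_derivative (\<lambda>y. \<beta> y e) (at (coords ?c x)) v +
         frechet_derivative (\<lambda>y. \<beta>' y w) (at (coords ?c x)) v * \<beta> (coords ?c x) e) -
        (\<beta>' (coords ?c x) e * frechet_derivative (\<lambda>y. \<beta> y w) (at (coords ?c x)) v +
         frechet_derivative (\<lambda>y. \<beta>' y e) (at (coords ?c x)) v * \<beta> (coords ?c x) w))) (at (coords ?c x))"
      by (intro has_derivative_diff has_derivative_mult smooth_on_has_derivative[OF sm(1) y]
          smooth_on_has_derivative[OF sm(2) y])
    have d2: "((\<lambda>y. \<beta>' y w * \<beta> y e - \<beta>' y e * \<beta> y w) has_derivative (\<lambda>v. 0)) (at (coords ?c x))"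
      by (rule has_derivative_transform_within_open[OF has_derivative_const[of 0] S y]) (simp add: pr)
    have "\<theta>' x w = 0" using ker[OF x] that by simp
    then show ?thesis
      using fun_cong[OF has_derivative_unique[OF d1 d2], of v] that by (simp add: at_x)
  qed
  show ?thesis
    using D[OF w, of v] D[OF v, of w] unfolding ext_d_local d_local_def \<beta>_def[symmetric] \<beta>'_def[symmetric]
    by (simp add: algebra_simps)
qed

end

section \<open>The structure group acting on coframes\<close>

lemma coframe_act_diag:
  "coframe_act (\<omega>, \<omega>1, \<omega>2) (diag3 a d b) =
    ((\<lambda>v. a / b * \<omega> v), (\<lambda>v. a\<^sup>2 * b * \<omega>1 v), (\<lambda>v. 1 / (a * b\<^sup>2) * \<omega>2 v))"
  by (simp add: coframe_act_def diag3_def mat3_def vector_3)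

text \<open>The middle entries d, e, f can be arbitrary since \<open>coframe_act\<close> reads only
  the two outer diagonal entries.\<close>

lemma coframe_act_compose:
  assumes "a \<noteq> 0" "b \<noteq> 0" "p \<noteq> 0" "q \<noteq> 0"
  shows "coframe_act (coframe_act \<sigma> (diag3 a d b)) (diag3 p e q) = coframe_act \<sigma> (diag3 (p * a) f (q * b))"
  using assms by (cases \<sigma>) (auto simp: coframe_act_diag fun_eq_iff power_mult_distrib field_simps)

text \<open>The map \<open>(a, b) \<mapsto> (a\<^sup>2 b, 1/(a b\<^sup>2))\<close> is a bijection of pairs of nonzero numbers because
  \<open>a\<^sup>3\<close> and \<open>a/b\<close> are recovered from the image.\<close>

lemma diag_parameters:
  assumes "p \<noteq> 0" "q \<noteq> (0::real)"
  defines "a \<equiv> root 3 (p\<^sup>2 * q)"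
  defines "b \<equiv> a / (p * q)"
  shows "a \<noteq> 0" "b \<noteq> 0" "a / b = p * q" "a\<^sup>2 * b = p" "1 / (a * b\<^sup>2) = q"
proof -
  have a3: "a ^ 3 = p\<^sup>2 * q" by (simp add: a_def odd_real_root_pow)
  show a: "a \<noteq> 0" using assms by (simp add: a_def)
  show "b \<noteq> 0" using a assms by (simp add: b_def)
  show "a / b = p * q" using a assms by (simp add: b_def)
  have "a\<^sup>2 * b = a ^ 3 / (p * q)" by (simp add: b_def power2_eq_square power3_eq_cube)
  then show "a\<^sup>2 * b = p" using assms(1,2) unfolding a3 by (simp add: power2_eq_square)
  have "a * b\<^sup>2 = a ^ 3 / (p * q)\<^sup>2" by (simp add: b_def power2_eq_square power3_eq_cube)
  then show "1 / (a * b\<^sup>2) = q" using assms(1,2) unfolding a3 by (simp add: power2_eq_square)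
qed

lemma diag_parameters_unique:
  assumes "a \<noteq> 0" "b \<noteq> 0" "a' \<noteq> 0" "b' \<noteq> (0::real)"
    and "a\<^sup>2 * b = a'\<^sup>2 * b'" "1 / (a * b\<^sup>2) = 1 / (a' * b'\<^sup>2)"
  shows "a = a' \<and> b = b'"
proof -
  have e: "a * b\<^sup>2 = a' * b'\<^sup>2" using assms by (simp add: field_simps)
  have "a ^ 3 * (a * b\<^sup>2) = (a\<^sup>2 * b)\<^sup>2" by (simp add: algebra_simps eval_nat_numeral)
  also have "\<dots> = a' ^ 3 * (a' * b'\<^sup>2)"
    unfolding assms(5) by (simp add: algebra_simps eval_nat_numeral)
  finally have "a ^ 3 = a' ^ 3" using assms e by simp
  then have "a = a'" by (metis odd_real_root_power_cancel odd_numeral)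
  then show ?thesis using assms by simp
qed

section \<open>Adapted coframes over a single point\<close>

locale enriched_manifold = manifold_atlas \<A> for \<A> :: "('m, real^3) atlas" +
  fixes T1 T2 L :: "'m \<Rightarrow> (real^3) set"
  assumes enriched: "enriched_path_structure \<A> T1 T2 L"
begin

abbreviation D :: "'m \<Rightarrow> (real^3) set" where "D \<equiv> bundle_sum T1 T2"

definition spanning_frame :: "'m \<Rightarrow> real^3 \<Rightarrow> real^3 \<Rightarrow> real^3 \<Rightarrow> bool" where
  "spanning_frame x X1 X2 XL \<longleftrightarrow> T1 x = span {X1} \<and> T2 x = span {X2} \<and> L x = span {XL}"

lemma local_frame:
  assumes x: "x \<in> points \<A>" and c: "c \<in> \<A>" "x \<in> dom_of c"
  obtains U X1 X2 XL where "openin (mtopology \<A>) U" "x \<in> U" "U \<subseteq> dom_of c"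
    "smooth_field \<A> U X1" "smooth_field \<A> U X2" "smooth_field \<A> U XL"
    "\<And>y. y \<in> U \<Longrightarrow> spanning_frame y (X1 y) (X2 y) (XL y)"
proof -
  have l: "line_subbundle \<A> T1" "line_subbundle \<A> T2" "line_subbundle \<A> L"
    using enriched by (auto simp: enriched_path_structure_def path_structure_def)
  obtain U1 X1 where 1: "openin (mtopology \<A>) U1" "x \<in> U1" "smooth_field \<A> U1 X1" "\<forall>y\<in>U1. T1 y = span {X1 y}"
    using l(1) x unfolding line_subbundle_def by blast
  obtain U2 X2 where 2: "openin (mtopology \<A>) U2" "x \<in> U2" "smooth_field \<A> U2 X2" "\<forall>y\<in>U2. T2 y = span {X2 y}"
    using l(2) x unfolding line_subbundle_def by blast
  obtain U3 X3 where 3: "openin (mtopology \<A>) U3" "x \<in> U3" "smooth_field \<A> U3 X3" "\<forall>y\<in>U3. L y = span {X3 y}"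
    using l(3) x unfolding line_subbundle_def by blast
  show thesis
  proof (rule that[of "U1 \<inter> U2 \<inter> U3 \<inter> dom_of c" X1 X2 X3])
    show "openin (mtopology \<A>) (U1 \<inter> U2 \<inter> U3 \<inter> dom_of c)"
      using 1 2 3 openin_dom[OF c(1)] by auto
    show "smooth_field \<A> (U1 \<inter> U2 \<inter> U3 \<inter> dom_of c) X1"
      by (rule smooth_field_subset[OF 1(3)]) auto
    show "smooth_field \<A> (U1 \<inter> U2 \<inter> U3 \<inter> dom_of c) X2"
      by (rule smooth_field_subset[OF 2(3)]) auto
    show "smooth_field \<A> (U1 \<inter> U2 \<inter> U3 \<inter> dom_of c) X3"
      by (rule smooth_field_subset[OF 3(3)]) auto
  qed (use 1 2 3 c in \<open>auto simp: spanning_frame_def\<close>)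
qed

lemma spanning_frame_exists:
  assumes "x \<in> points \<A>"
  obtains X1 X2 XL where "spanning_frame x X1 X2 XL"
proof -
  obtain c where c: "c \<in> \<A>" "x \<in> dom_of c" using chart_at[OF assms] by blast
  show thesis by (rule local_frame[OF assms c]) (rule that, blast)
qed

lemma frame_D:
  assumes "spanning_frame x X1 X2 XL"
  shows "D x = {r *\<^sub>R X1 + s *\<^sub>R X2 | r s. True}"
  using assms unfolding spanning_frame_def bundle_sum_def by (auto simp: span_singleton)

lemma frame_span:
  assumes "x \<in> points \<A>" "spanning_frame x X1 X2 XL"
  obtains r s t where "v = r *\<^sub>R XL + s *\<^sub>R X1 + t *\<^sub>R X2"
proof -
  have "v \<in> bundle_sum D L x"
    using enriched assms(1) unfolding enriched_path_structure_def by blast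
  then obtain d l where dl: "v = d + l" "d \<in> D x" "l \<in> L x" by (auto simp: bundle_sum_def)
  obtain s t where "d = s *\<^sub>R X1 + t *\<^sub>R X2" using dl(2) frame_D[OF assms(2)] by auto
  moreover obtain r where "l = r *\<^sub>R XL"
    using dl(3) assms(2) by (auto simp: spanning_frame_def span_singleton)
  ultimately have "v = r *\<^sub>R XL + s *\<^sub>R X1 + t *\<^sub>R X2" using dl(1) by simp
  then show thesis by (rule that)
qed

lemma frame_independent:
  assumes x: "x \<in> points \<A>" and X: "spanning_frame x X1 X2 XL"
    and z: "r *\<^sub>R XL + s *\<^sub>R X1 + t *\<^sub>R X2 = 0"
  shows "r = 0" "s = 0" "t = 0"
proof -
  have "dim (T1 x) = 1" "dim (T2 x) = 1" "dim (L x) = 1"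
    using enriched x by (auto simp: enriched_path_structure_def path_structure_def line_subbundle_def)
  then have nz: "X1 \<noteq> 0" "X2 \<noteq> 0" "XL \<noteq> 0"
    using X by (auto simp: spanning_frame_def)
  have i: "T1 x \<inter> T2 x = {0}" "D x \<inter> L x = {0}"
    using enriched x by (auto simp: enriched_path_structure_def path_structure_def)
  have "(- s) *\<^sub>R X1 + (- t) *\<^sub>R X2 = r *\<^sub>R XL"
    using z by (metis (no_types, lifting) add.assoc add.commute add_eq_0_iff minus_add_distrib scaleR_minus_left)
  then have "r *\<^sub>R XL \<in> D x" using frame_D[OF X] by (metis (mono_tags, lifting) mem_Collect_eq)
  moreover have "r *\<^sub>R XL \<in> L x" using X by (auto simp: spanning_frame_def span_singleton)
  ultimately have "r *\<^sub>R XL = 0" using i by blast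
  then show r: "r = 0" using nz by simp
  have e: "s *\<^sub>R X1 = (- t) *\<^sub>R X2" using z r by (simp add: eq_neg_iff_add_eq_0)
  have "s *\<^sub>R X1 \<in> T1 x" "(- t) *\<^sub>R X2 \<in> T2 x"
    using X by (simp_all only: spanning_frame_def span_scale span_base singletonI)
  then have "s *\<^sub>R X1 = 0" using i e by (metis IntI singletonD)
  then show "s = 0" "t = 0" using nz e by simp_all
qed

lemma frame_in:
  assumes "spanning_frame x X1 X2 XL"
  shows "X1 \<in> D x" "X2 \<in> D x" "X2 \<in> bundle_sum T2 L x" "XL \<in> bundle_sum T2 L x"
    "X1 \<in> bundle_sum T1 L x" "XL \<in> bundle_sum T1 L x"
proof -
  have "X1 \<in> T1 x" "X2 \<in> T2 x" "XL \<in> L x" "0 \<in> T1 x" "0 \<in> T2 x" "0 \<in> L x"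
    using assms by (auto simp: spanning_frame_def span_base span_zero)
  then show "X1 \<in> D x" "X2 \<in> D x" "X2 \<in> bundle_sum T2 L x" "XL \<in> bundle_sum T2 L x"
    "X1 \<in> bundle_sum T1 L x" "XL \<in> bundle_sum T1 L x"
    unfolding bundle_sum_def by (metis (mono_tags, lifting) add.left_neutral add.right_neutral mem_Collect_eq)+
qed

text \<open>Each covector of an adapted coframe kills two of the three lines; killing the third as
  well would make it zero, against independence.\<close>

lemma adapted_coframe_values:
  assumes x: "x \<in> points \<A>" and \<sigma>: "(\<omega>, \<omega>1, \<omega>2) \<in> adapted_coframes \<A> T1 T2 L x"
    and X: "spanning_frame x X1 X2 XL"
  shows "linear \<omega>" "linear \<omega>1" "linear \<omega>2" "\<omega> X1 = 0" "\<omega> X2 = 0" "\<omega>1 X2 = 0" "\<omega>1 XL = 0" "\<omega>2 X1 = 0" "\<omega>2 XL = 0"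
    "\<omega> XL \<noteq> 0" "\<omega>1 X1 \<noteq> 0" "\<omega>2 X2 \<noteq> 0"
proof -
  have c: "is_coframe (\<omega>, \<omega>1, \<omega>2)" and k: "{v. \<omega> v = 0} = D x"
    and 1: "\<forall>v \<in> bundle_sum T2 L x. \<omega>1 v = 0" and 2: "\<forall>v \<in> bundle_sum T1 L x. \<omega>2 v = 0"
    using \<sigma> by (auto simp: adapted_coframes_def)
  show lin: "linear \<omega>" "linear \<omega>1" "linear \<omega>2" using c by (auto simp: is_coframe_def)
  show v: "\<omega> X1 = 0" "\<omega> X2 = 0" "\<omega>1 X2 = 0" "\<omega>1 XL = 0" "\<omega>2 X1 = 0" "\<omega>2 XL = 0"
    using k 1 2 frame_in[OF X] by auto
  have ind: "\<forall>v. r * \<omega> v + s * \<omega>1 v + t * \<omega>2 v = 0 \<Longrightarrow> r = 0 \<and> s = 0 \<and> t = 0" for r s t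
    using c unfolding is_coframe_def prod.case by blast
  have e: "\<omega> u = 0 \<or> \<omega> XL \<noteq> 0" "\<omega>1 u = 0 \<or> \<omega>1 X1 \<noteq> 0" "\<omega>2 u = 0 \<or> \<omega>2 X2 \<noteq> 0" for u
  proof -
    obtain r s t where "u = r *\<^sub>R XL + s *\<^sub>R X1 + t *\<^sub>R X2" by (rule frame_span[OF x X])
    then show "\<omega> u = 0 \<or> \<omega> XL \<noteq> 0" "\<omega>1 u = 0 \<or> \<omega>1 X1 \<noteq> 0" "\<omega>2 u = 0 \<or> \<omega>2 X2 \<noteq> 0"
      using lin v by (auto simp: linear_sum3)
  qed
  show "\<omega> XL \<noteq> 0" using ind[of 1 0 0] e by auto
  show "\<omega>1 X1 \<noteq> 0" using ind[of 0 1 0] e by auto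
  show "\<omega>2 X2 \<noteq> 0" using ind[of 0 0 1] e by auto
qed

text \<open>By \<open>adapted_coframe_values\<close> the covectors are proportional one by one. The
  normalisation of the exterior derivative, compared on X1 and X2, forces the factor of the first
  covector to be the product of the other two, so that two free parameters remain.\<close>

lemma adapted_coframe_ratio:
  assumes x: "x \<in> points \<A>" and \<sigma>: "(\<omega>, \<omega>1, \<omega>2) \<in> adapted_coframes \<A> T1 T2 L x"
    and \<sigma>': "(\<omega>', \<omega>1', \<omega>2') \<in> adapted_coframes \<A> T1 T2 L x"
  obtains p q where "p \<noteq> 0" "q \<noteq> 0" "\<omega>' = (\<lambda>v. p * q * \<omega> v)" "\<omega>1' = (\<lambda>v. p * \<omega>1 v)" "\<omega>2' = (\<lambda>v. q * \<omega>2 v)"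
proof -
  obtain X1 X2 XL where X: "spanning_frame x X1 X2 XL" by (rule spanning_frame_exists[OF x])
  note v = adapted_coframe_values[OF x \<sigma> X] and v' = adapted_coframe_values[OF x \<sigma>' X]
  define p q l where "p = \<omega>1' X1 / \<omega>1 X1" and "q = \<omega>2' X2 / \<omega>2 X2" and "l = \<omega>' XL / \<omega> XL"
  have nz: "p \<noteq> 0" "q \<noteq> 0" using v v' by (auto simp: p_def q_def)
  have eq: "\<omega>' u = l * \<omega> u" "\<omega>1' u = p * \<omega>1 u" "\<omega>2' u = q * \<omega>2 u" for u
  proof -
    obtain r s t where "u = r *\<^sub>R XL + s *\<^sub>R X1 + t *\<^sub>R X2" by (rule frame_span[OF x X])
    then show "\<omega>' u = l * \<omega> u" "\<omega>1' u = p * \<omega>1 u" "\<omega>2' u = q * \<omega>2 u"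
      using v v' by (simp_all add: linear_sum3 p_def q_def l_def)
  qed
  obtain U \<theta> where U: "openin (mtopology \<A>) U" "x \<in> U" "smooth_form1 \<A> U \<theta>" "\<theta> x = \<omega>"
      "\<forall>y\<in>U. {v. \<theta> y v = 0} = D y"
      "\<forall>v \<in> D x. \<forall>w \<in> D x. ext_d \<A> \<theta> x v w = \<omega>1 v * \<omega>2 w - \<omega>1 w * \<omega>2 v"
    using \<sigma> unfolding adapted_coframes_def by blast
  obtain U' \<theta>' where U': "openin (mtopology \<A>) U'" "x \<in> U'" "smooth_form1 \<A> U' \<theta>'" "\<theta>' x = \<omega>'"
      "\<forall>y\<in>U'. {v. \<theta>' y v = 0} = D y"
      "\<forall>v \<in> D x. \<forall>w \<in> D x. ext_d \<A> \<theta>' x v w = \<omega>1' v * \<omega>2' w - \<omega>1' w * \<omega>2' v"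
    using \<sigma>' unfolding adapted_coframes_def by blast
  have "ext_d \<A> \<theta>' x X1 X2 * \<theta> x XL = \<theta>' x XL * ext_d \<A> \<theta> x X1 X2"
    using ext_d_proportional[OF U(3) U'(3) U(1) U'(1) U(2) U'(2), where v = X1 and w = X2 and e = XL] U(4,5) U'(4,5) v by auto
  then have "(\<omega>1' X1 * \<omega>2' X2) * \<omega> XL = \<omega>' XL * (\<omega>1 X1 * \<omega>2 X2)"
    using U(4,6) U'(4,6) frame_in[OF X] v v' by simp
  then have "l = p * q" using v by (simp add: l_def p_def q_def field_simps)
  then show thesis using that[OF nz] eq by auto
qed

text \<open>The factor of the first covector and the product of the factors of the other two are
  both a/b, so the normalisation survives.\<close>

lemma adapted_coframe_act:
  assumes x: "x \<in> points \<A>" and \<sigma>: "\<sigma> \<in> adapted_coframes \<A> T1 T2 L x" and nz: "a \<noteq> 0" "b \<noteq> 0"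
  shows "coframe_act \<sigma> (diag3 a d b) \<in> adapted_coframes \<A> T1 T2 L x"
proof -
  obtain \<omega> \<omega>1 \<omega>2 where s: "\<sigma> = (\<omega>, \<omega>1, \<omega>2)" by (cases \<sigma>)
  have c: "is_coframe (\<omega>, \<omega>1, \<omega>2)" and k: "{v. \<omega> v = 0} = D x"
    and 1: "\<forall>v \<in> bundle_sum T2 L x. \<omega>1 v = 0" and 2: "\<forall>v \<in> bundle_sum T1 L x. \<omega>2 v = 0"
    using \<sigma> by (auto simp: adapted_coframes_def s)
  obtain U \<theta> where U: "openin (mtopology \<A>) U" "x \<in> U" "smooth_form1 \<A> U \<theta>" "\<theta> x = \<omega>"
      "\<forall>y\<in>U. {v. \<theta> y v = 0} = D y"
      "\<forall>v \<in> D x. \<forall>w \<in> D x. ext_d \<A> \<theta> x v w = \<omega>1 v * \<omega>2 w - \<omega>1 w * \<omega>2 v"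
    using \<sigma> unfolding adapted_coframes_def s by blast
  have h: "bounded_linear ((*) (a / b))" by (rule bounded_linear_mult_right)
  have "smooth_form1 \<A> U (\<lambda>y v. a / b * \<theta> y v)"
    unfolding smooth_form1_def
  proof (intro conjI ballI allI)
    show "linear (\<lambda>v. a / b * \<theta> p v)" if "p \<in> U" for p
      using smooth_form1_linear[OF U(3) that] by (intro linearI) (simp_all add: linear_add linear_scale algebra_simps)
    fix d w assume d: "d \<in> \<A>"
    show "smooth_on (coords d ` (U \<inter> dom_of d)) (\<lambda>y. local_form \<A> d (\<lambda>y v. a / b * \<theta> y v) y w)"
      using smooth_on_bounded_linear[OF h manifold_openD[OF openin_manifold_open[OF U(1)] d]
        smooth_form1_local(1)[OF U(3) d, of w]] by (simp add: local_form_def)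
  qed
  moreover have "ext_d \<A> (\<lambda>y v. a / b * \<theta> y v) x v w = a / b * ext_d \<A> \<theta> x v w" for v w
    by (rule ext_d_bounded_linear[OF U(3,2) x h])
  moreover have "(a\<^sup>2 * b * \<omega>1 v) * (1 / (a * b\<^sup>2) * \<omega>2 w) - (a\<^sup>2 * b * \<omega>1 w) * (1 / (a * b\<^sup>2) * \<omega>2 v) =
      a / b * (\<omega>1 v * \<omega>2 w - \<omega>1 w * \<omega>2 v)" for v w
    using nz by (simp add: field_simps power2_eq_square)
  ultimately have "\<exists>U \<theta>'. openin (mtopology \<A>) U \<and> x \<in> U \<and> smooth_form1 \<A> U \<theta>' \<and> \<theta>' x = (\<lambda>v. a / b * \<omega> v) \<and>
        (\<forall>y\<in>U. {v. \<theta>' y v = 0} = D y) \<and>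
        (\<forall>v \<in> D x. \<forall>w \<in> D x. ext_d \<A> \<theta>' x v w = (a\<^sup>2 * b * \<omega>1 v) * (1 / (a * b\<^sup>2) * \<omega>2 w) -
           (a\<^sup>2 * b * \<omega>1 w) * (1 / (a * b\<^sup>2) * \<omega>2 v))"
    using U nz by (intro exI[of _ U] exI[of _ "\<lambda>y v. a / b * \<theta> y v"]) simp
  moreover have "is_coframe ((\<lambda>v. a / b * \<omega> v), (\<lambda>v. a\<^sup>2 * b * \<omega>1 v), (\<lambda>v. 1 / (a * b\<^sup>2) * \<omega>2 v))"
    unfolding is_coframe_def prod.case
  proof (intro conjI allI impI)
    have lin: "linear \<omega>" "linear \<omega>1" "linear \<omega>2" using c by (auto simp: is_coframe_def)
    then show "linear (\<lambda>v. a / b * \<omega> v)" "linear (\<lambda>v. a\<^sup>2 * b * \<omega>1 v)" "linear (\<lambda>v. 1 / (a * b\<^sup>2) * \<omega>2 v)"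
      by (auto intro!: linearI simp: linear_add linear_scale algebra_simps add_divide_distrib)
    fix r s t
    assume *: "\<forall>v. r * (a / b * \<omega> v) + s * (a\<^sup>2 * b * \<omega>1 v) + t * (1 / (a * b\<^sup>2) * \<omega>2 v) = 0"
    have "\<forall>v. (r * (a / b)) * \<omega> v + (s * (a\<^sup>2 * b)) * \<omega>1 v + (t * (1 / (a * b\<^sup>2))) * \<omega>2 v = 0"
      using * by (simp only: mult.assoc simp_thms)
    then have "r * (a / b) = 0 \<and> s * (a\<^sup>2 * b) = 0 \<and> t * (1 / (a * b\<^sup>2)) = 0"
      using c unfolding is_coframe_def prod.case by blast
    then show "r = 0" "s = 0" "t = 0" using nz by auto
  qed
  ultimately show ?thesis
    using k 1 2 nz unfolding s coframe_act_diag adapted_coframes_def by simp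
qed

text \<open>Together with \<open>fibre_free\<close> this says that the group acts simply
  transitively on each fibre.\<close>

lemma fibre_transitive:
  assumes x: "x \<in> points \<A>" and \<sigma>: "\<sigma> \<in> adapted_coframes \<A> T1 T2 L x"
    and \<sigma>': "\<sigma>' \<in> adapted_coframes \<A> T1 T2 L x"
  shows "\<exists>a b. a \<noteq> 0 \<and> b \<noteq> 0 \<and> \<sigma>' = coframe_act \<sigma> (diag3 a (1 / (a * b)) b)"
proof -
  obtain \<omega> \<omega>1 \<omega>2 where s: "\<sigma> = (\<omega>, \<omega>1, \<omega>2)" by (cases \<sigma>)
  obtain \<omega>' \<omega>1' \<omega>2' where s': "\<sigma>' = (\<omega>', \<omega>1', \<omega>2')" by (cases \<sigma>')
  obtain p q where pq: "p \<noteq> 0" "q \<noteq> 0" "\<omega>' = (\<lambda>v. p * q * \<omega> v)" "\<omega>1' = (\<lambda>v. p * \<omega>1 v)" "\<omega>2' = (\<lambda>v. q * \<omega>2 v)"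
    using adapted_coframe_ratio[OF x \<sigma>[unfolded s] \<sigma>'[unfolded s']] .
  show ?thesis
    using diag_parameters[OF pq(1,2)] unfolding s s' coframe_act_diag pq(3-5) by metis
qed

lemma fibre_free:
  assumes x: "x \<in> points \<A>" and \<sigma>: "\<sigma> \<in> adapted_coframes \<A> T1 T2 L x"
    and nz: "a \<noteq> 0" "b \<noteq> 0" "a' \<noteq> 0" "b' \<noteq> 0"
    and eq: "coframe_act \<sigma> (diag3 a d b) = coframe_act \<sigma> (diag3 a' d' b')"
  shows "a = a' \<and> b = b'"
proof -
  obtain \<omega> \<omega>1 \<omega>2 where s: "\<sigma> = (\<omega>, \<omega>1, \<omega>2)" by (cases \<sigma>)
  obtain X1 X2 XL where X: "spanning_frame x X1 X2 XL" by (rule spanning_frame_exists[OF x])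
  note v = adapted_coframe_values[OF x \<sigma>[unfolded s] X]
  have "(\<lambda>v. a\<^sup>2 * b * \<omega>1 v) = (\<lambda>v. a'\<^sup>2 * b' * \<omega>1 v)" "(\<lambda>v. 1 / (a * b\<^sup>2) * \<omega>2 v) = (\<lambda>v. 1 / (a' * b'\<^sup>2) * \<omega>2 v)"
    using eq unfolding s coframe_act_diag by auto
  then have "a\<^sup>2 * b * \<omega>1 X1 = a'\<^sup>2 * b' * \<omega>1 X1" "1 / (a * b\<^sup>2) * \<omega>2 X2 = 1 / (a' * b'\<^sup>2) * \<omega>2 X2"
    by metis+
  then show ?thesis
    using v by (intro diag_parameters_unique nz) simp_all
qed

end

section \<open>The smooth structure of the adapted coframe bundle\<close>

context enriched_manifold
begin

text \<open>\<theta> sees only the XL components. If d\<theta>(X1, X2) were 0, only the products of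
  an XL component with another one would be left in d\<theta>, and the cyclic sum would be a
  combination of 3 by 3 determinants with two equal rows.\<close>

lemma contact_nonzero:
  assumes x: "x \<in> points \<A>" and U: "openin (mtopology \<A>) U" "x \<in> U" and \<theta>: "smooth_form1 \<A> U \<theta>"
    and ker: "D x = {v. \<theta> x v = 0}" and nz: "wedge12 \<theta> (ext_d \<A> \<theta>) x u v w \<noteq> 0"
    and X: "spanning_frame x X1 X2 XL"
  shows "ext_d \<A> \<theta> x X1 X2 \<noteq> 0"
proof
  assume 0: "ext_d \<A> \<theta> x X1 X2 = 0"
  note lin = linear_ext_d[OF \<theta> openin_manifold_open[OF U(1)] U(2) x]
  have \<theta>X: "\<theta> x X1 = 0" "\<theta> x X2 = 0" using frame_in[OF X] ker by auto
  obtain u0 u1 u2 where u: "u = u0 *\<^sub>R XL + u1 *\<^sub>R X1 + u2 *\<^sub>R X2" by (rule frame_span[OF x X])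
  obtain v0 v1 v2 where v: "v = v0 *\<^sub>R XL + v1 *\<^sub>R X1 + v2 *\<^sub>R X2" by (rule frame_span[OF x X])
  obtain w0 w1 w2 where w: "w = w0 *\<^sub>R XL + w1 *\<^sub>R X1 + w2 *\<^sub>R X2" by (rule frame_span[OF x X])
  note e = two_form_expand[OF lin ext_d_skew]
  have l: "\<theta> x u = u0 * \<theta> x XL" "\<theta> x v = v0 * \<theta> x XL" "\<theta> x w = w0 * \<theta> x XL"
    unfolding u v w using linear_sum3[OF smooth_form1_linear[OF \<theta> U(2)]] \<theta>X by simp_all
  show False
    using nz unfolding wedge12_def l e[OF u v] e[OF v w] e[OF w u] 0 by (simp add: algebra_simps)
qed

text \<open>D is spanned by X1 and X2, so a skew form on it is fixed by its value on this
  pair.\<close>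

lemma adapted_coframeI:
  assumes x: "x \<in> points \<A>" and U: "openin (mtopology \<A>) U" "x \<in> U" and \<theta>: "smooth_form1 \<A> U \<theta>"
    and ker: "\<And>y. y \<in> U \<Longrightarrow> D y = {v. \<theta> y v = 0}"
    and X: "spanning_frame x X1 X2 XL"
    and lin: "linear \<omega>1" "linear \<omega>2"
    and 1: "\<omega>1 X1 \<noteq> 0" "\<omega>1 X2 = 0" "\<omega>1 XL = 0" and 2: "\<omega>2 X1 = 0" "\<omega>2 X2 \<noteq> 0" "\<omega>2 XL = 0"
    and d: "ext_d \<A> \<theta> x X1 X2 = \<omega>1 X1 * \<omega>2 X2"
  shows "(\<theta> x, \<omega>1, \<omega>2) \<in> adapted_coframes \<A> T1 T2 L x"
proof -
  note lin\<theta> = smooth_form1_linear[OF \<theta> U(2)]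
  have \<theta>X: "\<theta> x X1 = 0" "\<theta> x X2 = 0" using frame_in[OF X] ker[OF U(2)] by auto
  have "\<theta> x XL \<noteq> 0"
  proof
    assume "\<theta> x XL = 0"
    then have "XL \<in> D x" using ker[OF U(2)] by simp
    then obtain r s where "XL = r *\<^sub>R X1 + s *\<^sub>R X2" using frame_D[OF X] by auto
    then have "(- 1) *\<^sub>R XL + r *\<^sub>R X1 + s *\<^sub>R X2 = 0" by simp
    from frame_independent(1)[OF x X this] show False by simp
  qed
  have co: "is_coframe (\<theta> x, \<omega>1, \<omega>2)"
    unfolding is_coframe_def prod.case
  proof (intro conjI allI impI lin lin\<theta>)
    fix r s t assume *: "\<forall>v. r * \<theta> x v + s * \<omega>1 v + t * \<omega>2 v = 0"
    show "r = 0" using spec[OF *, of XL] 1 2 \<open>\<theta> x XL \<noteq> 0\<close> by simp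
    show "s = 0" using spec[OF *, of X1] 1 2 \<theta>X by simp
    show "t = 0" using spec[OF *, of X2] 1 2 \<theta>X by simp
  qed
  have v1: "\<omega>1 v = 0" if vin: "v \<in> bundle_sum T2 L x" for v
  proof -
    obtain r s where "v = r *\<^sub>R X2 + s *\<^sub>R XL"
      using vin X unfolding bundle_sum_def spanning_frame_def by (auto simp: span_singleton)
    then show ?thesis using 1 by (simp add: linear_combination2[OF lin(1)])
  qed
  have v2: "\<omega>2 v = 0" if vin: "v \<in> bundle_sum T1 L x" for v
  proof -
    obtain r s where "v = r *\<^sub>R X1 + s *\<^sub>R XL"
      using vin X unfolding bundle_sum_def spanning_frame_def by (auto simp: span_singleton)
    then show ?thesis using 2 by (simp add: linear_combination2[OF lin(2)])
  qed
  have dD: "ext_d \<A> \<theta> x v w = \<omega>1 v * \<omega>2 w - \<omega>1 w * \<omega>2 v" if vin: "v \<in> D x" and win: "w \<in> D x" for v w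
  proof -
    obtain v1 v2 where v: "v = v1 *\<^sub>R X1 + v2 *\<^sub>R X2" using vin frame_D[OF X] by auto
    obtain w1 w2 where w: "w = w1 *\<^sub>R X1 + w2 *\<^sub>R X2" using win frame_D[OF X] by auto
    have "v = 0 *\<^sub>R XL + v1 *\<^sub>R X1 + v2 *\<^sub>R X2" "w = 0 *\<^sub>R XL + w1 *\<^sub>R X1 + w2 *\<^sub>R X2"
      using v w by simp_all
    from two_form_expand[OF linear_ext_d[OF \<theta> openin_manifold_open[OF U(1)] U(2) x] ext_d_skew this]
    have "ext_d \<A> \<theta> x v w = ext_d \<A> \<theta> x X1 X2 * (v1 * w2 - w1 * v2)" by simp
    moreover have "\<omega>1 v = v1 * \<omega>1 X1" "\<omega>1 w = w1 * \<omega>1 X1" "\<omega>2 v = v2 * \<omega>2 X2" "\<omega>2 w = w2 * \<omega>2 X2"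
      unfolding v w using 1 2 by (simp_all add: linear_combination2[OF lin(1)] linear_combination2[OF lin(2)])
    ultimately show ?thesis unfolding d by (simp add: algebra_simps)
  qed
  show ?thesis
    unfolding adapted_coframes_def mem_Collect_eq prod.case
    using co v1 v2 dD U \<theta> ker by (intro conjI exI[of _ U] exI[of _ \<theta>]) auto
qed

text \<open>Take the contact form and the covectors dual to X1 and X2 in a local frame, and multiply
  the first of these by d\<theta>(X1, X2), nonzero by \<open>contact_nonzero\<close>, to reach the
  normalisation.\<close>

lemma local_section:
  assumes x: "x \<in> points \<A>"
  obtains c U \<sigma> where "c \<in> \<A>" "openin (mtopology \<A>) U" "x \<in> U" "U \<subseteq> dom_of c"
    "smooth_adapted_section \<A> T1 T2 L U \<sigma>"
proof -
  have "contact_distribution \<A> D"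
    using enriched by (simp add: enriched_path_structure_def path_structure_def)
  from bspec[OF this[unfolded contact_distribution_def] x] obtain U0 \<theta> where 0: "openin (mtopology \<A>) U0" "x \<in> U0" "smooth_form1 \<A> U0 \<theta>"
      "\<forall>y\<in>U0. D y = {v. \<theta> y v = 0}" "\<forall>y\<in>U0. \<exists>u v w. wedge12 \<theta> (ext_d \<A> \<theta>) y u v w \<noteq> 0"
    by (elim exE conjE) (rule that)
  obtain c where c: "c \<in> \<A>" "x \<in> dom_of c" using chart_at[OF x] by blast
  obtain U1 X1 X2 XL where 1: "openin (mtopology \<A>) U1" "x \<in> U1" "U1 \<subseteq> dom_of c"
    "smooth_field \<A> U1 X1" "smooth_field \<A> U1 X2" "smooth_field \<A> U1 XL"
    "\<And>y. y \<in> U1 \<Longrightarrow> spanning_frame y (X1 y) (X2 y) (XL y)"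
    by (rule local_frame[OF x c]) (rule that)
  define U where "U = U0 \<inter> U1"
  have U: "openin (mtopology \<A>) U" "x \<in> U" "U \<subseteq> dom_of c" "U \<subseteq> points \<A>"
    using 0 1 openin_points[of U0] by (auto simp: U_def)
  have Uc: "U \<inter> dom_of c = U" using U(3) by auto
  note mU = openin_manifold_open[OF U(1)]
  define S where "S = coords c ` U"
  have S: "open S" using manifold_openD[OF mU c(1)] by (simp add: S_def Uc)
  have \<theta>: "smooth_form1 \<A> U \<theta>" by (rule smooth_form1_subset[OF 0(3)]) (simp add: U_def)
  have X: "spanning_frame y (X1 y) (X2 y) (XL y)" if "y \<in> U" for y using 1(7) that by (simp add: U_def)
  define x1 x2 xL where "x1 p = comps \<A> c p (X1 p)" and "x2 p = comps \<A> c p (X2 p)"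
    and "xL p = comps \<A> c p (XL p)" for p
  have UU: "U \<subseteq> U1" by (simp add: U_def)
  have sx: "smooth_on S (\<lambda>y. x1 (param c y))" "smooth_on S (\<lambda>y. x2 (param c y))" "smooth_on S (\<lambda>y. xL (param c y))"
    unfolding x1_def x2_def xL_def S_def
    using bspec[OF smooth_field_subset[OF 1(4) UU, unfolded smooth_field_def] c(1)]
      bspec[OF smooth_field_subset[OF 1(5) UU, unfolded smooth_field_def] c(1)]
      bspec[OF smooth_field_subset[OF 1(6) UU, unfolded smooth_field_def] c(1)]
    by (simp_all only: Uc)
  have cU: "p \<in> dom_of c" if "p \<in> U" for p using U(3) that by auto
  have pS: "param c y \<in> U" "coords c (param c y) = y" if "y \<in> S" for y
    using that c(1) cU by (auto simp: S_def)
  have nz: "x1 p \<bullet> cross3 (x2 p) (xL p) \<noteq> 0" "x2 p \<bullet> cross3 (xL p) (x1 p) \<noteq> 0" if p: "p \<in> U" for p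
  proof -
    show "x1 p \<bullet> cross3 (x2 p) (xL p) \<noteq> 0"
    proof (rule triple_product_nonzero)
      fix r s t assume "r *\<^sub>R x1 p + s *\<^sub>R x2 p + t *\<^sub>R xL p = 0"
      then have "comps \<A> c p (t *\<^sub>R XL p + r *\<^sub>R X1 p + s *\<^sub>R X2 p) = 0"
        using linear_comps[OF c(1) cU[OF p]] by (simp add: linear_add linear_scale x1_def x2_def xL_def algebra_simps)
      then have "t *\<^sub>R XL p + r *\<^sub>R X1 p + s *\<^sub>R X2 p = 0"
        using tvec_comps[OF c(1) cU[OF p]] linear_0[OF linear_tvec[OF c(1) cU[OF p]]] by metis
      from frame_independent[OF _ X[OF p] this] U(4) p show "r = 0 \<and> s = 0 \<and> t = 0" by auto
    qed
    then show "x2 p \<bullet> cross3 (xL p) (x1 p) \<noteq> 0"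
      by (simp add: triple_cyclic(1)[of "x2 p" "xL p" "x1 p"])
  qed
  \<comment> \<open>Cramer's rule in the components of the chart c: the covectors dual to X1 and X2
    in the frame X1, X2, XL.\<close>
  define \<eta>1 \<eta>2 where "\<eta>1 p v = comps \<A> c p v \<bullet> cross3 (x2 p) (xL p) / (x1 p \<bullet> cross3 (x2 p) (xL p))"
    and "\<eta>2 p v = comps \<A> c p v \<bullet> cross3 (xL p) (x1 p) / (x2 p \<bullet> cross3 (xL p) (x1 p))" for p v
  define k where "k p = ext_d \<A> \<theta> p (X1 p) (X2 p)" for p
  have \<eta>X: "\<eta>1 p (X1 p) = 1" "\<eta>1 p (X2 p) = 0" "\<eta>1 p (XL p) = 0"
    "\<eta>2 p (X1 p) = 0" "\<eta>2 p (X2 p) = 1" "\<eta>2 p (XL p) = 0" if "p \<in> U" for p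
    using nz[OF that] by (simp_all add: \<eta>1_def \<eta>2_def x1_def[symmetric] x2_def[symmetric] xL_def[symmetric] dot_cross_self)
  have k: "k p \<noteq> 0" if "p \<in> U" for p
  proof -
    have "\<exists>u v w. wedge12 \<theta> (ext_d \<A> \<theta>) p u v w \<noteq> 0" using 0(5) that by (simp add: U_def)
    then obtain u v w where "wedge12 \<theta> (ext_d \<A> \<theta>) p u v w \<noteq> 0" by blast
    from contact_nonzero[OF _ U(1) that \<theta> _ this X[OF that]] show ?thesis
      using 0(4) that U(4) by (auto simp: k_def U_def)
  qed
  have lin: "linear (\<lambda>v. k p * \<eta>1 p v)" "linear (\<eta>2 p)" if "p \<in> U" for p
    using linear_comps[OF c(1) cU[OF that]]
    by (auto intro!: linearI simp: \<eta>1_def \<eta>2_def linear_add linear_scale inner_add_left algebra_simps add_divide_distrib)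
  note sl = smooth_form1_local[OF \<theta> c(1), unfolded Uc, folded S_def]
  \<comment> \<open>\<open>k\<close> is defined by \<open>ext_d\<close>, which uses a different
    chart at each point; \<open>ext_d_chart\<close> rewrites it in the fixed chart c, where its
    smoothness is visible.\<close>
  have "smooth_on S (\<lambda>y. d_local (local_form \<A> c \<theta>) y (x1 (param c y)) (x2 (param c y)))"
    by (rule smooth_d_local[OF S sl(2) sl(1) sx(1,2)])
  then have sk: "smooth_on S (\<lambda>y. k (param c y))"
  proof (rule smooth_on_cong[OF S])
    fix y assume y: "y \<in> S"
    show "d_local (local_form \<A> c \<theta>) y (x1 (param c y)) (x2 (param c y)) = k (param c y)"
      using ext_d_chart[OF \<theta> mU c(1) pS(1)[OF y] cU[OF pS(1)[OF y]]] pS(2)[OF y]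
      by (simp add: k_def x1_def x2_def)
  qed
  have s1: "smooth_form1 \<A> U (\<lambda>p v. k p * \<eta>1 p v)"
  proof (rule smooth_form1I[OF c(1) mU U(3) lin(1)])
    fix w
    have "smooth_on S (\<lambda>y. k (param c y) * (w \<bullet> cross3 (x2 (param c y)) (xL (param c y)) /
        (x1 (param c y) \<bullet> cross3 (x2 (param c y)) (xL (param c y)))))"
      by (intro smooth_intros S sk sx nz pS)
    then show "smooth_on (coords c ` U) (\<lambda>y. local_form \<A> c (\<lambda>p v. k p * \<eta>1 p v) y w)"
      unfolding S_def[symmetric]
      by (rule smooth_on_cong[OF S]) (simp add: local_form_def \<eta>1_def comps_tvec[OF c(1) cU[OF pS(1)]])
  qed
  have s2: "smooth_form1 \<A> U \<eta>2"
  proof (rule smooth_form1I[OF c(1) mU U(3) lin(2)])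
    fix w
    have "smooth_on S (\<lambda>y. w \<bullet> cross3 (xL (param c y)) (x1 (param c y)) /
        (x2 (param c y) \<bullet> cross3 (xL (param c y)) (x1 (param c y))))"
      by (intro smooth_intros S sx nz pS)
    then show "smooth_on (coords c ` U) (\<lambda>y. local_form \<A> c \<eta>2 y w)"
      unfolding S_def[symmetric]
      by (rule smooth_on_cong[OF S]) (simp add: local_form_def \<eta>2_def comps_tvec[OF c(1) cU[OF pS(1)]])
  qed
  have "(\<theta> p, \<lambda>v. k p * \<eta>1 p v, \<eta>2 p) \<in> adapted_coframes \<A> T1 T2 L p" if p: "p \<in> U" for p
  proof (rule adapted_coframeI[OF _ U(1) p \<theta> _ X[OF p] lin(1,2)[OF p]])
    show "D y = {v. \<theta> y v = 0}" if "y \<in> U" for y using 0(4) that by (simp add: U_def)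
  qed (use k[OF p] \<eta>X[OF p] U(4) p in \<open>auto simp: k_def\<close>)
  then have "smooth_adapted_section \<A> T1 T2 L U (\<lambda>p. (\<theta> p, \<lambda>v. k p * \<eta>1 p v, \<eta>2 p))"
    using \<theta> s1 s2 by (simp add: smooth_adapted_section_def)
  then show thesis using that[OF c(1) U(1-3)] by blast
qed

lemma smooth_adapted_section_subset:
  "smooth_adapted_section \<A> T1 T2 L U \<sigma> \<Longrightarrow> V \<subseteq> U \<Longrightarrow> smooth_adapted_section \<A> T1 T2 L V \<sigma>"
  unfolding smooth_adapted_section_def by (meson smooth_form1_subset subsetD)

text \<open>At each point \<open>adapted_coframes\<close> only provides some extension \<theta>
  unrelated to the section; \<open>ext_d_proportional\<close> replaces it by the first form of the
  section itself.\<close>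

lemma section_coframe_field:
  assumes c: "c \<in> \<A>" and U: "openin (mtopology \<A>) U" "U \<subseteq> dom_of c"
    and \<sigma>: "smooth_adapted_section \<A> T1 T2 L U \<sigma>"
  shows "adapted_coframe_field (coords c ` U) (local_form \<A> c (\<lambda>x. fst (\<sigma> x)))
    (local_form \<A> c (\<lambda>x. fst (snd (\<sigma> x)))) (local_form \<A> c (\<lambda>x. snd (snd (\<sigma> x))))"
proof -
  have Uc: "U \<inter> dom_of c = U" using U by auto
  note mU = openin_manifold_open[OF U(1)]
  have s: "smooth_form1 \<A> U (\<lambda>x. fst (\<sigma> x))" "smooth_form1 \<A> U (\<lambda>x. fst (snd (\<sigma> x)))"
    "smooth_form1 \<A> U (\<lambda>x. snd (snd (\<sigma> x)))"
    and a: "\<And>x. x \<in> U \<Longrightarrow> (fst (\<sigma> x), fst (snd (\<sigma> x)), snd (snd (\<sigma> x))) \<in> adapted_coframes \<A> T1 T2 L x"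
    using \<sigma> by (auto simp: smooth_adapted_section_def)
  note sm = smooth_form1_local(1)[OF s(1) c, unfolded Uc] smooth_form1_local(1)[OF s(2) c, unfolded Uc]
    smooth_form1_local(1)[OF s(3) c, unfolded Uc]
  note lin = smooth_form1_local(2)[OF s(1) c, unfolded Uc] smooth_form1_local(2)[OF s(2) c, unfolded Uc]
    smooth_form1_local(2)[OF s(3) c, unfolded Uc]
  show ?thesis
  proof (unfold_locales)
    show "open (coords c ` U)" using manifold_openD[OF mU c] by (simp add: Uc)
    fix y assume y: "y \<in> coords c ` U"
    then obtain x where x: "x \<in> U" "x \<in> dom_of c" "y = coords c x" using U by auto
    have xp: "x \<in> points \<A>" using dom_points[OF c x(2)] .
    have at_x: "local_form \<A> c \<alpha> y w = \<alpha> x (tvec \<A> c x w)" for \<alpha> :: "'m \<Rightarrow> real^3 \<Rightarrow> real" and w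
      unfolding x(3) by (rule local_form_coords[OF c x(2)])
    show "is_coframe (local_form \<A> c (\<lambda>x. fst (\<sigma> x)) y, local_form \<A> c (\<lambda>x. fst (snd (\<sigma> x))) y,
        local_form \<A> c (\<lambda>x. snd (snd (\<sigma> x))) y)"
      unfolding is_coframe_def prod.case
    proof (intro conjI lin[OF y] allI impI)
      fix r s t assume *: "\<forall>v. r * local_form \<A> c (\<lambda>x. fst (\<sigma> x)) y v + s * local_form \<A> c (\<lambda>x. fst (snd (\<sigma> x))) y v +
        t * local_form \<A> c (\<lambda>x. snd (snd (\<sigma> x))) y v = 0"
      have "\<forall>v. r * fst (\<sigma> x) v + s * fst (snd (\<sigma> x)) v + t * snd (snd (\<sigma> x)) v = 0"
        using * unfolding at_x by (metis tvec_comps[OF c x(2)])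
      moreover have "is_coframe (fst (\<sigma> x), fst (snd (\<sigma> x)), snd (snd (\<sigma> x)))"
        using a[OF x(1)] unfolding adapted_coframes_def mem_Collect_eq prod.case by blast
      ultimately show "r = 0" "s = 0" "t = 0" unfolding is_coframe_def prod.case by blast+
    qed
    fix v w assume v: "local_form \<A> c (\<lambda>x. fst (\<sigma> x)) y v = 0" and w: "local_form \<A> c (\<lambda>x. fst (\<sigma> x)) y w = 0"
    obtain V \<theta> where V: "openin (mtopology \<A>) V" "x \<in> V" "smooth_form1 \<A> V \<theta>" "\<theta> x = fst (\<sigma> x)"
      "\<forall>y\<in>V. {v. \<theta> y v = 0} = D y"
      "\<forall>v \<in> D x. \<forall>w \<in> D x. ext_d \<A> \<theta> x v w = fst (snd (\<sigma> x)) v * snd (snd (\<sigma> x)) w - fst (snd (\<sigma> x)) w * snd (snd (\<sigma> x)) v"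
      using a[OF x(1)] unfolding adapted_coframes_def by blast
    have ker: "\<theta> y v = 0 \<longleftrightarrow> fst (\<sigma> y) v = 0" if "y \<in> V" "y \<in> U" for y v
    proof -
      have "{v. fst (\<sigma> y) v = 0} = D y" using a[OF that(2)] unfolding adapted_coframes_def mem_Collect_eq prod.case by blast
      then show ?thesis using V(5) that(1) by blast
    qed
    define v' w' where "v' = tvec \<A> c x v" and "w' = tvec \<A> c x w"
    have vw: "\<theta> x v' = 0" "\<theta> x w' = 0" using v w at_x V(4) by (simp_all add: v'_def w'_def)
    then have D: "v' \<in> D x" "w' \<in> D x" using V(2,5) by blast+
    obtain X1 X2 XL where X: "spanning_frame x X1 X2 XL" by (rule spanning_frame_exists[OF xp])
    have nz: "fst (\<sigma> x) XL \<noteq> 0" by (rule adapted_coframe_values(10)[OF xp a[OF x(1)] X])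
    have "ext_d \<A> (\<lambda>x. fst (\<sigma> x)) x v' w' = ext_d \<A> \<theta> x v' w'"
      using ext_d_proportional[OF V(3) s(1) V(1) U(1) V(2) x(1) ker vw, of XL] nz V(4) by simp
    moreover have "ext_d \<A> (\<lambda>x. fst (\<sigma> x)) x v' w' = d_local (local_form \<A> c (\<lambda>x. fst (\<sigma> x))) y v w"
      using ext_d_chart[OF s(1) mU c x(1,2), of v' w'] comps_tvec[OF c x(2)] by (simp add: v'_def w'_def x(3))
    ultimately show "d_local (local_form \<A> c (\<lambda>x. fst (\<sigma> x))) y v w =
        wedge (local_form \<A> c (\<lambda>x. fst (snd (\<sigma> x)))) (local_form \<A> c (\<lambda>x. snd (snd (\<sigma> x)))) y v w"
      using V(6) D by (simp add: wedge_def at_x v'_def w'_def)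
  qed (rule sm)+
qed

end

lemma P2_cases:
  assumes "h \<in> P2"
  obtains p d q where "p \<noteq> 0" "q \<noteq> 0" "h = diag3 p d q" "d = 1 / (p * q)"
  using assms unfolding P2_def by blast

lemma d_local_cong:
  assumes "open S" "y \<in> S" "\<And>y w. y \<in> S \<Longrightarrow> \<beta> y w = \<beta>' y w" and "\<And>w. smooth_on S (\<lambda>y. \<beta> y w)"
  shows "d_local \<beta> y v w = d_local \<beta>' y v w"
proof -
  have "frechet_derivative (\<lambda>y. \<beta> y w) (at y) = frechet_derivative (\<lambda>y. \<beta>' y w) (at y)" for w
    by (rule frechet_derivative_transform_within_open[OF smooth_on_differentiable[OF assms(4,2)] assms(1,2)])
      (rule assms(3))
  then show ?thesis by (simp add: d_local_def)
qed

section \<open>Charts of the coframe bundle and their transition maps\<close>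

context enriched_manifold
begin

abbreviation Y :: "'m coframe_point set" where "Y \<equiv> coframe_bundle \<A> T1 T2 L"
abbreviation \<Y> :: "('m coframe_point, fibre_coords) atlas" where "\<Y> \<equiv> coframe_atlas \<A> T1 T2 L"
abbreviation "bchart \<equiv> bundle_chart \<A> T1 T2 L"
abbreviation over :: "('m, real^3) chart \<Rightarrow> 'm set \<Rightarrow> fibre_coords set" where
  "over c U \<equiv> coords c ` U \<times> (- {0}) \<times> (- {0})"

definition chart_data :: "('m, real^3) chart \<Rightarrow> 'm set \<Rightarrow> ('m \<Rightarrow> coframe) \<Rightarrow> bool" where
  "chart_data c U \<sigma> \<longleftrightarrow> c \<in> \<A> \<and> openin (mtopology \<A>) U \<and> U \<subseteq> dom_of c \<and> smooth_adapted_section \<A> T1 T2 L U \<sigma>"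

definition fibre_point :: "coframe \<Rightarrow> real \<times> real \<Rightarrow> coframe" where
  "fibre_point s = (\<lambda>(a, b). coframe_act s (diag3 a (1 / (a * b)) b))"

text \<open>The inverse of the coordinate map of a bundle chart, see
  \<open>param_bchart\<close>.\<close>

definition bundle_point :: "('m, real^3) chart \<Rightarrow> ('m \<Rightarrow> coframe) \<Rightarrow> fibre_coords \<Rightarrow> 'm coframe_point" where
  "bundle_point c \<sigma> z = (param c (fst z), fibre_point (\<sigma> (param c (fst z))) (snd z))"

lemma coframe_atlas_eq: "\<Y> = {bchart c U \<sigma> | c U \<sigma>. chart_data c U \<sigma>}"
  unfolding coframe_atlas_def chart_data_def by simp

lemma chart_data_point:
  assumes "chart_data c U \<sigma>" "x \<in> U"
  shows "x \<in> points \<A>" "x \<in> dom_of c" "\<sigma> x \<in> adapted_coframes \<A> T1 T2 L x" "param c (coords c x) = x"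
proof -
  show "x \<in> points \<A>" using assms openin_points unfolding chart_data_def by blast
  show d: "x \<in> dom_of c" using assms unfolding chart_data_def by blast
  show "\<sigma> x \<in> adapted_coframes \<A> T1 T2 L x" using assms unfolding chart_data_def smooth_adapted_section_def by blast
  show "param c (coords c x) = x" using assms d by (simp add: chart_data_def)
qed

lemma dom_bchart: "dom_of (bchart c U \<sigma>) = {u \<in> Y. fst u \<in> U}"
  by (simp add: bundle_chart_def)

lemma fibre_point_in:
  assumes "chart_data c U \<sigma>" "x \<in> U" "a \<noteq> 0" "b \<noteq> 0"
  shows "(x, fibre_point (\<sigma> x) (a, b)) \<in> Y"
  using adapted_coframe_act[OF chart_data_point(1,3)[OF assms(1,2)] assms(3,4)] chart_data_point(1)[OF assms(1,2)]
  by (simp add: coframe_bundle_def fibre_point_def)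

text \<open>The definite description in \<open>bundle_chart\<close> is resolved by
  \<open>fibre_free\<close>.\<close>

lemma coords_bchart:
  assumes "chart_data c U \<sigma>" "x \<in> U" "a \<noteq> 0" "b \<noteq> 0"
  shows "coords (bchart c U \<sigma>) (x, fibre_point (\<sigma> x) (a, b)) = (coords c x, a, b)"
proof -
  have "(THE (a', b'). a' \<noteq> 0 \<and> b' \<noteq> 0 \<and>
      fibre_point (\<sigma> x) (a, b) = coframe_act (\<sigma> x) (diag3 a' (1 / (a' * b')) b')) = (a, b)"
  proof (rule the_equality)
    show "case (a, b) of (a', b') \<Rightarrow> a' \<noteq> 0 \<and> b' \<noteq> 0 \<and>
      fibre_point (\<sigma> x) (a, b) = coframe_act (\<sigma> x) (diag3 a' (1 / (a' * b')) b')"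
      using assms by (simp add: fibre_point_def)
    fix ab assume "case ab of (a', b') \<Rightarrow> a' \<noteq> 0 \<and> b' \<noteq> 0 \<and>
      fibre_point (\<sigma> x) (a, b) = coframe_act (\<sigma> x) (diag3 a' (1 / (a' * b')) b')"
    then obtain a' b' where ab: "ab = (a', b')" "a' \<noteq> 0" "b' \<noteq> 0"
      "coframe_act (\<sigma> x) (diag3 a (1 / (a * b)) b) = coframe_act (\<sigma> x) (diag3 a' (1 / (a' * b')) b')"
      by (cases ab) (auto simp: fibre_point_def)
    show "ab = (a, b)"
      using fibre_free[OF chart_data_point(1,3)[OF assms(1,2)] assms(3,4) ab(2-4)] ab(1) by simp
  qed
  then show ?thesis by (simp add: bundle_chart_def)
qed

lemma bchart_cases:
  assumes "chart_data c U \<sigma>" "u \<in> Y" "fst u \<in> U"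
  obtains x a b where "x \<in> U" "a \<noteq> 0" "b \<noteq> 0" "u = (x, fibre_point (\<sigma> x) (a, b))"
proof -
  obtain x s where u: "u = (x, s)" by (cases u)
  have x: "x \<in> U" "s \<in> adapted_coframes \<A> T1 T2 L x"
    using assms by (auto simp: u coframe_bundle_def)
  show thesis
    using fibre_transitive[OF chart_data_point(1,3)[OF assms(1) x(1)] x(2)] that[OF x(1)]
    by (auto simp: u fibre_point_def)
qed

lemma coords_bchart_image:
  assumes "chart_data c U \<sigma>" "V \<subseteq> U"
  shows "coords (bchart c U \<sigma>) ` {u \<in> Y. fst u \<in> V} = over c V"
proof (intro equalityI subsetI)
  fix z assume "z \<in> coords (bchart c U \<sigma>) ` {u \<in> Y. fst u \<in> V}"
  then obtain u where u: "u \<in> Y" "fst u \<in> V" "z = coords (bchart c U \<sigma>) u" by auto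
  obtain x a b where "x \<in> U" "a \<noteq> 0" "b \<noteq> 0" "u = (x, fibre_point (\<sigma> x) (a, b))"
    using bchart_cases[OF assms(1) u(1)] u(2) assms(2) by blast
  then show "z \<in> over c V"
    using u coords_bchart[OF assms(1)] by auto
next
  fix z :: "fibre_coords" assume "z \<in> over c V"
  then obtain x a b where z: "x \<in> V" "a \<noteq> 0" "b \<noteq> 0" "z = (coords c x, a, b)" by auto
  have x: "x \<in> U" using z(1) assms(2) by auto
  have "z = coords (bchart c U \<sigma>) (x, fibre_point (\<sigma> x) (a, b))"
    using coords_bchart[OF assms(1) x z(2,3)] z(4) by simp
  then show "z \<in> coords (bchart c U \<sigma>) ` {u \<in> Y. fst u \<in> V}"
    using fibre_point_in[OF assms(1) x z(2,3)] z(1) by auto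
qed

lemma bundle_point_coords:
  assumes "chart_data c U \<sigma>" "u \<in> Y" "fst u \<in> U"
  shows "bundle_point c \<sigma> (coords (bchart c U \<sigma>) u) = u"
proof -
  obtain x a b where u: "x \<in> U" "a \<noteq> 0" "b \<noteq> 0" "u = (x, fibre_point (\<sigma> x) (a, b))"
    using bchart_cases[OF assms] .
  then show ?thesis
    using coords_bchart[OF assms(1)] chart_data_point(4)[OF assms(1)] by (simp add: bundle_point_def)
qed

lemma inj_bchart: "chart_data c U \<sigma> \<Longrightarrow> inj_on (coords (bchart c U \<sigma>)) (dom_of (bchart c U \<sigma>))"
  by (rule inj_on_inverseI[where g = "bundle_point c \<sigma>"]) (simp add: dom_bchart bundle_point_coords)

lemma param_bchart:
  assumes "chart_data c U \<sigma>" "z \<in> over c U"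
  shows "param (bchart c U \<sigma>) z = bundle_point c \<sigma> z" "bundle_point c \<sigma> z \<in> dom_of (bchart c U \<sigma>)"
    "coords (bchart c U \<sigma>) (bundle_point c \<sigma> z) = z"
proof -
  obtain x a b where z: "x \<in> U" "a \<noteq> 0" "b \<noteq> 0" "z = (coords c x, a, b)" using assms(2) by auto
  have b: "bundle_point c \<sigma> z = (x, fibre_point (\<sigma> x) (a, b))"
    using chart_data_point(4)[OF assms(1) z(1)] z by (simp add: bundle_point_def)
  show d: "bundle_point c \<sigma> z \<in> dom_of (bchart c U \<sigma>)"
    using fibre_point_in[OF assms(1) z(1-3)] z(1) by (simp add: b dom_bchart)
  show c: "coords (bchart c U \<sigma>) (bundle_point c \<sigma> z) = z"
    unfolding b using coords_bchart[OF assms(1) z(1-3)] z(4) by simp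
  show "param (bchart c U \<sigma>) z = bundle_point c \<sigma> z"
    unfolding param_def by (rule inv_into_f_eq[OF inj_bchart[OF assms(1)] d c])
qed

text \<open>These are the transition functions of the principal bundle. The factors p and q between
  the two coframes come from evaluating one of them on the dual frame of the other, hence depend
  smoothly on the point; \<open>diag_parameters\<close> converts them into a and b.\<close>

lemma section_ratio:
  assumes C: "chart_data c U \<sigma>" and C': "chart_data c' U' \<sigma>'"
  obtains a b where "smooth_on (coords c ` (U \<inter> U')) a" "smooth_on (coords c ` (U \<inter> U')) b"
    "\<And>x. x \<in> U \<Longrightarrow> x \<in> U' \<Longrightarrow> a (coords c x) \<noteq> 0 \<and> b (coords c x) \<noteq> 0 \<and>
      \<sigma> x = fibre_point (\<sigma>' x) (a (coords c x), b (coords c x))"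
proof -
  let ?V = "U \<inter> U'" let ?S = "coords c ` ?V"
  have c: "c \<in> \<A>" and V: "openin (mtopology \<A>) ?V" "?V \<subseteq> dom_of c"
    using C C' by (auto simp: chart_data_def)
  have \<sigma>: "smooth_adapted_section \<A> T1 T2 L ?V \<sigma>"
    by (rule smooth_adapted_section_subset[of U]) (use C in \<open>auto simp: chart_data_def\<close>)
  have \<sigma>': "smooth_adapted_section \<A> T1 T2 L ?V \<sigma>'"
    by (rule smooth_adapted_section_subset[of U']) (use C' in \<open>auto simp: chart_data_def\<close>)
  interpret F: adapted_coframe_field ?S "local_form \<A> c (\<lambda>x. fst (\<sigma> x))"
    "local_form \<A> c (\<lambda>x. fst (snd (\<sigma> x)))" "local_form \<A> c (\<lambda>x. snd (snd (\<sigma> x)))"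
    by (rule section_coframe_field[OF c V \<sigma>])
  interpret F': adapted_coframe_field ?S "local_form \<A> c (\<lambda>x. fst (\<sigma>' x))"
    "local_form \<A> c (\<lambda>x. fst (snd (\<sigma>' x)))" "local_form \<A> c (\<lambda>x. snd (snd (\<sigma>' x)))"
    by (rule section_coframe_field[OF c V \<sigma>'])
  define p q where "p y = local_form \<A> c (\<lambda>x. fst (snd (\<sigma> x))) y (F'.e1 y)"
    and "q y = local_form \<A> c (\<lambda>x. snd (snd (\<sigma> x))) y (F'.e2 y)" for y
  define a b where "a y = root 3 ((p y)\<^sup>2 * q y)" and "b y = a y / (p y * q y)" for y
  have pq: "p (coords c x) \<noteq> 0 \<and> q (coords c x) \<noteq> 0 \<and>
      fst (\<sigma> x) = (\<lambda>v. p (coords c x) * q (coords c x) * fst (\<sigma>' x) v) \<and>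
      fst (snd (\<sigma> x)) = (\<lambda>v. p (coords c x) * fst (snd (\<sigma>' x)) v) \<and>
      snd (snd (\<sigma> x)) = (\<lambda>v. q (coords c x) * snd (snd (\<sigma>' x)) v)" if x: "x \<in> ?V" for x
  proof -
    have xU: "x \<in> U" "x \<in> U'" "x \<in> dom_of c" using x V by auto
    have y: "coords c x \<in> ?S" using x by auto
    have "(fst (\<sigma>' x), fst (snd (\<sigma>' x)), snd (snd (\<sigma>' x))) \<in> adapted_coframes \<A> T1 T2 L x"
      "(fst (\<sigma> x), fst (snd (\<sigma> x)), snd (snd (\<sigma> x))) \<in> adapted_coframes \<A> T1 T2 L x"
      using chart_data_point(3)[OF C' xU(2)] chart_data_point(3)[OF C xU(1)] by simp_all
    from adapted_coframe_ratio[OF chart_data_point(1)[OF C xU(1)] this]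
    obtain p' q' where r: "p' \<noteq> 0" "q' \<noteq> 0" "fst (\<sigma> x) = (\<lambda>v. p' * q' * fst (\<sigma>' x) v)"
      "fst (snd (\<sigma> x)) = (\<lambda>v. p' * fst (snd (\<sigma>' x)) v)" "snd (snd (\<sigma> x)) = (\<lambda>v. q' * snd (snd (\<sigma>' x)) v)" .
    have "p (coords c x) = p' * local_form \<A> c (\<lambda>x. fst (snd (\<sigma>' x))) (coords c x) (F'.e1 (coords c x))"
      "q (coords c x) = q' * local_form \<A> c (\<lambda>x. snd (snd (\<sigma>' x))) (coords c x) (F'.e2 (coords c x))"
      unfolding p_def q_def local_form_coords[OF c xU(3)] r(4,5) by simp_all
    then have "p (coords c x) = p'" "q (coords c x) = q'" by (simp_all only: F'.dual_eqs[OF y] mult_1_right)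
    then show ?thesis using r by simp
  qed
  have pqS: "p y \<noteq> 0" "q y \<noteq> 0" if "y \<in> ?S" for y using pq that by auto
  have sp: "smooth_on ?S p" unfolding p_def
    by (rule smooth_on_linear_arg[OF F.open_S F.linear_coframe(2) F.smooth1 F'.smooth_frame(2)])
  have sq: "smooth_on ?S q" unfolding q_def
    by (rule smooth_on_linear_arg[OF F.open_S F.linear_coframe(3) F.smooth2 F'.smooth_frame(3)])
  have "smooth_on ?S (\<lambda>y. (p y)\<^sup>2 * q y)" by (intro smooth_intros F.open_S sp sq)
  \<comment> \<open>The argument has no zero, so the cube root is taken only where it is
    smooth.\<close>
  from smooth_on_compose[OF smooth_on_root3 F.open_S this]
  have sa: "smooth_on ?S (\<lambda>y. a y)" unfolding a_def using pqS by fastforce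
  have sb: "smooth_on ?S (\<lambda>y. b y)" unfolding b_def
    by (intro smooth_intros F.open_S sa sp sq) (use pqS in auto)
  show thesis
  proof (rule that[OF sa sb])
    fix x assume "x \<in> U" "x \<in> U'"
    then have x: "x \<in> ?V" by simp
    note pqx = pq[OF x]
    have e: "a (coords c x) \<noteq> 0" "b (coords c x) \<noteq> 0"
      "a (coords c x) / b (coords c x) = p (coords c x) * q (coords c x)"
      "(a (coords c x))\<^sup>2 * b (coords c x) = p (coords c x)"
      "1 / (a (coords c x) * (b (coords c x))\<^sup>2) = q (coords c x)"
      using diag_parameters[of "p (coords c x)" "q (coords c x)"] pqx unfolding a_def b_def by auto
    have "fibre_point (fst (\<sigma>' x), fst (snd (\<sigma>' x)), snd (snd (\<sigma>' x))) (a (coords c x), b (coords c x)) =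
        (fst (\<sigma> x), fst (snd (\<sigma> x)), snd (snd (\<sigma> x)))"
      unfolding fibre_point_def prod.case coframe_act_diag e(3-5) using pqx by simp
    then show "a (coords c x) \<noteq> 0 \<and> b (coords c x) \<noteq> 0 \<and> \<sigma> x = fibre_point (\<sigma>' x) (a (coords c x), b (coords c x))"
      using e by simp
  qed
qed

lemma fibre_point_compose:
  assumes "a \<noteq> 0" "b \<noteq> 0" "p \<noteq> 0" "q \<noteq> 0"
  shows "coframe_act (fibre_point s (a, b)) (diag3 p d q) = fibre_point s (p * a, q * b)"
    "fibre_point (fibre_point s (a, b)) (p, q) = fibre_point s (p * a, q * b)"
  using coframe_act_compose[OF assms] by (simp_all add: fibre_point_def)

lemma smooth_atlas_bundle: "smooth_atlas \<Y>"
  unfolding smooth_atlas_def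
proof (intro conjI ballI)
  fix C assume "C \<in> \<Y>"
  then obtain c U \<sigma> where C: "chart_data c U \<sigma>" "C = bchart c U \<sigma>" by (auto simp: coframe_atlas_eq)
  show "inj_on (coords C) (dom_of C)" using inj_bchart C by simp
  have op: "open (coords c ` V)" if "openin (mtopology \<A>) V" "V \<subseteq> U" for V
  proof -
    have "V \<inter> dom_of c = V" "c \<in> \<A>" using that(2) C(1) by (auto simp: chart_data_def)
    then show ?thesis using manifold_openD[OF openin_manifold_open[OF that(1)]] by metis
  qed
  show "open (coords C ` dom_of C)"
    unfolding C(2) dom_bchart coords_bchart_image[OF C(1) subset_refl]
    using C(1) by (intro open_Times op) (auto simp: chart_data_def)
  fix C' assume "C' \<in> \<Y>"
  then obtain c' U' \<sigma>' where C': "chart_data c' U' \<sigma>'" "C' = bchart c' U' \<sigma>'" by (auto simp: coframe_atlas_eq)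
  let ?S = "coords c ` (U \<inter> U')"
  have dom: "dom_of C \<inter> dom_of C' = {u \<in> Y. fst u \<in> U \<inter> U'}"
    by (auto simp: C C' dom_bchart)
  have im: "coords C ` (dom_of C \<inter> dom_of C') = ?S \<times> (- {0}) \<times> (- {0})"
    unfolding dom unfolding C(2) by (rule coords_bchart_image[OF C(1)]) auto
  have S: "open ?S" using C(1) C'(1) by (intro op) (auto simp: chart_data_def)
  then show o: "open (coords C ` (dom_of C \<inter> dom_of C'))"
    unfolding im by (intro open_Times) auto
  obtain a b where ab: "smooth_on ?S a" "smooth_on ?S b"
    "\<And>x. x \<in> U \<Longrightarrow> x \<in> U' \<Longrightarrow> a (coords c x) \<noteq> 0 \<and> b (coords c x) \<noteq> 0 \<and>
      \<sigma> x = fibre_point (\<sigma>' x) (a (coords c x), b (coords c x))"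
    by (rule section_ratio[OF C(1) C'(1)]) (rule that)
  have "smooth_on ?S (coords c' \<circ> param c)"
    by (rule smooth_on_subset[OF smooth_transition]) (use C(1) C'(1) in \<open>auto simp: chart_data_def\<close>)
  note sm = smooth_on_fst_compose[OF this o[unfolded im]] smooth_on_fst_compose[OF ab(1) o[unfolded im]]
    smooth_on_fst_compose[OF ab(2) o[unfolded im]]
  \<comment> \<open>A change of section multiplies the fibre coordinates by the functions a and b of
    the base point.\<close>
  have "smooth_on (?S \<times> (- {0}) \<times> (- {0})) (\<lambda>z. ((coords c' \<circ> param c) (fst z), fst (snd z) * a (fst z), snd (snd z) * b (fst z)))"
    by (intro smooth_on_Pair smooth_on_mult smooth_on_fst smooth_on_snd smooth_on_id sm o[unfolded im])
  then show "smooth_on (coords C ` (dom_of C \<inter> dom_of C')) (coords C' \<circ> param C)"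
    unfolding im
  proof (rule smooth_on_cong[OF o[unfolded im]])
    fix z :: "fibre_coords" assume z: "z \<in> ?S \<times> (- {0}) \<times> (- {0})"
    then obtain x p q where x: "x \<in> U" "x \<in> U'" "p \<noteq> 0" "q \<noteq> 0" "z = (coords c x, p, q)" by auto
    note abx = ab(3)[OF x(1,2)]
    have "param C z = (x, fibre_point (\<sigma> x) (p, q))"
      using param_bchart(1)[OF C(1), of z] z x chart_data_point(4)[OF C(1) x(1)]
      by (auto simp: C(2) bundle_point_def)
    also have "fibre_point (\<sigma> x) (p, q) = fibre_point (\<sigma>' x) (p * a (coords c x), q * b (coords c x))"
      using fibre_point_compose(2)[of "a (coords c x)" "b (coords c x)" p q "\<sigma>' x"] abx x by metis
    finally have "(coords C' \<circ> param C) z = (coords c' x, p * a (coords c x), q * b (coords c x))"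
      using coords_bchart[OF C'(1) x(2), of "p * a (coords c x)" "q * b (coords c x)"] abx x by (simp add: C'(2))
    then show "((coords c' \<circ> param c) (fst z), fst (snd z) * a (fst z), snd (snd z) * b (fst z)) = (coords C' \<circ> param C) z"
      using x(5) chart_data_point(4)[OF C(1) x(1)] by simp
  qed
qed

sublocale Y: manifold_atlas \<Y>
  by unfold_locales (rule smooth_atlas_bundle)

lemma points_bundle: "points \<Y> = Y"
proof
  show "points \<Y> \<subseteq> Y" by (auto simp: points_def coframe_atlas_eq dom_bchart)
  show "Y \<subseteq> points \<Y>"
  proof
    fix u assume u: "u \<in> Y"
    then have x: "fst u \<in> points \<A>" by (auto simp: coframe_bundle_def)
    obtain c U \<sigma> where "c \<in> \<A>" "openin (mtopology \<A>) U" "fst u \<in> U" "U \<subseteq> dom_of c"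
      "smooth_adapted_section \<A> T1 T2 L U \<sigma>" by (rule local_section[OF x])
    then have "chart_data c U \<sigma>" "u \<in> dom_of (bchart c U \<sigma>)" using u by (auto simp: chart_data_def dom_bchart)
    then show "u \<in> points \<Y>" unfolding points_def coframe_atlas_eq by blast
  qed
qed

lemma bundle_open: "Y.manifold_open Y"
proof -
  have "open (coords C ` (Y \<inter> dom_of C))" if C: "C \<in> \<Y>" for C
  proof -
    have "Y \<inter> dom_of C = dom_of C \<inter> dom_of C" using Y.dom_points[OF C] by (auto simp: points_bundle)
    then show ?thesis using Y.open_overlap[OF C C] by metis
  qed
  then show ?thesis by (simp add: Y.manifold_open_def)
qed

end

section \<open>Projection and tautological forms in a trivialisation\<close>

locale bundle_trivialisation = enriched_manifold +
  fixes c U \<sigma>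
  assumes data: "chart_data c U \<sigma>"
begin

sublocale F: adapted_coframe_field "coords c ` U" "local_form \<A> c (\<lambda>x. fst (\<sigma> x))"
    "local_form \<A> c (\<lambda>x. fst (snd (\<sigma> x)))" "local_form \<A> c (\<lambda>x. snd (snd (\<sigma> x)))"
  by (rule section_coframe_field) (use data in \<open>auto simp: chart_data_def\<close>)

abbreviation "C \<equiv> bchart c U \<sigma>"

lemma C_in: "C \<in> \<Y>" using data unfolding coframe_atlas_eq by blast

lemma c_in: "c \<in> \<A>" using data by (simp add: chart_data_def)

lemma coords_C: "coords C ` dom_of C = F.fibred" "coords C ` (Y \<inter> dom_of C) = F.fibred"
proof -
  have "Y \<inter> dom_of C = {u \<in> Y. fst u \<in> U}" by (auto simp: dom_bchart)
  then show "coords C ` dom_of C = F.fibred" "coords C ` (Y \<inter> dom_of C) = F.fibred"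
    using coords_bchart_image[OF data subset_refl] by (simp_all add: F.fibred_def dom_bchart)
qed

lemma param_C:
  assumes "z \<in> F.fibred"
  shows "param C z = bundle_point c \<sigma> z" "param C z \<in> dom_of C" "coords C (param C z) = z" "param C z \<in> Y"
    "param c (fst z) \<in> U" "coords c (param c (fst z)) = fst z"
proof -
  have z: "z \<in> over c U" using assms by (simp add: F.fibred_def)
  show "param C z = bundle_point c \<sigma> z" "param C z \<in> dom_of C" "coords C (param C z) = z"
    using param_bchart[OF data z] by simp_all
  then show "param C z \<in> Y" by (simp add: dom_bchart)
  have "fst z \<in> coords c ` U" using z by auto
  then obtain x where "x \<in> U" "fst z = coords c x" by blast
  then show "param c (fst z) \<in> U" "coords c (param c (fst z)) = fst z"
    using chart_data_point(4)[OF data] by simp_all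
qed

lemma tangent_map_fst:
  assumes z: "z \<in> F.fibred"
  shows "tangent_map \<Y> \<A> fst (param C z) (tvec \<Y> C (param C z) v) = tvec \<A> c (param c (fst z)) (fst v)"
proof -
  note p = param_C[OF z]
  have fst_p: "fst (param C z) = param c (fst z)" if "z \<in> F.fibred" for z
    using param_C(1)[OF that] by (simp add: bundle_point_def)
  have "tangent_map \<Y> \<A> fst (param C z) (tvec \<Y> C (param C z) v) = tvec \<A> c (fst (param C z)) (fst v)"
  proof (rule tangent_map_tvec[OF Y.manifold_atlas_axioms manifold_atlas_axioms C_in p(2) c_in _ F.open_fibred])
    show "fst (param C z) \<in> dom_of c" "coords C (param C z) \<in> F.fibred"
      using fst_p[OF z] p(3,5) z chart_data_point(2)[OF data] by simp_all
    show "F.fibred \<subseteq> coords C ` dom_of C" by (simp add: coords_C)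
    show "fst (param C y) \<in> dom_of c" if "y \<in> F.fibred" for y
      using fst_p[OF that] param_C(5)[OF that] chart_data_point(2)[OF data] by simp
    have "(fst has_derivative fst) (at z)" by (rule bounded_linear_imp_has_derivative[OF bounded_linear_fst])
    then have "((coords c \<circ> fst \<circ> param C) has_derivative fst) (at z)"
      by (rule has_derivative_transform_within_open[OF _ F.open_fibred z]) (simp add: fst_p param_C(6))
    then show "((coords c \<circ> fst \<circ> param C) has_derivative fst) (at (coords C (param C z)))"
      by (simp only: p(3))
  qed
  then show ?thesis by (simp only: fst_p[OF z])
qed

lemma local_taut:
  assumes z: "z \<in> F.fibred"
  shows "local_form \<Y> C (taut \<A> \<Y>) z v = F.\<Omega>0 z v" "local_form \<Y> C (taut1 \<A> \<Y>) z v = F.\<Omega>1 z v"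
    "local_form \<Y> C (taut2 \<A> \<Y>) z v = F.\<Omega>2 z v"
proof -
  obtain y a b where zz: "z = (y, a, b)" by (metis surj_pair)
  obtain s0 s1 s2 where s: "\<sigma> (param c y) = (s0, s1, s2)" by (metis surj_pair)
  show "local_form \<Y> C (taut \<A> \<Y>) z v = F.\<Omega>0 z v" "local_form \<Y> C (taut1 \<A> \<Y>) z v = F.\<Omega>1 z v"
    "local_form \<Y> C (taut2 \<A> \<Y>) z v = F.\<Omega>2 z v"
    unfolding local_form_def[of \<Y>] taut_def taut1_def taut2_def tangent_map_fst[OF z]
    unfolding param_C(1)[OF z] F.\<Omega>0_def F.\<Omega>1_def F.\<Omega>2_def local_form_def
    by (simp_all add: zz s bundle_point_def fibre_point_def coframe_act_diag)
qed

end

section \<open>Existence and uniqueness of the connection\<close>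

lemma (in manifold_atlas) ext_d_cong:
  assumes "smooth_form1 \<A> U \<alpha>" "manifold_open U" "p \<in> U" "p \<in> points \<A>" "\<And>q v. q \<in> U \<Longrightarrow> \<alpha> q v = \<alpha>' q v"
  shows "ext_d \<A> \<alpha> p v w = ext_d \<A> \<alpha>' p v w"
proof -
  let ?c = "chart_at \<A> p"
  have c: "?c \<in> \<A>" "p \<in> dom_of ?c" using chart_at assms(4) by auto
  show ?thesis
    unfolding ext_d_local
  proof (rule d_local_cong[OF manifold_openD[OF assms(2) c(1)]])
    show "coords ?c p \<in> coords ?c ` (U \<inter> dom_of ?c)" using assms(3) c by auto
    show "local_form \<A> ?c \<alpha> y w = local_form \<A> ?c \<alpha>' y w" if "y \<in> coords ?c ` (U \<inter> dom_of ?c)" for y w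
      using that c assms(5) by (auto simp: local_form_def)
  qed (rule smooth_form1_local(1)[OF assms(1) c(1)])
qed

lemma ext_d_zero: "ext_d \<A> (\<lambda>p v. 0) p v w = 0"
  by (simp add: ext_d_def local_form_def Let_def)

section \<open>Matrices of the prescribed shape\<close>

definition bmat :: "real \<Rightarrow> real \<Rightarrow> real \<Rightarrow> real \<Rightarrow> real \<Rightarrow> real^3^3" where
  "bmat f g x0 x1 x2 = mat3 (f + g) 0 0  x1 (- 2 * g) 0  x0 x2 (- f + g)"

lemma mat3_nth [simp]:
  "mat3 a11 a12 a13 a21 a22 a23 a31 a32 a33 $ 1 $ 1 = a11" "mat3 a11 a12 a13 a21 a22 a23 a31 a32 a33 $ 1 $ 2 = a12"
  "mat3 a11 a12 a13 a21 a22 a23 a31 a32 a33 $ 1 $ 3 = a13" "mat3 a11 a12 a13 a21 a22 a23 a31 a32 a33 $ 2 $ 1 = a21"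
  "mat3 a11 a12 a13 a21 a22 a23 a31 a32 a33 $ 2 $ 2 = a22" "mat3 a11 a12 a13 a21 a22 a23 a31 a32 a33 $ 2 $ 3 = a23"
  "mat3 a11 a12 a13 a21 a22 a23 a31 a32 a33 $ 3 $ 1 = a31" "mat3 a11 a12 a13 a21 a22 a23 a31 a32 a33 $ 3 $ 2 = a32"
  "mat3 a11 a12 a13 a21 a22 a23 a31 a32 a33 $ 3 $ 3 = a33"
  by (simp_all add: mat3_def vector_3)

lemma mat3_eqI:
  fixes X Z :: "real^3^3"
  assumes "X $ 1 $ 1 = Z $ 1 $ 1" "X $ 1 $ 2 = Z $ 1 $ 2" "X $ 1 $ 3 = Z $ 1 $ 3"
    "X $ 2 $ 1 = Z $ 2 $ 1" "X $ 2 $ 2 = Z $ 2 $ 2" "X $ 2 $ 3 = Z $ 2 $ 3"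
    "X $ 3 $ 1 = Z $ 3 $ 1" "X $ 3 $ 2 = Z $ 3 $ 2" "X $ 3 $ 3 = Z $ 3 $ 3"
  shows "X = Z"
  using assms by (simp add: vec_eq_iff forall_3)

lemma bmat_expand: "bmat f g x0 x1 x2 = f *\<^sub>R bmat 1 0 0 0 0 + g *\<^sub>R bmat 0 1 0 0 0 + x0 *\<^sub>R bmat 0 0 1 0 0 +
    x1 *\<^sub>R bmat 0 0 0 1 0 + x2 *\<^sub>R bmat 0 0 0 0 1"
  by (rule mat3_eqI) (simp_all add: bmat_def)

lemma bmat_inject: "bmat f g x0 x1 x2 = bmat f' g' x0' x1' x2' \<longleftrightarrow>
    f = f' \<and> g = g' \<and> x0 = x0' \<and> x1 = x1' \<and> x2 = x2'"
proof
  assume e: "bmat f g x0 x1 x2 = bmat f' g' x0' x1' x2'"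
  have "f + g = f' + g'" "- 2 * g = - 2 * g'" "x0 = x0'" "x1 = x1'" "x2 = x2'"
    using arg_cong[OF e, of "\<lambda>X. X $ 1 $ 1"] arg_cong[OF e, of "\<lambda>X. X $ 2 $ 2"] arg_cong[OF e, of "\<lambda>X. X $ 3 $ 1"]
      arg_cong[OF e, of "\<lambda>X. X $ 2 $ 1"] arg_cong[OF e, of "\<lambda>X. X $ 3 $ 2"]
    by (simp_all add: bmat_def)
  then show "f = f' \<and> g = g' \<and> x0 = x0' \<and> x1 = x1' \<and> x2 = x2'" by simp
qed simp

lemma lie_b_bmat: "lie_b = {bmat f g x0 x1 x2 | f g x0 x1 x2. True}"
proof (intro equalityI subsetI)
  fix X assume X: "X \<in> lie_b"
  have "X = bmat ((X $ 1 $ 1 - X $ 3 $ 3) / 2) ((X $ 1 $ 1 + X $ 3 $ 3) / 2) (X $ 3 $ 1) (X $ 2 $ 1) (X $ 3 $ 2)"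
    using X by (intro mat3_eqI) (simp_all add: lie_b_def trace_def sum_3 bmat_def field_simps)
  then show "X \<in> {bmat f g x0 x1 x2 | f g x0 x1 x2. True}" by blast
qed (auto simp: lie_b_def trace_def sum_3 bmat_def)

lemma linear_bmat:
  assumes "linear f" "linear g" "linear x0" "linear x1" "linear x2"
  shows "linear (\<lambda>v. bmat (f v) (g v) (x0 v) (x1 v) (x2 v))"
  using assms
  by (intro linearI mat3_eqI) (simp_all add: bmat_def linear_add linear_scale algebra_simps)

lemma smooth_bmat:
  assumes "open S" "smooth_on S f" "smooth_on S g" "smooth_on S x0" "smooth_on S x1" "smooth_on S x2"
  shows "smooth_on S (\<lambda>z. bmat (f z) (g z) (x0 z) (x1 z) (x2 z))"
  by (subst bmat_expand) (intro smooth_intros assms)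

lemma diag3_inverse:
  assumes "p \<noteq> 0" "q \<noteq> 0"
  shows "matrix_inv (diag3 p (1 / (p * q)) q) = diag3 (1 / p) (p * q) (1 / q)"
proof -
  have *: "diag3 p (1 / (p * q)) q ** diag3 (1 / p) (p * q) (1 / q) = mat 1"
    "diag3 (1 / p) (p * q) (1 / q) ** diag3 p (1 / (p * q)) q = mat 1"
    using assms by (intro mat3_eqI; simp add: diag3_def matrix_matrix_mult_def sum_3 mat_def)+
  let ?A = "diag3 p (1 / (p * q)) q" and ?B = "diag3 (1 / p) (p * q) (1 / q)"
  have "?A ** matrix_inv ?A = mat 1"
    unfolding matrix_inv_def by (rule conjunct1[OF someI[of _ ?B]]) (simp add: *)
  then have "?B ** (?A ** matrix_inv ?A) = ?B" by simp
  then show ?thesis by (simp only: matrix_mul_assoc *(2) matrix_mul_lid)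
qed

text \<open>Conjugation keeps the diagonal and rescales the entries below it by the factors of
  \<open>coframe_act\<close>; this reduces equivariance of the connection to
  \<open>fibred_scale\<close>.\<close>

lemma bmat_conjugate:
  assumes "p \<noteq> 0" "q \<noteq> 0"
  shows "diag3 (1 / p) (p * q) (1 / q) ** bmat f g x0 x1 x2 ** diag3 p (1 / (p * q)) q =
    bmat f g (p / q * x0) (p\<^sup>2 * q * x1) (1 / (p * q\<^sup>2) * x2)"
  using assms by (intro mat3_eqI)
    (simp_all add: diag3_def bmat_def matrix_matrix_mult_def sum_3 field_simps power2_eq_square)

section \<open>Smoothness on the bundle and pointwise structure equations\<close>

context enriched_manifold
begin

abbreviation "\<omega> \<equiv> taut \<A> \<Y>"
abbreviation "\<omega>1 \<equiv> taut1 \<A> \<Y>"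
abbreviation "\<omega>2 \<equiv> taut2 \<A> \<Y>"
abbreviation "trivialisation \<equiv> bundle_trivialisation \<A> T1 T2 L"

lemma trivialisationI: "chart_data c U \<sigma> \<Longrightarrow> trivialisation c U \<sigma>"
  by (intro bundle_trivialisation.intro enriched_manifold_axioms bundle_trivialisation_axioms.intro)

lemma bundle_chart_cases:
  assumes "C \<in> \<Y>"
  obtains c U \<sigma> where "trivialisation c U \<sigma>" "C = bchart c U \<sigma>"
  using assms trivialisationI unfolding coframe_atlas_eq by blast

lemma trivialisation_exists:
  assumes "u \<in> Y"
  obtains c U \<sigma> where "trivialisation c U \<sigma>" "u \<in> dom_of (bchart c U \<sigma>)" "chart_at \<Y> u = bchart c U \<sigma>"
proof -
  have "chart_at \<Y> u \<in> \<Y>" "u \<in> dom_of (chart_at \<Y> u)" using Y.chart_at assms points_bundle by auto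
  then show thesis using that bundle_chart_cases by metis
qed

definition local_expression ::
    "('m coframe_point \<Rightarrow> fibre_coords \<Rightarrow> 'v::real_normed_vector) \<Rightarrow> ('m, real^3) chart \<Rightarrow> 'm set \<Rightarrow>
     ('m \<Rightarrow> coframe) \<Rightarrow> (fibre_coords \<Rightarrow> fibre_coords \<Rightarrow> 'v) \<Rightarrow> bool" where
  "local_expression \<alpha> c U \<sigma> \<beta> \<longleftrightarrow> (\<forall>z \<in> over c U. linear (\<beta> z) \<and>
     (\<forall>v. local_form \<Y> (bchart c U \<sigma>) \<alpha> z v = \<beta> z v \<and> smooth_on (over c U) (\<lambda>z. \<beta> z v)))"

lemma smooth_form1_bundleI:
  fixes \<alpha> :: "'m coframe_point \<Rightarrow> fibre_coords \<Rightarrow> 'v::real_normed_vector"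
  assumes "\<And>c U \<sigma>. trivialisation c U \<sigma> \<Longrightarrow> \<exists>\<beta>. local_expression \<alpha> c U \<sigma> \<beta>"
  shows "smooth_form1 \<Y> Y \<alpha>"
  unfolding smooth_form1_def
proof (intro conjI ballI allI)
  fix u assume u: "u \<in> Y"
  obtain c U \<sigma> where t: "trivialisation c U \<sigma>" and d: "u \<in> dom_of (bchart c U \<sigma>)"
    by (rule trivialisation_exists[OF u])
  interpret B: bundle_trivialisation \<A> T1 T2 L c U \<sigma> by (rule t)
  have z: "coords B.C u \<in> over c U" using B.coords_C(1) d by (auto simp: B.F.fibred_def)
  from assms[OF t] obtain \<beta> where "local_expression \<alpha> c U \<sigma> \<beta>" ..
  from bspec[OF this[unfolded local_expression_def] z] have \<beta>: "linear (\<beta> (coords B.C u))"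
    "\<And>v. local_form \<Y> B.C \<alpha> (coords B.C u) v = \<beta> (coords B.C u) v" by blast+
  have "\<alpha> u = \<beta> (coords B.C u) \<circ> comps \<Y> B.C u"
    using Y.form_eq_local_form[OF B.C_in d, of \<alpha>] \<beta>(2) by (simp add: fun_eq_iff)
  then show "linear (\<alpha> u)" using linear_compose[OF Y.linear_comps[OF B.C_in d] \<beta>(1)] by simp
next
  fix C w assume "C \<in> \<Y>"
  then obtain c U \<sigma> where t: "trivialisation c U \<sigma>" and C: "C = bchart c U \<sigma>"
    by (rule bundle_chart_cases)
  interpret B: bundle_trivialisation \<A> T1 T2 L c U \<sigma> by (rule t)
  from assms[OF t] obtain \<beta> where "local_expression \<alpha> c U \<sigma> \<beta>" ..
  note \<beta> = this[unfolded local_expression_def, folded B.F.fibred_def]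
  show "smooth_on (coords C ` (Y \<inter> dom_of C)) (\<lambda>y. local_form \<Y> C \<alpha> y w)"
    unfolding C B.coords_C(2)
  \<comment> \<open>In \<open>local_expression\<close> the smoothness clause sits under a quantifier
    over points and is void over an empty domain.\<close>
  proof (cases "B.F.fibred = {}")
    case True
    then show "smooth_on B.F.fibred (\<lambda>y. local_form \<Y> B.C \<alpha> y w)"
      using smooth_on_cong[OF B.F.open_fibred smooth_on_const[of _ 0]] by auto
  next
    case False
    then have "smooth_on B.F.fibred (\<lambda>z. \<beta> z w)" using \<beta> by blast
    then show "smooth_on B.F.fibred (\<lambda>y. local_form \<Y> B.C \<alpha> y w)"
      by (rule smooth_on_cong[OF B.F.open_fibred]) (use \<beta> in metis)
  qed
qed

lemma smooth_fun_bundleI: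
  fixes f :: "'m coframe_point \<Rightarrow> real"
  assumes "\<And>c U \<sigma>. trivialisation c U \<sigma> \<Longrightarrow> \<exists>g. smooth_on (over c U) g \<and>
      (\<forall>u \<in> dom_of (bchart c U \<sigma>). f u = g (coords (bchart c U \<sigma>) u))"
  shows "smooth_fun \<Y> Y f"
  unfolding smooth_fun_def
proof
  fix C assume "C \<in> \<Y>"
  then obtain c U \<sigma> where t: "trivialisation c U \<sigma>" and C: "C = bchart c U \<sigma>"
    by (rule bundle_chart_cases)
  interpret B: bundle_trivialisation \<A> T1 T2 L c U \<sigma> by (rule t)
  obtain g where g: "smooth_on B.F.fibred g" "\<forall>u \<in> dom_of B.C. f u = g (coords B.C u)"
    using assms[OF t] unfolding B.F.fibred_def by blast
  show "smooth_on (coords C ` (Y \<inter> dom_of C)) (f \<circ> param C)"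
    unfolding C B.coords_C(2)
    by (rule smooth_on_cong[OF B.F.open_fibred g(1)]) (simp add: g(2) B.param_C(2,3))
qed

lemma smooth_taut: "smooth_form1 \<Y> Y \<omega>" "smooth_form1 \<Y> Y \<omega>1" "smooth_form1 \<Y> Y \<omega>2"
proof -
  have "\<exists>\<beta>. local_expression \<alpha> c U \<sigma> \<beta>"
    if t: "trivialisation c U \<sigma>" and "\<alpha> \<in> {\<omega>, \<omega>1, \<omega>2}" for c U \<sigma> \<alpha>
  proof -
    interpret B: bundle_trivialisation \<A> T1 T2 L c U \<sigma> by (rule t)
    show ?thesis
      using that(2) B.local_taut B.F.linear_fibred_forms B.F.smooth_fibred_forms
      unfolding local_expression_def B.F.fibred_def[symmetric] by blast
  qed
  then show "smooth_form1 \<Y> Y \<omega>" "smooth_form1 \<Y> Y \<omega>1" "smooth_form1 \<Y> Y \<omega>2"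
    by (intro smooth_form1_bundleI; blast)+
qed

text \<open>The unknowns \<open>f\<close> and \<open>g\<close> are functions on the single tangent
  space at \<open>u\<close>: the equations differentiate only the tautological forms and can be
  solved point by point.\<close>

definition structure_eqs ::
    "'m coframe_point \<Rightarrow> (fibre_coords \<Rightarrow> real) \<Rightarrow> (fibre_coords \<Rightarrow> real) \<Rightarrow> real \<Rightarrow> real \<Rightarrow> bool" where
  "structure_eqs u f g t1 t2 \<longleftrightarrow> (\<forall>v w.
     ext_d \<Y> \<omega> u v w = wedge \<omega>1 \<omega>2 u v w + 2 * (f v * \<omega> u w - f w * \<omega> u v) \<and>
     ext_d \<Y> \<omega>1 u v w = (f v * \<omega>1 u w - f w * \<omega>1 u v) + 3 * (g v * \<omega>1 u w - g w * \<omega>1 u v) + t1 * wedge \<omega> \<omega>2 u v w \<and>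
     ext_d \<Y> \<omega>2 u v w = (f v * \<omega>2 u w - f w * \<omega>2 u v) - 3 * (g v * \<omega>2 u w - g w * \<omega>2 u v) - t2 * wedge \<omega> \<omega>1 u v w)"

definition coefficients ::
    "(fibre_coords \<Rightarrow> fibre_coords \<Rightarrow> real) \<Rightarrow> 'm coframe_point \<Rightarrow> real \<times> real \<times> real \<Rightarrow> bool" where
  "coefficients \<delta> u = (\<lambda>(p, q, r). \<forall>v w. \<delta> v w = p * wedge \<omega> \<omega>1 u v w + q * wedge \<omega> \<omega>2 u v w + r * wedge \<omega>1 \<omega>2 u v w)"

end

context bundle_trivialisation
begin

lemma fibredI: "u \<in> dom_of C \<Longrightarrow> coords C u \<in> F.fibred"
  using coords_C(1) by blast

lemma form_C:
  assumes "\<And>z v. z \<in> F.fibred \<Longrightarrow> local_form \<Y> C \<alpha> z v = \<beta> z v" "u \<in> dom_of C"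
  shows "\<alpha> u v = \<beta> (coords C u) (comps \<Y> C u v)"
  using Y.form_eq_local_form[OF C_in assms(2), of \<alpha> v] assms(1)[OF fibredI[OF assms(2)]] by simp

lemma local_form_C:
  assumes "\<And>u v. u \<in> dom_of C \<Longrightarrow> \<alpha> u v = \<beta> (coords C u) (comps \<Y> C u v)" "z \<in> F.fibred"
  shows "local_form \<Y> C \<alpha> z v = \<beta> z v"
  using assms(1)[OF param_C(2)[OF assms(2)]] Y.comps_tvec[OF C_in param_C(2)[OF assms(2)]]
  by (simp add: local_form_def param_C(3)[OF assms(2)])

lemma ext_d_C:
  assumes "smooth_form1 \<Y> Y \<alpha>" "\<And>z v. z \<in> F.fibred \<Longrightarrow> local_form \<Y> C \<alpha> z v = \<beta> z v" "u \<in> dom_of C"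
  shows "ext_d \<Y> \<alpha> u v w = d_local \<beta> (coords C u) (comps \<Y> C u v) (comps \<Y> C u w)"
proof -
  have u: "u \<in> Y" using assms(3) by (simp add: dom_bchart)
  have "ext_d \<Y> \<alpha> u v w = d_local (local_form \<Y> C \<alpha>) (coords C u) (comps \<Y> C u v) (comps \<Y> C u w)"
    by (rule Y.ext_d_chart[OF assms(1) bundle_open C_in u assms(3)])
  also have "\<dots> = d_local \<beta> (coords C u) (comps \<Y> C u v) (comps \<Y> C u w)"
    using Y.smooth_form1_local(1)[OF assms(1) C_in] unfolding coords_C(2)
    by (intro d_local_cong[OF F.open_fibred fibredI[OF assms(3)] assms(2)])
  finally show ?thesis .
qed

lemma taut_C:
  assumes "u \<in> dom_of C"
  shows "\<omega> u v = F.\<Omega>0 (coords C u) (comps \<Y> C u v)" "\<omega>1 u v = F.\<Omega>1 (coords C u) (comps \<Y> C u v)"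
    "\<omega>2 u v = F.\<Omega>2 (coords C u) (comps \<Y> C u v)"
  by (rule form_C[OF local_taut(1) assms] form_C[OF local_taut(2) assms] form_C[OF local_taut(3) assms]; assumption)+

lemma structure_eqs_C:
  assumes u: "u \<in> dom_of C"
  shows "structure_eqs u (\<lambda>v. F.\<Phi> (coords C u) (comps \<Y> C u v)) (\<lambda>v. F.K (coords C u) (comps \<Y> C u v))
    (F.torsion1 (coords C u)) (F.torsion2 (coords C u))"
proof -
  have d: "ext_d \<Y> \<omega> u v w = d_local F.\<Omega>0 (coords C u) (comps \<Y> C u v) (comps \<Y> C u w)"
    "ext_d \<Y> \<omega>1 u v w = d_local F.\<Omega>1 (coords C u) (comps \<Y> C u v) (comps \<Y> C u w)"
    "ext_d \<Y> \<omega>2 u v w = d_local F.\<Omega>2 (coords C u) (comps \<Y> C u v) (comps \<Y> C u w)" for v w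
    by (rule ext_d_C[OF smooth_taut(1) _ u] ext_d_C[OF smooth_taut(2) _ u] ext_d_C[OF smooth_taut(3) _ u];
      rule local_taut; assumption)+
  show ?thesis
    unfolding structure_eqs_def d F.fibred_structure[OF fibredI[OF u]] wedge_def taut_C[OF u] by blast
qed

end

section \<open>Uniqueness at a point and the global definitions\<close>

context enriched_manifold
begin

lemma dual_vectors:
  assumes "u \<in> Y"
  obtains E0 E1 E2 where "\<omega> u E0 = 1" "\<omega>1 u E0 = 0" "\<omega>2 u E0 = 0"
    "\<omega> u E1 = 0" "\<omega>1 u E1 = 1" "\<omega>2 u E1 = 0" "\<omega> u E2 = 0" "\<omega>1 u E2 = 0" "\<omega>2 u E2 = 1"
proof -
  obtain c U \<sigma> where t: "trivialisation c U \<sigma>" and d: "u \<in> dom_of (bchart c U \<sigma>)"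
    by (rule trivialisation_exists[OF assms])
  interpret B: bundle_trivialisation \<A> T1 T2 L c U \<sigma> by (rule t)
  obtain e0 e1 e2 where e: "B.F.\<Omega>0 (coords B.C u) e0 = 1" "B.F.\<Omega>1 (coords B.C u) e0 = 0" "B.F.\<Omega>2 (coords B.C u) e0 = 0"
    "B.F.\<Omega>0 (coords B.C u) e1 = 0" "B.F.\<Omega>1 (coords B.C u) e1 = 1" "B.F.\<Omega>2 (coords B.C u) e1 = 0"
    "B.F.\<Omega>0 (coords B.C u) e2 = 0" "B.F.\<Omega>1 (coords B.C u) e2 = 0" "B.F.\<Omega>2 (coords B.C u) e2 = 1"
    using B.F.fibred_solve[OF B.fibredI[OF d], of 1 0 0 0 0] B.F.fibred_solve[OF B.fibredI[OF d], of 0 1 0 0 0]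
      B.F.fibred_solve[OF B.fibredI[OF d], of 0 0 1 0 0] by blast
  show thesis
    by (rule that[of "tvec \<Y> B.C u e0" "tvec \<Y> B.C u e1" "tvec \<Y> B.C u e2"])
      (simp_all add: B.taut_C[OF d] Y.comps_tvec[OF B.C_in d] e)
qed

text \<open>The differences F and G of two solutions satisfy F \<and> \<omega> = 0 and, up to
  torsion terms, (F + 3 G) \<and> \<omega>1 = 0 and (F - 3 G) \<and> \<omega>2 = 0. Evaluation on
  the dual vectors removes the torsion and shows that F, F + 3 G and F - 3 G are multiples of
  \<omega>, \<omega>1 and \<omega>2. Since 2 F is the sum of the last two, all of them
  vanish.\<close>

lemma structure_eqs_unique:
  assumes u: "u \<in> Y" and s: "structure_eqs u f g t1 t2" and s': "structure_eqs u f' g' t1' t2'"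
  shows "f = f' \<and> g = g' \<and> t1 = t1' \<and> t2 = t2'"
proof -
  obtain E0 E1 E2 where E: "\<omega> u E0 = 1" "\<omega>1 u E0 = 0" "\<omega>2 u E0 = 0"
    "\<omega> u E1 = 0" "\<omega>1 u E1 = 1" "\<omega>2 u E1 = 0" "\<omega> u E2 = 0" "\<omega>1 u E2 = 0" "\<omega>2 u E2 = 1"
    by (rule dual_vectors[OF u])
  define F G where "F v = f v - f' v" and "G v = g v - g' v" for v
  have e0: "F v * \<omega> u w = F w * \<omega> u v"
    and e1: "(F v + 3 * G v) * \<omega>1 u w - (F w + 3 * G w) * \<omega>1 u v + (t1 - t1') * wedge \<omega> \<omega>2 u v w = 0"
    and e2: "(F v - 3 * G v) * \<omega>2 u w - (F w - 3 * G w) * \<omega>2 u v - (t2 - t2') * wedge \<omega> \<omega>1 u v w = 0" for v w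
  proof -
    note a = s[unfolded structure_eqs_def, rule_format, of v w] and b = s'[unfolded structure_eqs_def, rule_format, of v w]
    show "F v * \<omega> u w = F w * \<omega> u v"
      using conjunct1[OF a] conjunct1[OF b] by (simp add: F_def algebra_simps)
    show "(F v + 3 * G v) * \<omega>1 u w - (F w + 3 * G w) * \<omega>1 u v + (t1 - t1') * wedge \<omega> \<omega>2 u v w = 0"
      using conjunct1[OF conjunct2[OF a]] conjunct1[OF conjunct2[OF b]] by (simp add: F_def G_def algebra_simps)
    show "(F v - 3 * G v) * \<omega>2 u w - (F w - 3 * G w) * \<omega>2 u v - (t2 - t2') * wedge \<omega> \<omega>1 u v w = 0"
      using conjunct2[OF conjunct2[OF a]] conjunct2[OF conjunct2[OF b]] by (simp add: F_def G_def algebra_simps)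
  qed
  have 0: "F v = F E0 * \<omega> u v" for v using e0[of v E0] E by simp
  have 1: "F v + 3 * G v = 3 * G E1 * \<omega>1 u v" for v using e1[of v E1] 0[of E1] E by (simp add: wedge_def)
  have 2: "F v - 3 * G v = - 3 * G E2 * \<omega>2 u v" for v using e2[of v E2] 0[of E2] E by (simp add: wedge_def)
  have "F E0 = 0" using 1[of E0] 2[of E0] E by simp
  then have F: "F v = 0" for v using 0[of v] by simp
  have "G E1 = 0" using 2[of E1] F[of E1] E by simp
  then have G: "G v = 0" for v using 1[of v] F[of v] by simp
  have "t1 = t1'" "t2 = t2'" using e1[of E0 E2] e2[of E0 E1] F G E by (simp_all add: wedge_def)
  moreover have "f = f'" "g = g'" using F G by (auto simp: F_def G_def)
  ultimately show ?thesis by simp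
qed

lemma coefficients_unique:
  assumes u: "u \<in> Y" and "coefficients \<delta> u t" "coefficients \<delta> u t'"
  shows "t = t'"
proof -
  obtain E0 E1 E2 where E: "\<omega> u E0 = 1" "\<omega>1 u E0 = 0" "\<omega>2 u E0 = 0"
    "\<omega> u E1 = 0" "\<omega>1 u E1 = 1" "\<omega>2 u E1 = 0" "\<omega> u E2 = 0" "\<omega>1 u E2 = 0" "\<omega>2 u E2 = 1"
    by (rule dual_vectors[OF u])
  have "t = (\<delta> E0 E1, \<delta> E0 E2, \<delta> E1 E2)" if t: "coefficients \<delta> u t" for t
  proof -
    obtain p q r where pqr: "t = (p, q, r)" by (cases t)
    have "\<delta> v w = p * wedge \<omega> \<omega>1 u v w + q * wedge \<omega> \<omega>2 u v w + r * wedge \<omega>1 \<omega>2 u v w" for v w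
      using t unfolding pqr coefficients_def prod.case by blast
    then show ?thesis using E by (simp add: pqr wedge_def)
  qed
  then show ?thesis using assms by metis
qed

definition connection_data :: "'m coframe_point \<Rightarrow>
    (fibre_coords \<Rightarrow> real) \<times> (fibre_coords \<Rightarrow> real) \<times> real \<times> real" where
  "connection_data u = (THE d. case d of (f, g, t1, t2) \<Rightarrow> structure_eqs u f g t1 t2)"

definition \<phi> :: "'m coframe_point \<Rightarrow> fibre_coords \<Rightarrow> real" where
  "\<phi> u = fst (connection_data u)"
definition \<kappa> :: "'m coframe_point \<Rightarrow> fibre_coords \<Rightarrow> real" where
  "\<kappa> u = fst (snd (connection_data u))"
definition \<tau>1 :: "'m coframe_point \<Rightarrow> real" where "\<tau>1 u = fst (snd (snd (connection_data u)))"
definition \<tau>2 :: "'m coframe_point \<Rightarrow> real" where "\<tau>2 u = snd (snd (snd (connection_data u)))"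

text \<open>The components along \<omega> \<and> \<omega>1, \<omega> \<and> \<omega>2 and \<omega>1
  \<and> \<omega>2; the third one turns out to be 0.\<close>

definition d\<phi>_coefs :: "'m coframe_point \<Rightarrow> real \<times> real \<times> real" where
  "d\<phi>_coefs u = (THE t. coefficients (ext_d \<Y> \<phi> u) u t)"
definition d\<kappa>_coefs :: "'m coframe_point \<Rightarrow> real \<times> real \<times> real" where
  "d\<kappa>_coefs u = (THE t. coefficients (ext_d \<Y> \<kappa> u) u t)"

lemma connection_data_eq:
  assumes "u \<in> Y" "structure_eqs u f g t1 t2"
  shows "\<phi> u = f" "\<kappa> u = g" "\<tau>1 u = t1" "\<tau>2 u = t2"
proof -
  have "connection_data u = (f, g, t1, t2)"
    unfolding connection_data_def
  proof (rule the_equality)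
    show "case (f, g, t1, t2) of (f, g, t1, t2) \<Rightarrow> structure_eqs u f g t1 t2" using assms(2) by simp
    fix d assume d: "case d of (f, g, t1, t2) \<Rightarrow> structure_eqs u f g t1 t2"
    obtain f' g' t1' t2' where d': "d = (f', g', t1', t2')" by (metis surj_pair)
    show "d = (f, g, t1, t2)"
      using structure_eqs_unique[OF assms(1) d[unfolded d' prod.case] assms(2)] d' by simp
  qed
  then show "\<phi> u = f" "\<kappa> u = g" "\<tau>1 u = t1" "\<tau>2 u = t2" by (simp_all add: \<phi>_def \<kappa>_def \<tau>1_def \<tau>2_def)
qed

end

section \<open>The solution in a trivialisation, and its smoothness\<close>

context bundle_trivialisation
begin

lemma connection_C:
  assumes u: "u \<in> dom_of C"
  shows "\<phi> u v = F.\<Phi> (coords C u) (comps \<Y> C u v)" "\<kappa> u v = F.K (coords C u) (comps \<Y> C u v)"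
    "\<tau>1 u = F.torsion1 (coords C u)" "\<tau>2 u = F.torsion2 (coords C u)"
proof -
  have "u \<in> Y" using u by (simp add: dom_bchart)
  from connection_data_eq[OF this structure_eqs_C[OF u]]
  show "\<phi> u v = F.\<Phi> (coords C u) (comps \<Y> C u v)" "\<kappa> u v = F.K (coords C u) (comps \<Y> C u v)"
    "\<tau>1 u = F.torsion1 (coords C u)" "\<tau>2 u = F.torsion2 (coords C u)" by simp_all
qed

lemma local_connection:
  assumes "z \<in> F.fibred"
  shows "local_form \<Y> C \<phi> z v = F.\<Phi> z v" "local_form \<Y> C \<kappa> z v = F.K z v"
  by (rule local_form_C[OF _ assms]; simp add: connection_C)+

end

context enriched_manifold
begin

lemma smooth_connection: "smooth_form1 \<Y> Y \<phi>" "smooth_form1 \<Y> Y \<kappa>"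
proof -
  have "\<exists>\<beta>. local_expression \<alpha> c U \<sigma> \<beta>"
    if t: "trivialisation c U \<sigma>" and "\<alpha> \<in> {\<phi>, \<kappa>}" for c U \<sigma> \<alpha>
  proof -
    interpret B: bundle_trivialisation \<A> T1 T2 L c U \<sigma> by (rule t)
    show ?thesis
      using that(2) B.local_connection B.F.linear_fibred_forms B.F.smooth_fibred_forms
      unfolding local_expression_def B.F.fibred_def[symmetric] by blast
  qed
  then show "smooth_form1 \<Y> Y \<phi>" "smooth_form1 \<Y> Y \<kappa>"
    by (intro smooth_form1_bundleI; blast)+
qed

lemma structure_eqs_connection:
  assumes u: "u \<in> Y"
  shows "structure_eqs u (\<phi> u) (\<kappa> u) (\<tau>1 u) (\<tau>2 u)"
proof -
  obtain c U \<sigma> where t: "trivialisation c U \<sigma>" and d: "u \<in> dom_of (bchart c U \<sigma>)"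
    by (rule trivialisation_exists[OF u])
  interpret B: bundle_trivialisation \<A> T1 T2 L c U \<sigma> by (rule t)
  show ?thesis using connection_data_eq[OF u B.structure_eqs_C[OF d]] B.structure_eqs_C[OF d] by simp
qed

end

context bundle_trivialisation
begin

text \<open>The 0 for \<open>\<phi>\<close> goes back to \<open>T_\<phi>\<close> on the base; it is
  what allows d\<phi> to be written as \<omega> \<and> \<psi>.\<close>

lemma d_connection_C:
  assumes u: "u \<in> dom_of C"
  shows "coefficients (ext_d \<Y> \<phi> u) u (F.coef_A (coords C u), F.coef_B (coords C u), 0)"
    "coefficients (ext_d \<Y> \<kappa> u) u (F.coef_C (coords C u), F.coef_D (coords C u), F.coef_S (coords C u))"
proof -
  have d: "ext_d \<Y> \<phi> u v w = d_local F.\<Phi> (coords C u) (comps \<Y> C u v) (comps \<Y> C u w)"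
    "ext_d \<Y> \<kappa> u v w = d_local F.K (coords C u) (comps \<Y> C u v) (comps \<Y> C u w)" for v w
    by (rule ext_d_C[OF smooth_connection(1) _ u] ext_d_C[OF smooth_connection(2) _ u];
      rule local_connection; assumption)+
  show "coefficients (ext_d \<Y> \<phi> u) u (F.coef_A (coords C u), F.coef_B (coords C u), 0)"
    "coefficients (ext_d \<Y> \<kappa> u) u (F.coef_C (coords C u), F.coef_D (coords C u), F.coef_S (coords C u))"
    unfolding coefficients_def prod.case d F.fibred_structure[OF fibredI[OF u]] wedge_def taut_C[OF u]
    by simp_all
qed

lemma coefs_C:
  assumes u: "u \<in> dom_of C"
  shows "d\<phi>_coefs u = (F.coef_A (coords C u), F.coef_B (coords C u), 0)"
    "d\<kappa>_coefs u = (F.coef_C (coords C u), F.coef_D (coords C u), F.coef_S (coords C u))"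
proof -
  have "u \<in> Y" using u by (simp add: dom_bchart)
  then show "d\<phi>_coefs u = (F.coef_A (coords C u), F.coef_B (coords C u), 0)"
    "d\<kappa>_coefs u = (F.coef_C (coords C u), F.coef_D (coords C u), F.coef_S (coords C u))"
    unfolding d\<phi>_coefs_def d\<kappa>_coefs_def using d_connection_C[OF u] coefficients_unique
    by (metis (no_types, lifting) the_equality)+
qed

end

context enriched_manifold
begin

lemma d_connection:
  assumes u: "u \<in> Y"
  shows "ext_d \<Y> \<phi> u v w = fst (d\<phi>_coefs u) * wedge \<omega> \<omega>1 u v w + fst (snd (d\<phi>_coefs u)) * wedge \<omega> \<omega>2 u v w"
    "ext_d \<Y> \<kappa> u v w = fst (d\<kappa>_coefs u) * wedge \<omega> \<omega>1 u v w + fst (snd (d\<kappa>_coefs u)) * wedge \<omega> \<omega>2 u v w +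
      snd (snd (d\<kappa>_coefs u)) * wedge \<omega>1 \<omega>2 u v w"
proof -
  obtain c U \<sigma> where t: "trivialisation c U \<sigma>" and d: "u \<in> dom_of (bchart c U \<sigma>)"
    by (rule trivialisation_exists[OF u])
  interpret B: bundle_trivialisation \<A> T1 T2 L c U \<sigma> by (rule t)
  show "ext_d \<Y> \<phi> u v w = fst (d\<phi>_coefs u) * wedge \<omega> \<omega>1 u v w + fst (snd (d\<phi>_coefs u)) * wedge \<omega> \<omega>2 u v w"
    "ext_d \<Y> \<kappa> u v w = fst (d\<kappa>_coefs u) * wedge \<omega> \<omega>1 u v w + fst (snd (d\<kappa>_coefs u)) * wedge \<omega> \<omega>2 u v w +
      snd (snd (d\<kappa>_coefs u)) * wedge \<omega>1 \<omega>2 u v w"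
    using B.d_connection_C(1)[OF d, unfolded coefficients_def prod.case, rule_format, of v w]
      B.d_connection_C(2)[OF d, unfolded coefficients_def prod.case, rule_format, of v w]
    by (simp_all add: B.coefs_C[OF d])
qed

lemma smooth_coefficients:
  assumes "f \<in> {\<lambda>u. fst (d\<phi>_coefs u), \<lambda>u. fst (snd (d\<phi>_coefs u)), \<lambda>u. fst (d\<kappa>_coefs u),
    \<lambda>u. fst (snd (d\<kappa>_coefs u)), \<lambda>u. snd (snd (d\<kappa>_coefs u)), \<tau>1, \<tau>2}"
  shows "smooth_fun \<Y> Y f"
proof (rule smooth_fun_bundleI)
  fix c U \<sigma> assume t: "trivialisation c U \<sigma>"
  interpret B: bundle_trivialisation \<A> T1 T2 L c U \<sigma> by (rule t)
  have "\<exists>g \<in> {B.F.coef_A, B.F.coef_B, B.F.coef_C, B.F.coef_D, B.F.coef_S, B.F.torsion1, B.F.torsion2}.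
      \<forall>u \<in> dom_of B.C. f u = g (coords B.C u)"
    using assms by (auto simp: B.coefs_C B.connection_C)
  then show "\<exists>g. smooth_on (over c U) g \<and> (\<forall>u \<in> dom_of B.C. f u = g (coords B.C u))"
    using B.F.smooth_coefs unfolding B.F.fibred_def[symmetric] by blast
qed

end

section \<open>Curvature of a form of the prescribed shape\<close>

context enriched_manifold
begin

text \<open>Stated for arbitrary diagonal forms \<open>f\<close> and \<open>g\<close> because it
  serves both existence and uniqueness.\<close>

lemma curvature_bmat:
  assumes \<pi>: "smooth_form1 \<Y> Y \<pi>" and f: "smooth_form1 \<Y> Y f" and g: "smooth_form1 \<Y> Y g"
    and \<pi>_eq: "\<forall>u\<in>Y. \<forall>v. \<pi> u v = bmat (f u v) (g u v) (\<omega> u v) (\<omega>1 u v) (\<omega>2 u v)"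
    and u: "u \<in> Y"
  shows "curvature \<Y> \<pi> u v w = mat3
     (ext_d \<Y> f u v w + ext_d \<Y> g u v w) 0 0
     (ext_d \<Y> \<omega>1 u v w - wedge f \<omega>1 u v w - 3 * wedge g \<omega>1 u v w) (- 2 * ext_d \<Y> g u v w) 0
     (ext_d \<Y> \<omega> u v w - wedge \<omega>1 \<omega>2 u v w - 2 * wedge f \<omega> u v w)
     (ext_d \<Y> \<omega>2 u v w - wedge f \<omega>2 u v w + 3 * wedge g \<omega>2 u v w)
     (- ext_d \<Y> f u v w + ext_d \<Y> g u v w)"
proof -
  note eq = \<pi>_eq[rule_format]
  have up: "u \<in> points \<Y>" using u points_bundle by simp
  \<comment> \<open>A fixed linear functional of the matrix commutes with d. Half the difference and
    half the sum of the outer diagonal entries recover \<open>f\<close> and \<open>g\<close>; the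
    entries above the diagonal and the trace give the zero form.\<close>
  have h: "h (ext_d \<Y> \<pi> u v w) = ext_d \<Y> \<alpha> u v w"
    if "linear h" "smooth_form1 \<Y> Y \<alpha>" "\<And>q v. q \<in> Y \<Longrightarrow> \<alpha> q v = h (\<pi> q v)" for h :: "real^3^3 \<Rightarrow> real" and \<alpha>
    using Y.ext_d_bounded_linear[OF \<pi> u up, of h] Y.ext_d_cong[OF that(2) bundle_open u up, of "\<lambda>p v. h (\<pi> p v)"]
      that(1,3) by (simp add: linear_conv_bounded_linear)
  have z: "smooth_form1 \<Y> Y (\<lambda>p v. 0 :: real)"
    by (auto simp: smooth_form1_def local_form_def smooth_on_const linear_0 intro!: linearI)
  let ?P = "ext_d \<Y> \<pi> u v w"
  have "(?P $ 1 $ 1 - ?P $ 3 $ 3) / 2 = ext_d \<Y> f u v w"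
    by (rule h[OF _ f]) (auto intro!: linearI simp: eq bmat_def field_simps)
  moreover have "(?P $ 1 $ 1 + ?P $ 3 $ 3) / 2 = ext_d \<Y> g u v w"
    by (rule h[OF _ g]) (auto intro!: linearI simp: eq bmat_def field_simps)
  ultimately have "?P $ 1 $ 1 = ext_d \<Y> f u v w + ext_d \<Y> g u v w" "?P $ 3 $ 3 = - ext_d \<Y> f u v w + ext_d \<Y> g u v w"
    by (simp_all add: field_simps)
  moreover have "?P $ 2 $ 2 + ?P $ 1 $ 1 + ?P $ 3 $ 3 = ext_d \<Y> (\<lambda>p v. 0) u v w"
    by (rule h[OF _ z]) (auto intro!: linearI simp: eq bmat_def algebra_simps)
  moreover have "?P $ 1 $ 2 = ext_d \<Y> (\<lambda>p v. 0) u v w" "?P $ 1 $ 3 = ext_d \<Y> (\<lambda>p v. 0) u v w"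
    "?P $ 2 $ 3 = ext_d \<Y> (\<lambda>p v. 0) u v w"
    by (rule h[OF _ z]; auto intro!: linearI simp: eq bmat_def)+
  moreover have "?P $ 3 $ 1 = ext_d \<Y> \<omega> u v w"
    by (rule h[OF _ smooth_taut(1)]) (auto intro!: linearI simp: eq bmat_def)
  moreover have "?P $ 2 $ 1 = ext_d \<Y> \<omega>1 u v w"
    by (rule h[OF _ smooth_taut(2)]) (auto intro!: linearI simp: eq bmat_def)
  moreover have "?P $ 3 $ 2 = ext_d \<Y> \<omega>2 u v w"
    by (rule h[OF _ smooth_taut(3)]) (auto intro!: linearI simp: eq bmat_def)
  ultimately show ?thesis
    unfolding curvature_def matrix_wedge_def eq[OF u]
    by (intro mat3_eqI) (simp_all add: ext_d_zero matrix_matrix_mult_def sum_3 bmat_def wedge_def algebra_simps)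
qed

text \<open>The restriction to \<open>Y\<close> is there because uniqueness is asserted among
  extensional functions.\<close>

definition connection :: "'m coframe_point \<Rightarrow> fibre_coords \<Rightarrow> real^3^3" where
  "connection = restrict (\<lambda>u v. bmat (\<phi> u v) (\<kappa> u v) (\<omega> u v) (\<omega>1 u v) (\<omega>2 u v)) Y"

lemma connection_eq: "u \<in> Y \<Longrightarrow> connection u v = bmat (\<phi> u v) (\<kappa> u v) (\<omega> u v) (\<omega>1 u v) (\<omega>2 u v)"
  by (simp add: connection_def)

end

section \<open>The right action in a trivialisation\<close>

context bundle_trivialisation
begin

lemma connection_bmat_C:
  assumes u: "u \<in> dom_of C"
  shows "connection u v = bmat (F.\<Phi> (coords C u) (comps \<Y> C u v)) (F.K (coords C u) (comps \<Y> C u v))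
    (F.\<Omega>0 (coords C u) (comps \<Y> C u v)) (F.\<Omega>1 (coords C u) (comps \<Y> C u v)) (F.\<Omega>2 (coords C u) (comps \<Y> C u v))"
  using u connection_eq[of u v] connection_C[OF u] taut_C[OF u] by (simp add: dom_bchart)

lemma dom_C_cases:
  assumes "u \<in> dom_of C"
  obtains x a b where "x \<in> U" "a \<noteq> 0" "b \<noteq> 0" "u = (x, fibre_point (\<sigma> x) (a, b))" "coords C u = (coords c x, a, b)"
proof -
  have "u \<in> Y" "fst u \<in> U" using assms by (simp_all add: dom_bchart)
  then obtain x a b where "x \<in> U" "a \<noteq> 0" "b \<noteq> 0" "u = (x, fibre_point (\<sigma> x) (a, b))"
    using bchart_cases[OF data] by blast
  then show thesis using that coords_bchart[OF data] by blast
qed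

lemma right_act_C:
  assumes u: "u \<in> dom_of C" and h: "p \<noteq> 0" "q \<noteq> 0"
  shows "right_act (diag3 p d q) u \<in> dom_of C"
    "coords C (right_act (diag3 p d q) u) =
      (fst (coords C u), p * fst (snd (coords C u)), q * snd (snd (coords C u)))"
proof -
  obtain x a b where x: "x \<in> U" "a \<noteq> 0" "b \<noteq> 0" "u = (x, fibre_point (\<sigma> x) (a, b))" "coords C u = (coords c x, a, b)"
    by (rule dom_C_cases[OF u])
  have r: "right_act (diag3 p d q) u = (x, fibre_point (\<sigma> x) (p * a, q * b))"
    using fibre_point_compose(1)[OF x(2,3) h] by (simp add: right_act_def x(4))
  show "right_act (diag3 p d q) u \<in> dom_of C"
    unfolding r using fibre_point_in[OF data x(1)] x h by (simp add: dom_bchart)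
  show "coords C (right_act (diag3 p d q) u) =
      (fst (coords C u), p * fst (snd (coords C u)), q * snd (snd (coords C u)))"
    unfolding r x(5) using coords_bchart[OF data x(1)] x h by simp
qed

lemma tangent_map_right_act:
  assumes u: "u \<in> dom_of C" and h: "p \<noteq> 0" "q \<noteq> 0"
  shows "comps \<Y> C (right_act (diag3 p d q) u) (tangent_map \<Y> \<Y> (right_act (diag3 p d q)) u v) =
    (fst (comps \<Y> C u v), p * fst (snd (comps \<Y> C u v)), q * snd (snd (comps \<Y> C u v)))"
proof -
  let ?h = "right_act (diag3 p d q) :: 'a coframe_point \<Rightarrow> 'a coframe_point"
  let ?F = "\<lambda>z :: fibre_coords. (fst z, p * fst (snd z), q * snd (snd z))"
  note r = right_act_C[OF _ h]
  have "tangent_map \<Y> \<Y> ?h u (tvec \<Y> C u (comps \<Y> C u v)) = tvec \<Y> C (?h u) (?F (comps \<Y> C u v))"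
  proof (rule tangent_map_tvec[where f = ?h and F = ?F, OF Y.manifold_atlas_axioms Y.manifold_atlas_axioms C_in u C_in r(1)[OF u] F.open_fibred fibredI[OF u]])
    show "F.fibred \<subseteq> coords C ` dom_of C" by (simp add: coords_C)
    show "?h (param C y) \<in> dom_of C" if "y \<in> F.fibred" for y by (rule r(1)[OF param_C(2)[OF that]])
    have "(?F has_derivative ?F) (at (coords C u))"
      by (auto intro!: derivative_eq_intros)
    then show "((coords C \<circ> ?h \<circ> param C) has_derivative ?F) (at (coords C u))"
      by (rule has_derivative_transform_within_open[OF _ F.open_fibred fibredI[OF u]])
        (simp add: r(2)[OF param_C(2)] param_C(3))
  qed
  then show ?thesis
    by (simp only: Y.tvec_comps[OF C_in u] Y.comps_tvec[OF C_in r(1)[OF u]])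
qed

end

section \<open>The Cartan axioms, the curvature and uniqueness\<close>

context enriched_manifold
begin

lemma smooth_connection_form: "smooth_form1 \<Y> Y connection"
proof (rule smooth_form1_bundleI)
  fix c U \<sigma> assume t: "trivialisation c U \<sigma>"
  interpret B: bundle_trivialisation \<A> T1 T2 L c U \<sigma> by (rule t)
  show "\<exists>\<beta>. local_expression connection c U \<sigma> \<beta>"
    unfolding local_expression_def B.F.fibred_def[symmetric]
  proof (intro exI ballI conjI allI)
    fix z v assume z: "z \<in> B.F.fibred"
    show "local_form \<Y> B.C connection z v = bmat (B.F.\<Phi> z v) (B.F.K z v) (B.F.\<Omega>0 z v) (B.F.\<Omega>1 z v) (B.F.\<Omega>2 z v)"
      by (rule B.local_form_C[where \<alpha> = connection and \<beta> = "\<lambda>z v. bmat (B.F.\<Phi> z v) (B.F.K z v) (B.F.\<Omega>0 z v) (B.F.\<Omega>1 z v) (B.F.\<Omega>2 z v)",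
            OF B.connection_bmat_C z])
    show "linear (\<lambda>v. bmat (B.F.\<Phi> z v) (B.F.K z v) (B.F.\<Omega>0 z v) (B.F.\<Omega>1 z v) (B.F.\<Omega>2 z v))"
      by (intro linear_bmat B.F.linear_fibred_forms z)
    show "smooth_on B.F.fibred (\<lambda>z. bmat (B.F.\<Phi> z v) (B.F.K z v) (B.F.\<Omega>0 z v) (B.F.\<Omega>1 z v) (B.F.\<Omega>2 z v))"
      by (intro smooth_bmat B.F.open_fibred B.F.smooth_fibred_forms)
  qed
qed

lemma connection_bij:
  assumes u: "u \<in> Y"
  shows "bij_betw (connection u) UNIV lie_b"
proof -
  obtain c U \<sigma> where t: "trivialisation c U \<sigma>" and d: "u \<in> dom_of (bchart c U \<sigma>)"
    by (rule trivialisation_exists[OF u])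
  interpret B: bundle_trivialisation \<A> T1 T2 L c U \<sigma> by (rule t)
  note z = B.fibredI[OF d]
  show ?thesis
    unfolding bij_betw_def
  proof (intro conjI injI equalityI subsetI)
    fix v w assume "connection u v = connection u w"
    then have "comps \<Y> B.C u v = comps \<Y> B.C u w"
      unfolding B.connection_bmat_C[OF d] bmat_inject using B.F.fibred_solve[OF z] by metis
    then show "v = w" using Y.tvec_comps[OF B.C_in d] by metis
  next
    fix X assume "X \<in> lie_b"
    then obtain f g x0 x1 x2 where X: "X = bmat f g x0 x1 x2" by (auto simp: lie_b_bmat)
    obtain v where v: "B.F.\<Omega>0 (coords B.C u) v = x0 \<and> B.F.\<Omega>1 (coords B.C u) v = x1 \<and> B.F.\<Omega>2 (coords B.C u) v = x2 \<and>
        B.F.\<Phi> (coords B.C u) v = f \<and> B.F.K (coords B.C u) v = g"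
      using B.F.fibred_solve[OF z] by blast
    have "connection u (tvec \<Y> B.C u v) = X"
      using v unfolding B.connection_bmat_C[OF d] Y.comps_tvec[OF B.C_in d] X by simp
    then show "X \<in> range (connection u)" by blast
  next
    fix X assume "X \<in> range (connection u)"
    then show "X \<in> lie_b" unfolding lie_b_bmat using connection_eq[OF u] by blast
  qed
qed

lemma connection_equivariant:
  assumes h: "h \<in> P2" and u: "u \<in> Y"
  shows "connection (right_act h u) (tangent_map \<Y> \<Y> (right_act h) u v) = matrix_inv h ** connection u v ** h"
proof -
  obtain p d q where p: "p \<noteq> 0" "q \<noteq> 0" "h = diag3 p d q" "d = 1 / (p * q)" by (rule P2_cases[OF h])
  obtain c U \<sigma> where t: "trivialisation c U \<sigma>" and du: "u \<in> dom_of (bchart c U \<sigma>)"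
    by (rule trivialisation_exists[OF u])
  interpret B: bundle_trivialisation \<A> T1 T2 L c U \<sigma> by (rule t)
  obtain y a b where z: "coords B.C u = (y, a, b)" by (metis surj_pair)
  obtain w s r where v: "comps \<Y> B.C u v = (w, s, r)" by (metis surj_pair)
  show ?thesis
    unfolding p(3) B.connection_bmat_C[OF B.right_act_C(1)[OF du p(1,2)]] B.connection_bmat_C[OF du]
      B.tangent_map_right_act[OF du p(1,2)] B.right_act_C(2)[OF du p(1,2)] z v fst_conv snd_conv
      B.F.fibred_scale[OF p(1,2)]
    unfolding p(4) diag3_inverse[OF p(1,2)] bmat_conjugate[OF p(1,2)] ..
qed

lemma connection_fundamental:
  assumes X: "X \<in> lie_P2" and u: "u \<in> Y"
  shows "connection u (fundamental_field \<Y> X u) = X"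
proof -
  obtain s r where Xs: "X = diag3 s (- (s + r)) r" using X by (auto simp: lie_P2_def)
  \<comment> \<open>The trivialisation is taken to be the preferred chart at u, in which the
    velocity of the orbit is recorded.\<close>
  obtain c U \<sigma> where t: "trivialisation c U \<sigma>" and d: "u \<in> dom_of (bchart c U \<sigma>)"
    and C: "chart_at \<Y> u = bchart c U \<sigma>"
    by (rule trivialisation_exists[OF u])
  interpret B: bundle_trivialisation \<A> T1 T2 L c U \<sigma> by (rule t)
  obtain y a b where z: "coords B.C u = (y, a, b)" by (metis surj_pair)
  have nz: "y \<in> coords c ` U" "a \<noteq> 0" "b \<noteq> 0" using B.F.fibredD[OF B.fibredI[OF d]] by (simp_all add: z)
  have op: "one_param X k = diag3 (exp (k * s)) (exp (k * - (s + r))) (exp (k * r))" for k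
    by (simp add: one_param_def Xs diag3_def)
  have path: "coords B.C (right_act (one_param X k) u) = (y, exp (k * s) * a, exp (k * r) * b)" for k
    unfolding op by (simp add: B.right_act_C(2)[OF d] z)
  \<comment> \<open>\<open>velocity\<close> uses the preferred chart at the position of the curve,
    so the curve has to be shown to start at u.\<close>
  have "coords B.C (right_act (one_param X 0) u) = coords B.C u" unfolding path z by simp
  moreover have "right_act (one_param X 0) u \<in> dom_of B.C" unfolding op by (rule B.right_act_C(1)[OF d]) simp_all
  ultimately have u0: "right_act (one_param X 0) u = u"
    using Y.inj_coords[OF B.C_in] d by (auto dest: inj_onD)
  have "((\<lambda>k. (y, exp (k * s) * a, exp (k * r) * b)) has_vector_derivative (0, s * a, r * b)) (at 0)"
    unfolding has_vector_derivative_def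
    by (auto intro!: derivative_eq_intros simp: fun_eq_iff algebra_simps)
  then have "vector_derivative (coords B.C \<circ> (\<lambda>k. right_act (one_param X k) u)) (at 0) = (0, s * a, r * b)"
    unfolding comp_def path by (rule vector_derivative_at)
  then have "fundamental_field \<Y> X u = (0, s * a, r * b)"
    unfolding fundamental_field_def velocity_def u0 C .
  moreover have "comps \<Y> B.C u v = v" for v
    using Y.comps_chart_at[of u v] u points_bundle C by simp
  ultimately have "connection u (fundamental_field \<Y> X u) =
     bmat (B.F.\<Phi> (y, a, b) (0, s * a, r * b)) (B.F.K (y, a, b) (0, s * a, r * b)) (B.F.\<Omega>0 (y, a, b) (0, s * a, r * b))
       (B.F.\<Omega>1 (y, a, b) (0, s * a, r * b)) (B.F.\<Omega>2 (y, a, b) (0, s * a, r * b))"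
    unfolding B.connection_bmat_C[OF d] z by simp
  \<comment> \<open>The base component of the vector is 0, so only the fibre parts remain, with da/a
    = s and db/b = r.\<close>
  also have "\<dots> = bmat ((s - r) / 2) ((s + r) / 2) 0 0 0"
    using nz linear_0[OF B.F.linear_coframe(1)[OF nz(1)]] linear_0[OF B.F.linear_coframe(2)[OF nz(1)]]
      linear_0[OF B.F.linear_coframe(3)[OF nz(1)]] linear_0[OF B.F.linear_\<phi>[OF nz(1)]] linear_0[OF B.F.linear_\<kappa>[OF nz(1)]]
    by (simp add: B.F.\<Phi>_def B.F.K_def B.F.\<Omega>0_def B.F.\<Omega>1_def B.F.\<Omega>2_def)
  also have "\<dots> = X"
    unfolding Xs by (rule mat3_eqI) (simp_all add: bmat_def diag3_def field_simps)
  finally show ?thesis .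
qed

lemma cartan_connection: "cartan_connection \<Y> Y connection"
  unfolding cartan_connection_def
  using smooth_connection_form connection_bij connection_equivariant connection_fundamental by blast

lemma curvature_connection:
  assumes u: "u \<in> Y"
  shows "curvature \<Y> connection u v w = mat3
     (wedge \<omega> (\<lambda>u v. fst (d\<phi>_coefs u) * \<omega>1 u v + fst (snd (d\<phi>_coefs u)) * \<omega>2 u v) u v w +
       (fst (d\<kappa>_coefs u) * wedge \<omega> \<omega>1 u v w + fst (snd (d\<kappa>_coefs u)) * wedge \<omega> \<omega>2 u v w +
        snd (snd (d\<kappa>_coefs u)) * wedge \<omega>1 \<omega>2 u v w)) 0 0
     (\<tau>1 u * wedge \<omega> \<omega>2 u v w)
     (- 2 * (fst (d\<kappa>_coefs u) * wedge \<omega> \<omega>1 u v w + fst (snd (d\<kappa>_coefs u)) * wedge \<omega> \<omega>2 u v w +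
        snd (snd (d\<kappa>_coefs u)) * wedge \<omega>1 \<omega>2 u v w)) 0
     0 (- \<tau>2 u * wedge \<omega> \<omega>1 u v w)
     (- wedge \<omega> (\<lambda>u v. fst (d\<phi>_coefs u) * \<omega>1 u v + fst (snd (d\<phi>_coefs u)) * \<omega>2 u v) u v w +
       (fst (d\<kappa>_coefs u) * wedge \<omega> \<omega>1 u v w + fst (snd (d\<kappa>_coefs u)) * wedge \<omega> \<omega>2 u v w +
        snd (snd (d\<kappa>_coefs u)) * wedge \<omega>1 \<omega>2 u v w))"
proof -
  have s: "ext_d \<Y> \<omega> u v w = wedge \<omega>1 \<omega>2 u v w + 2 * wedge \<phi> \<omega> u v w"
    "ext_d \<Y> \<omega>1 u v w = wedge \<phi> \<omega>1 u v w + 3 * wedge \<kappa> \<omega>1 u v w + \<tau>1 u * wedge \<omega> \<omega>2 u v w"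
    "ext_d \<Y> \<omega>2 u v w = wedge \<phi> \<omega>2 u v w - 3 * wedge \<kappa> \<omega>2 u v w - \<tau>2 u * wedge \<omega> \<omega>1 u v w"
    using structure_eqs_connection[OF u, unfolded structure_eqs_def, rule_format, of v w]
    unfolding wedge_def[of \<phi>] wedge_def[of \<kappa>] by simp_all
  have eq: "\<forall>u\<in>Y. \<forall>v. connection u v = bmat (\<phi> u v) (\<kappa> u v) (\<omega> u v) (\<omega>1 u v) (\<omega>2 u v)"
    by (simp add: connection_eq)
  have \<psi>: "wedge \<omega> (\<lambda>u v. p u * \<omega>1 u v + q u * \<omega>2 u v) u v w = p u * wedge \<omega> \<omega>1 u v w + q u * wedge \<omega> \<omega>2 u v w" for p q
    by (simp add: wedge_def algebra_simps)
  show ?thesis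
    unfolding curvature_bmat[OF smooth_connection_form smooth_connection eq u] s d_connection[OF u] \<psi>
    by simp
qed

text \<open>Inserting \<open>curvature_bmat\<close> turns the conditions on the curvature into
  \<open>structure_eqs\<close>, whose only solution is \<open>connection_data\<close>.\<close>

lemma connection_unique:
  assumes ext: "\<pi> \<in> extensional Y" and \<pi>: "smooth_form1 \<Y> Y \<pi>" and f: "smooth_form1 \<Y> Y f" and g: "smooth_form1 \<Y> Y g"
    and eq: "\<forall>u\<in>Y. \<forall>v. \<pi> u v = bmat (f u v) (g u v) (\<omega> u v) (\<omega>1 u v) (\<omega>2 u v)"
    and curv: "\<And>u v w. u \<in> Y \<Longrightarrow> curvature \<Y> \<pi> u v w $ 2 $ 1 = t1 u * wedge \<omega> \<omega>2 u v w \<and>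
      curvature \<Y> \<pi> u v w $ 3 $ 1 = 0 \<and> curvature \<Y> \<pi> u v w $ 3 $ 2 = - t2 u * wedge \<omega> \<omega>1 u v w"
  shows "\<pi> = connection"
proof (rule extensionalityI[OF ext])
  show "connection \<in> extensional Y" by (simp add: connection_def)
  fix u assume u: "u \<in> Y"
  have "structure_eqs u (f u) (g u) (t1 u) (t2 u)"
    unfolding structure_eqs_def
  proof (intro allI)
    fix v w
    show "ext_d \<Y> \<omega> u v w = wedge \<omega>1 \<omega>2 u v w + 2 * (f u v * \<omega> u w - f u w * \<omega> u v) \<and>
     ext_d \<Y> \<omega>1 u v w = (f u v * \<omega>1 u w - f u w * \<omega>1 u v) + 3 * (g u v * \<omega>1 u w - g u w * \<omega>1 u v) + t1 u * wedge \<omega> \<omega>2 u v w \<and>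
     ext_d \<Y> \<omega>2 u v w = (f u v * \<omega>2 u w - f u w * \<omega>2 u v) - 3 * (g u v * \<omega>2 u w - g u w * \<omega>2 u v) - t2 u * wedge \<omega> \<omega>1 u v w"
      using curv[OF u, of v w] unfolding curvature_bmat[OF \<pi> f g eq u] mat3_nth wedge_def[of f] wedge_def[of g]
      by (simp add: algebra_simps)
  qed
  from connection_data_eq[OF u this] show "\<pi> u = connection u"
    using bspec[OF eq u] connection_eq[OF u] by (simp add: fun_eq_iff)
qed

end

theorem proposition2p5:
  fixes \<A> :: "('m, real^3) atlas"
    and T1 T2 L :: "'m \<Rightarrow> (real^3) set"
  assumes "smooth_manifold \<A>"
    and "enriched_path_structure \<A> T1 T2 L"
  shows "let Y = coframe_bundle \<A> T1 T2 L;
             \<Y> = coframe_atlas \<A> T1 T2 L;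
             \<omega> = taut \<A> \<Y>; \<omega>1 = taut1 \<A> \<Y>; \<omega>2 = taut2 \<A> \<Y>
         in \<exists>!\<pi>. \<pi> \<in> extensional Y \<and> cartan_connection \<Y> Y \<pi> \<and>
           (\<exists>\<phi> w. smooth_form1 \<Y> Y \<phi> \<and> smooth_form1 \<Y> Y w \<and>
             (\<forall>u\<in>Y. \<forall>v. \<pi> u v =
                mat3 (\<phi> u v + w u v)  0               0
                     (\<omega>1 u v)         (- 2 * w u v)   0
                     (\<omega> u v)          (\<omega>2 u v)        (- \<phi> u v + w u v))) \<and>
           (\<exists>A B C D S \<tau>1 \<tau>2.
             (\<forall>f \<in> {A, B, C, D, S, \<tau>1, \<tau>2}. smooth_fun \<Y> Y f) \<and>
             (let \<psi> = (\<lambda>u v. A u * \<omega>1 u v + B u * \<omega>2 u v);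
                  W = (\<lambda>u v v'. C u * wedge \<omega> \<omega>1 u v v' + D u * wedge \<omega> \<omega>2 u v v' +
                         S u * wedge \<omega>1 \<omega>2 u v v')
              in \<forall>u\<in>Y. \<forall>v v'. curvature \<Y> \<pi> u v v' =
                mat3 (wedge \<omega> \<psi> u v v' + W u v v')  0                              0
                     (\<tau>1 u * wedge \<omega> \<omega>2 u v v')     (- 2 * W u v v')               0
                     0                              (- \<tau>2 u * wedge \<omega> \<omega>1 u v v')  (- wedge \<omega> \<psi> u v v' + W u v v')))"
proof -
  interpret E: enriched_manifold \<A> T1 T2 L
    using assms by unfold_locales (simp_all add: smooth_manifold_def)
  show ?thesis
    unfolding Let_def
  proof (rule ex1I[of _ E.connection], intro conjI, goal_cases)
    case 1
    show ?case by (simp add: E.connection_def)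
  next
    case 2
    show ?case by (rule E.cartan_connection)
  next
    case 3
    show ?case using E.smooth_connection E.connection_eq unfolding bmat_def by blast
  next
    case 4
    show ?case
      by (intro exI conjI ballI allI) (rule E.smooth_coefficients, assumption, rule E.curvature_connection, assumption)
  next
    case (5 \<pi>)
    then obtain f g where fg: "smooth_form1 E.\<Y> E.Y f" "smooth_form1 E.\<Y> E.Y g"
      "\<forall>u\<in>E.Y. \<forall>v. \<pi> u v = bmat (f u v) (g u v) (E.\<omega> u v) (E.\<omega>1 u v) (E.\<omega>2 u v)"
      unfolding bmat_def by blast
    from 5 obtain t1 t2 where "\<And>u v w. u \<in> E.Y \<Longrightarrow> curvature E.\<Y> \<pi> u v w $ 2 $ 1 = t1 u * wedge E.\<omega> E.\<omega>2 u v w \<and>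
      curvature E.\<Y> \<pi> u v w $ 3 $ 1 = 0 \<and> curvature E.\<Y> \<pi> u v w $ 3 $ 2 = - t2 u * wedge E.\<omega> E.\<omega>1 u v w"
      by (elim conjE exE) (simp only: mat3_nth)
    with fg 5 show "\<pi> = E.connection"
      by (intro E.connection_unique[of \<pi> f g t1 t2]) (auto simp: cartan_connection_def)
  qed
qed

end
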